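(* Let $G$ be a finite group and let $\Gamma=\mathrm{SC}(G,T_{11},T_{22},T_{12},T_{21})$ be a quasi-abelian semi-Cayley digraph. Let $m$ be the exponent of $G$ and $\omega_m$ a primitive $m$-th root of unity. Define the multisets $I_1:=T_{11}\cup T_{22}$, $I_2:=(T_{11}T_{11})\cup(T_{22}T_{22})\cup(4*T_{12}T_{21})$, $I_3:=2*T_{11}T_{22}$. Let $$T=\{t\in\mathbb{Z}_m^*\mid (I_1)^t=I_1,\ (I_2\setminus I_3)^t=I_2\setminus I_3,\ (I_3\setminus I_2)^t=I_3\setminus I_2\},$$ $$K=\mathbb{Q}\big(\chi(I_1),\ \chi(I_2\setminus I_3)-\chi(I_3\setminus I_2)\ \big|\ \chi\in\mathrm{Irr}(G)\big),$$ $$M=\big\langle [d_\chi(\chi(I_2\setminus I_3)-\chi(I_3\setminus I_2))]_K\ \big|\ \chi\in\mathrm{Irr}(G)\big\rangle\le K^\times/K^{\times 2}.$$ Then $K=\{x\in\mathbb{Q}(\omega_m)\mid\sigma(x)=x\text{ for all }\sigma\in\eta^{-1}(T)\}$, the splitting field of $\Gamma$ is $$\mathrm{SF}(\Gamma)=\mathbb{Q}\big(\chi(I_1),\sqrt{d_\chi(\chi(I_2\setminus I_3)-\chi(I_3\setminus I_2))}\ \big|\ \chi\in\mathrm{Irr}(G)\big)=K\big(\sqrt{d_\chi(\chi(I_2\setminus I_3)-\chi(I_3\setminus I_2))}\ \big|\ \chi\in\mathrm{Irr}(G)\big),$$ and the algebraic degree of $\Gamma$ is $$\deg(\Gamma)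=\frac{\varphi(m)\,|M|}{|T|}.$$
   Context: For subsets $T_{ij}$ ($i,j\in\{1,2\}$) of a finite group $G$, $\mathrm{SC}(G,T_{11},T_{22},T_{12},T_{21})$ is the digraph with vertex set $G_1\cup G_2$ (disjoint copies $G_i=\{g_i\mid g\in G\}$) and arc set $\bigcup_{i,j}\{(h_i,g_j)\mid g,h\in G,\ gh^{-1}\in T_{ij}\}$. It is quasi-abelian if each $T_{ij}$ is a union of conjugacy classes of $G$ (equivalently, conjugate-closed). The splitting field $\mathrm{SF}(\Gamma)$ is the smallest extension of $\mathbb{Q}$ (inside $\mathbb{C}$) containing all eigenvalues of the adjacency matrix of $\Gamma$; the algebraic degree is $\deg(\Gamma)=[\mathrm{SF}(\Gamma):\mathbb{Q}]$. Multisets: all unions are multiset unions (multiplicities added). For multisets $X,Y$ in $G$: $XY=[xy\mid x\in X,y\in Y]$ as a multiset (empty if $X$ or $Y$ is empty); $X^t=[x^t\mid x\in X]$ as a multiset (for $t\in\mathbb{Z}_m^*$, with $m$ the exponent of $G$, this is well defined); $k*X$ is the multiset in which each element of $X$ appears $k$ times (as often as in $X$). If $x\in G$ has multiplicity $a_x\ge 0$ in $X$ and $b_x\ge 0$ in $Y$, then $X\setminus Y$ is the multiset in which $x$ has multiplicity $\max(a_x-b_x,0)$. Characters: $\mathrm{Irr}(G)$ is the set of irreducible complex characters of $G$, $d_\chi=\chi(1)$, and for a multiset $A$ in $G$, $\chi(A)=\sum_{a\in A}\chi(a)$ (with multiplicity; $\chi(\emptyset)=0$). The exponent $m$ is the least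 common multiple of the orders of elements of $G$; $\mathbb{Z}_m^*$ is the unit group of $\mathbb{Z}/m\mathbb{Z}$; $\varphi$ is the Euler function; $\eta:\mathrm{Gal}(\mathbb{Q}(\omega_m)/\mathbb{Q})\to\mathbb{Z}_m^*$ is the isomorphism sending $\sigma$ to the $t$ with $\sigma(\omega_m)=\omega_m^t$. For a field $K$, $K^\times=K\setminus\{0\}$, $K^{\times2}=\{k^2\mid k\in K^\times\}$, and $[k]_K$ is the image of $k\in K^\times$ in $K^\times/K^{\times2}$; in the definition of $M$, characters $\chi$ for which the element in brackets is $0$ are omitted from the generators. *)

theory Defs
  imports
    "Graph_Theory.Graph_Theory"
    "Jordan_Normal_Form.Spectral_Radius"
    "Jordan_Normal_Form.VS_Connect"
    "HOL-Number_Theory.Totient"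
    "HOL-Algebra.Algebra"
begin

section \<open>Semi-Cayley digraphs\<close>

text \<open>
  The two copies of \<open>g\<close> are \<open>g\<^sub>1 = Inl g\<close> and \<open>g\<^sub>2 = Inr g\<close>.
  Loops are allowed: they occur when the identity lies in \<open>T\<^sub>1\<^sub>1\<close> or \<open>T\<^sub>2\<^sub>2\<close>.
\<close>

definition semi_cayley ::
    "('a, 'b) monoid_scheme \<Rightarrow> 'a set \<Rightarrow> 'a set \<Rightarrow> 'a set \<Rightarrow> 'a set \<Rightarrow> ('a + 'a) pair_pre_digraph" where
  "semi_cayley G T11 T22 T12 T21 =
    \<lparr> pverts = carrier G <+> carrier G,
      parcs =
        {(Inl h, Inl g) | g h. g \<in> carrier G \<and> h \<in> carrier G \<and> g \<otimes>\<^bsub>G\<^esub> inv\<^bsub>G\<^esub> h \<in> T11} \<union>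
        {(Inr h, Inr g) | g h. g \<in> carrier G \<and> h \<in> carrier G \<and> g \<otimes>\<^bsub>G\<^esub> inv\<^bsub>G\<^esub> h \<in> T22} \<union>
        {(Inl h, Inr g) | g h. g \<in> carrier G \<and> h \<in> carrier G \<and> g \<otimes>\<^bsub>G\<^esub> inv\<^bsub>G\<^esub> h \<in> T12} \<union>
        {(Inr h, Inl g) | g h. g \<in> carrier G \<and> h \<in> carrier G \<and> g \<otimes>\<^bsub>G\<^esub> inv\<^bsub>G\<^esub> h \<in> T21} \<rparr>"

definition conj_class :: "('a, 'b) monoid_scheme \<Rightarrow> 'a \<Rightarrow> 'a set" where
  "conj_class G x = {g \<otimes>\<^bsub>G\<^esub> x \<otimes>\<^bsub>G\<^esub> inv\<^bsub>G\<^esub> g | g. g \<in> carrier G}"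

definition union_of_conj_classes :: "('a, 'b) monoid_scheme \<Rightarrow> 'a set \<Rightarrow> bool" where
  "union_of_conj_classes G S \<longleftrightarrow> (\<exists>R \<subseteq> carrier G. S = (\<Union>x\<in>R. conj_class G x))"

text \<open>Quasi-abelianness of \<^term>\<open>semi_cayley G T11 T22 T12 T21\<close>, as a property of the defining data.\<close>

definition quasi_abelian ::
    "('a, 'b) monoid_scheme \<Rightarrow> 'a set \<Rightarrow> 'a set \<Rightarrow> 'a set \<Rightarrow> 'a set \<Rightarrow> bool" where
  "quasi_abelian G T11 T22 T12 T21 \<longleftrightarrow>
    union_of_conj_classes G T11 \<and> union_of_conj_classes G T22 \<and>
    union_of_conj_classes G T12 \<and> union_of_conj_classes G T21"


section \<open>Subfields of the complex numbers\<close>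

abbreviation complex_field :: "complex ring" where
  "complex_field \<equiv> class_ring"

definition adjoin :: "complex set \<Rightarrow> complex set \<Rightarrow> complex set" where
  "adjoin F S = generate_field complex_field (F \<union> S)"

definition ext_degree :: "complex set \<Rightarrow> complex set \<Rightarrow> nat" where
  "ext_degree L F = ring.dim complex_field F L"

definition galois_group :: "complex set \<Rightarrow> complex set \<Rightarrow> (complex \<Rightarrow> complex) set" where
  "galois_group L F =
    {\<sigma> \<in> extensional L.
       \<sigma> \<in> ring_iso (complex_field\<lparr>carrier := L\<rparr>) (complex_field\<lparr>carrier := L\<rparr>) \<and>
       (\<forall>x\<in>F. \<sigma> x = x)}"

definition primitive_root_of_unity :: "nat \<Rightarrow> complex \<Rightarrow> bool" where
  "primitive_root_of_unity m \<omega> \<longleftrightarrow> 0 < m \<and> \<omega> ^ m = 1 \<and> (\<forall>k\<in>{0<..<m}. \<omega> ^ k \<noteq> 1)"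

text \<open>
  Units modulo \<open>m\<close> are represented by \<^term>\<open>totatives m\<close>; for \<open>m = 1\<close> this is \<open>{1}\<close>,
  the trivial group.
\<close>

definition cyclotomic_char :: "nat \<Rightarrow> complex \<Rightarrow> (complex \<Rightarrow> complex) \<Rightarrow> nat" where
  "cyclotomic_char m \<omega> \<sigma> = (THE t. t \<in> totatives m \<and> \<sigma> \<omega> = \<omega> ^ t)"

definition mult_group :: "complex set \<Rightarrow> complex monoid" where
  "mult_group K = mult_of (complex_field\<lparr>carrier := K\<rparr>)"

definition nonzero_squares :: "complex set \<Rightarrow> complex set" where
  "nonzero_squares K = {k ^ 2 | k. k \<in> K - {0}}"

definition square_class_group :: "complex set \<Rightarrow> complex set monoid" where
  "square_class_group K = mult_group K Mod nonzero_squares K"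

definition square_class :: "complex set \<Rightarrow> complex \<Rightarrow> complex set" where
  "square_class K k = nonzero_squares K #>\<^bsub>mult_group K\<^esub> k"


section \<open>Adjacency matrix, splitting field and algebraic degree of a digraph\<close>

text \<open>
  A matrix needs an ordering of the vertices. We fix an arbitrary one; another choice
  conjugates the matrix by a permutation matrix and so has the same eigenvalues.
\<close>

definition vertex_list :: "'v pair_pre_digraph \<Rightarrow> 'v list" where
  "vertex_list D = (SOME vs. distinct vs \<and> set vs = pverts D)"

definition adjacency_matrix :: "'v pair_pre_digraph \<Rightarrow> complex mat" where
  "adjacency_matrix D =
    (let vs = vertex_list D; n = length vs
     in mat n n (\<lambda>(i, j). if (vs ! i, vs ! j) \<in> parcs D then 1 else 0))"

definition splitting_field :: "'v pair_pre_digraph \<Rightarrow> complex set" where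
  "splitting_field D = adjoin \<rat> (spectrum (adjacency_matrix D))"

definition algebraic_degree :: "'v pair_pre_digraph \<Rightarrow> nat" where
  "algebraic_degree D = ext_degree (splitting_field D) \<rat>"


section \<open>Multisets in a group\<close>

definition mset_prod :: "('a, 'b) monoid_scheme \<Rightarrow> 'a multiset \<Rightarrow> 'a multiset \<Rightarrow> 'a multiset" where
  "mset_prod G A B = (\<Sum>x\<in>#A. image_mset (\<lambda>y. x \<otimes>\<^bsub>G\<^esub> y) B)"

definition mset_pow :: "('a, 'b) monoid_scheme \<Rightarrow> 'a multiset \<Rightarrow> nat \<Rightarrow> 'a multiset" where
  "mset_pow G A t = image_mset (\<lambda>x. x [^]\<^bsub>G\<^esub> t) A"

definition group_exponent :: "('a, 'b) monoid_scheme \<Rightarrow> nat" where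
  "group_exponent G = Lcm (group.ord G ` carrier G)"


section \<open>Irreducible complex characters\<close>

definition mat_trace :: "complex mat \<Rightarrow> complex" where
  "mat_trace A = sum_list (diag_mat A)"

text \<open>
  A representation of degree \<open>n\<close> is a homomorphism into \<open>GL\<^sub>n\<close>, the group of units of the
  ring of complex \<open>n \<times> n\<close> matrices.
\<close>

definition representation ::
    "('a, 'b) monoid_scheme \<Rightarrow> nat \<Rightarrow> ('a \<Rightarrow> complex mat) \<Rightarrow> bool" where
  "representation G n \<rho> \<longleftrightarrow> \<rho> \<in> hom G (units_of (ring_mat TYPE(complex) n ()))"

definition irreducible_representation ::
    "('a, 'b) monoid_scheme \<Rightarrow> nat \<Rightarrow> ('a \<Rightarrow> complex mat) \<Rightarrow> bool" where
  "irreducible_representation G n \<rho> \<longleftrightarrow>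
    representation G n \<rho> \<and> 0 < n \<and>
    (\<forall>W. VectorSpace.subspace complex_field W (module_vec TYPE(complex) n) \<and>
         (\<forall>g\<in>carrier G. \<forall>w\<in>W. \<rho> g *\<^sub>v w \<in> W) \<longrightarrow>
         W = {0\<^sub>v n} \<or> W = carrier_vec n)"

definition irr_chars :: "('a, 'b) monoid_scheme \<Rightarrow> ('a \<Rightarrow> complex) set" where
  "irr_chars G =
    {(\<lambda>g\<in>carrier G. mat_trace (\<rho> g)) | n \<rho>. irreducible_representation G n \<rho>}"

definition char_sum :: "('a \<Rightarrow> complex) \<Rightarrow> 'a multiset \<Rightarrow> complex" where
  "char_sum \<chi> A = (\<Sum>a\<in>#A. \<chi> a)"

end

theory Submission
  imports Defs
begin

text \<open>Let \<open>\<chi>\<close> be an irreducible character of degree \<open>d\<close>, afforded by \<open>\<rho>\<close>. By Schur's lemma the sum of \<open>\<rho>\<close>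
  over a union \<open>S\<close> of conjugacy classes is the scalar \<open>\<chi>(S)/d\<close>. On functions built from the matrix
  entries of \<open>\<rho>\<close> the adjacency operator therefore acts as the 2 by 2 matrix \<open>(\<chi>(T\<^sub>i\<^sub>j)/d)\<close>, whose
  eigenvalues are \<open>(\<chi>(I\<^sub>1) \<plusminus> \<surd>(\<Delta> \<chi>)) / (2 d)\<close>. Conversely an eigenspace is invariant under right
  translation, hence contains an irreducible constituent (\<open>irreducible_constituent\<close>), whose values at
  the identity yield an eigenvector of that 2 by 2 matrix. So \<open>spectrum_semi_cayley\<close> is the full
  spectrum, and sums and differences of the two eigenvalues give both descriptions of the splitting
  field.

  For the base field \<open>K\<close>: an automorphism \<open>\<sigma>\<close> of \<open>\<rat>(\<omega>)\<close> with \<open>\<sigma> \<omega> = \<omega>\<^sup>t\<close> sends \<open>\<chi>(A)\<close> to \<open>\<chi>(A\<^sup>t)\<close>,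
  because character values are sums of \<open>m\<close>-th roots of unity. Irreducible characters separate
  conjugation-invariant multisets (\<open>class_mset_determined_by_characters\<close>), so \<open>\<sigma>\<close> fixes the
  generators of \<open>K\<close> exactly when \<open>t \<in> T\<close>; the two differences are separated from each other because
  they are disjoint and taking powers preserves size (\<open>disjoint_mset_eq_of_cross_sum\<close>). Hence \<open>T\<close> is the
  set of exponents of the conjugates of \<open>\<omega>\<close> over \<open>K\<close>, and the locale \<open>root_of_unity_extension\<close> gives both
  \<open>K\<close> as a fixed field and \<open>[\<rat>(\<omega>) : K] = |T|\<close>. Over \<open>\<rat>\<close> every exponent prime to \<open>m\<close> occurs; this is the
  irreducibility of the cyclotomic polynomial (\<open>ipoly_root_coprime_power\<close>), so \<open>[K : \<rat>] = \<phi>(m)/|T|\<close>.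

  Finally the splitting field arises from \<open>K\<close> by adjoining square roots of elements of \<open>K\<close>, and by
  Kummer theory for exponent 2 its degree over \<open>K\<close> is the order of the group generated by the square
  classes of the radicands (\<open>multiquadratic_extension\<close>).\<close>

(* These constants share their names with operations on univariate polynomials and with primality of
   numbers, which are meant below. *)
hide_const (open) up_ring.coeff up_ring.monom Polynomials.degree Polynomials.lead_coeff Divisibility.prime module.smult

section \<open>Subfields of the complex numbers and simple extensions\<close>

lemma field_complex: "field complex_field" by (rule class_field)
lemma domain_complex: "domain complex_field" using field_complex by (rule field.axioms(1))
lemma ring_complex: "ring complex_field" by (rule cring.axioms(1)[OF domain.axioms(1)[OF domain_complex]])

abbreviation ext_dim :: "nat \<Rightarrow> complex set \<Rightarrow> complex set \<Rightarrow> bool" where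
  "ext_dim \<equiv> ring.dimension complex_field"

text \<open>A subfield is a set closed under the field operations. The inverse of \<open>0\<close> is \<open>0\<close>, so closure under
  \<open>inverse\<close> may be stated for all elements. The equivalence with the record-based notion is
  \<open>complex_subfield_iff\<close>.\<close>

locale complex_subfield =
  fixes K :: "complex set"
  assumes one_mem [simp, intro]: "1 \<in> K"
    and uminus_mem: "x \<in> K \<Longrightarrow> - x \<in> K"
    and inverse_mem: "x \<in> K \<Longrightarrow> inverse x \<in> K"
    and add_mem: "x \<in> K \<Longrightarrow> y \<in> K \<Longrightarrow> x + y \<in> K"
    and mult_mem: "x \<in> K \<Longrightarrow> y \<in> K \<Longrightarrow> x * y \<in> K"
begin

lemma zero_mem [simp, intro]: "0 \<in> K"
  using add_mem[OF one_mem uminus_mem[OF one_mem]] by simp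

lemma diff_mem: "x \<in> K \<Longrightarrow> y \<in> K \<Longrightarrow> x - y \<in> K"
  using add_mem[OF _ uminus_mem] by fastforce

lemma divide_mem: "x \<in> K \<Longrightarrow> y \<in> K \<Longrightarrow> x / y \<in> K"
  using mult_mem[OF _ inverse_mem] by (simp add: divide_inverse)

lemma power_mem: "x \<in> K \<Longrightarrow> x ^ n \<in> K"
  by (induct n) (auto intro: mult_mem)

lemma sum_mem: "(\<And>i. i \<in> A \<Longrightarrow> f i \<in> K) \<Longrightarrow> sum f A \<in> K"
  by (induct A rule: infinite_finite_induct) (auto intro: add_mem)

lemma of_nat_mem [simp, intro]: "of_nat n \<in> K"
  by (induct n) (auto intro: add_mem)

lemma of_int_mem [simp, intro]: "of_int n \<in> K"
  by (cases n rule: int_cases2) (auto intro: uminus_mem)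

lemma numeral_mem [simp, intro]: "numeral n \<in> K"
  using of_nat_mem[of "numeral n"] by simp

lemma Rats_subset: "\<rat> \<subseteq> K"
proof
  fix x :: complex assume "x \<in> \<rat>"
  then show "x \<in> K" by (cases x rule: Rats_cases') (auto intro: divide_mem)
qed

end

lemma complex_subfield_iff: "complex_subfield K \<longleftrightarrow> subfield K complex_field"
proof
  assume K: "complex_subfield K"
  interpret complex_subfield K by (rule K)
  have "subring K complex_field"
    by (rule ring.subringI[OF ring_complex]) (auto simp: class_ring_simps intro: uminus_mem add_mem mult_mem)
  then show "subfield K complex_field"
    by (rule field.subfieldI'[OF field_complex]) (auto simp: class_ring_simps intro: inverse_mem)
next
  assume K: "subfield K complex_field"
  note sr = subringE[OF subfieldE(1)[OF K]]
  show "complex_subfield K"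
  proof
    show "1 \<in> K" using sr(3) by simp
    show "- x \<in> K" if "x \<in> K" for x using sr(5)[OF that] by (simp add: class_ring_simps)
    show "x + y \<in> K" if "x \<in> K" "y \<in> K" for x y using sr(7)[OF that] by simp
    show "x * y \<in> K" if "x \<in> K" "y \<in> K" for x y using sr(6)[OF that] by simp
    show "inverse x \<in> K" if "x \<in> K" for x
      using ring.subfield_m_inv(1)[OF ring_complex K, of x] that
      by (cases "x = 0") (auto simp: class_ring_simps)
  qed
qed

lemma Rats_subfield: "complex_subfield \<rat>"
  by standard auto

lemma adjoin_subfield: "complex_subfield (adjoin F S)"
  unfolding complex_subfield_iff adjoin_def
  by (rule field.generate_field_is_subfield[OF field_complex]) simp

lemma base_subset_adjoin: "F \<subseteq> adjoin F S"
  unfolding adjoin_def by (auto intro: generate_field.incl)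

lemma gens_subset_adjoin: "S \<subseteq> adjoin F S"
  unfolding adjoin_def by (auto intro: generate_field.incl)

lemma adjoin_least: "complex_subfield E \<Longrightarrow> F \<subseteq> E \<Longrightarrow> S \<subseteq> E \<Longrightarrow> adjoin F S \<subseteq> E"
  unfolding complex_subfield_iff adjoin_def
  by (rule field.generate_field_min_subfield1[OF field_complex]) auto

lemma adjoin_Rats_subset: "complex_subfield E \<Longrightarrow> S \<subseteq> E \<Longrightarrow> adjoin \<rat> S \<subseteq> E"
  by (rule adjoin_least) (auto dest: complex_subfield.Rats_subset)

lemma adjoin_adjoin: "adjoin (adjoin F S) S' = adjoin F (S \<union> S')"
proof (rule antisym)
  show "adjoin (adjoin F S) S' \<subseteq> adjoin F (S \<union> S')"
    by (meson Un_subset_iff adjoin_least adjoin_subfield base_subset_adjoin gens_subset_adjoin)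
  show "adjoin F (S \<union> S') \<subseteq> adjoin (adjoin F S) S'"
    by (intro adjoin_least adjoin_subfield Un_least order_trans[OF _ base_subset_adjoin]
        base_subset_adjoin gens_subset_adjoin)
qed

subsection \<open>Polynomials over a subfield\<close>

text \<open>Polynomials over a subfield are complex polynomials with restricted coefficients, so that one
  polynomial can be evaluated in several extensions of its coefficient field.\<close>

definition polys_over :: "complex set \<Rightarrow> complex poly set" where
  "polys_over K = {p. \<forall>i. coeff p i \<in> K}"

lemma polys_over_mono: "K \<subseteq> L \<Longrightarrow> polys_over K \<subseteq> polys_over L"
  by (auto simp: polys_over_def)

context complex_subfield
begin

lemma polys_over_0 [simp, intro]: "0 \<in> polys_over K"
  and polys_over_1 [simp, intro]: "1 \<in> polys_over K"
  by (auto simp: polys_over_def coeff_1)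

lemma polys_over_const: "c \<in> K \<Longrightarrow> [:c:] \<in> polys_over K"
  by (auto simp: polys_over_def coeff_pCons split: nat.split)

lemma polys_over_pCons: "c \<in> K \<Longrightarrow> p \<in> polys_over K \<Longrightarrow> pCons c p \<in> polys_over K"
  by (auto simp: polys_over_def coeff_pCons split: nat.split)

lemma polys_over_monom: "c \<in> K \<Longrightarrow> monom c n \<in> polys_over K"
  by (auto simp: polys_over_def)

lemma polys_over_add: "p \<in> polys_over K \<Longrightarrow> q \<in> polys_over K \<Longrightarrow> p + q \<in> polys_over K"
  and polys_over_diff: "p \<in> polys_over K \<Longrightarrow> q \<in> polys_over K \<Longrightarrow> p - q \<in> polys_over K"
  and polys_over_mult: "p \<in> polys_over K \<Longrightarrow> q \<in> polys_over K \<Longrightarrow> p * q \<in> polys_over K"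
  by (auto simp: polys_over_def coeff_mult intro: add_mem diff_mem uminus_mem sum_mem mult_mem)

lemma poly_mem: "p \<in> polys_over K \<Longrightarrow> x \<in> K \<Longrightarrow> poly p x \<in> K"
  by (auto simp: poly_altdef polys_over_def intro!: sum_mem mult_mem power_mem)

lemma polys_over_division:
  assumes g: "g \<in> polys_over K" "g \<noteq> 0" and "f \<in> polys_over K"
  shows "\<exists>q r. q \<in> polys_over K \<and> r \<in> polys_over K \<and> f = g * q + r \<and> (r = 0 \<or> degree r < degree g)"
  using assms(3)
proof (induct "degree f" arbitrary: f rule: less_induct)
  case less
  show ?case
  proof (cases "f = 0 \<or> degree f < degree g")
    case True
    then show ?thesis using less.prems by (intro exI[of _ 0] exI[of _ f]) auto
  next
    case False
    define h where "h = monom (lead_coeff f / lead_coeff g) (degree f - degree g)"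
    have h: "h \<in> polys_over K" using g(1) less.prems
      by (auto simp: h_def polys_over_def intro!: divide_mem)
    have f': "f - g * h \<in> polys_over K" by (intro polys_over_diff polys_over_mult less.prems g h)
    have hn: "h \<noteq> 0" using False g by (auto simp: h_def)
    have lf: "lead_coeff f / lead_coeff g \<noteq> 0" using False g by simp
    have dh: "degree h = degree f - degree g" unfolding h_def by (rule degree_monom_eq[OF lf])
    have dgh: "degree (g * h) = degree f" using False g hn
      by (subst degree_mult_eq) (auto simp: dh)
    have lh: "lead_coeff h = lead_coeff f / lead_coeff g" unfolding dh by (simp add: h_def)
    have lgh: "lead_coeff (g * h) = lead_coeff f" using g
      by (simp only: lead_coeff_mult lh) simp
    have "f - g * h = 0 \<or> degree (f - g * h) < degree f"
      using dgh lgh by (metis coeff_diff degree_diff_le_max diff_self leading_coeff_0_iff max.idem nat_less_le)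
    then obtain q r where "q \<in> polys_over K" "r \<in> polys_over K" "f - g * h = g * q + r"
        "r = 0 \<or> degree r < degree g"
      using less.hyps[OF _ f'] by (metis add_0_right mult_zero_right polys_over_0)
    then show ?thesis using h
      by (intro exI[of _ "q + h"] exI[of _ r]) (auto simp: algebra_simps intro: polys_over_add)
  qed
qed

lemma polys_over_mod: "g \<in> polys_over K \<Longrightarrow> f \<in> polys_over K \<Longrightarrow> f mod g \<in> polys_over K"
proof (cases "g = 0")
  case False
  assume g: "g \<in> polys_over K" and f: "f \<in> polys_over K"
  obtain q r where qr: "q \<in> polys_over K" "r \<in> polys_over K" "f = g * q + r" "r = 0 \<or> degree r < degree g"
    using polys_over_division[OF g False f] by auto
  have "f mod g = r" using qr(3,4) mod_poly_less by (auto simp: mod_add_left_eq[symmetric])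
  then show ?thesis using qr by simp
qed auto

end

text \<open>The minimal polynomial is characterised by the ideal that it generates, not as an
  irreducible polynomial: divisibility is how it is used below.\<close>

definition is_min_poly :: "complex set \<Rightarrow> complex \<Rightarrow> complex poly \<Rightarrow> bool" where
  "is_min_poly K x f \<longleftrightarrow> f \<in> polys_over K \<and> lead_coeff f = 1 \<and> poly f x = 0 \<and>
     (\<forall>p \<in> polys_over K. poly p x = 0 \<longrightarrow> f dvd p)"

text \<open>A monic polynomial of least degree with root \<open>x\<close> divides all others with that root, since the
  remainder has root \<open>x\<close> as well and its coefficients stay in \<open>K\<close>.\<close>

lemma (in complex_subfield) min_poly_exists:
  assumes "g \<in> polys_over K" "g \<noteq> 0" "poly g x = 0"
  obtains f where "is_min_poly K x f"
proof -
  define P where "P = (\<lambda>f. f \<in> polys_over K \<and> f \<noteq> 0 \<and> poly f x = 0)"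
  define f where "f = arg_min degree P"
  have P: "P f" and min: "\<And>p. P p \<Longrightarrow> degree f \<le> degree p"
    using arg_min_nat_lemma[of P g degree] assms unfolding P_def[symmetric] f_def
    by (auto simp: P_def)
  define h where "h = [:inverse (lead_coeff f):] * f"
  have h: "h \<in> polys_over K" "lead_coeff h = 1" "poly h x = 0" "degree h = degree f"
    using P by (auto simp: h_def P_def intro!: polys_over_mult polys_over_const inverse_mem)
      (auto simp: polys_over_def intro: mult_mem inverse_mem)
  have "h dvd p" if p: "p \<in> polys_over K" "poly p x = 0" for p
  proof -
    have "p mod h = 0"
    proof (rule ccontr)
      assume n: "p mod h \<noteq> 0"
      have "p mod h = p - h * (p div h)" by (simp add: minus_mult_div_eq_mod)
      then have "P (p mod h)" using polys_over_mod[OF h(1) p(1)] n h(3) p(2) by (simp add: P_def)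
      with min have "degree h \<le> degree (p mod h)" using h(4) by simp
      moreover have "h \<noteq> 0" using h(2) by auto
      ultimately show False using degree_mod_less'[of h p] n by auto
    qed
    then show ?thesis by auto
  qed
  then have "is_min_poly K x h" using h by (auto simp: is_min_poly_def)
  then show thesis by (rule that)
qed

lemma simple_extension_complex:
  assumes "complex_subfield K"
  shows "ring.simple_extension complex_field K x = {poly p x | p. p \<in> polys_over K}"
proof -
  interpret complex_subfield K by fact
  note defs = ring.simple_extension.intros[OF ring_complex, where K = K and x = x, simplified]
  show ?thesis
  proof (intro antisym subsetI)
    fix y assume "y \<in> ring.simple_extension complex_field K x"
    then show "y \<in> {poly p x | p. p \<in> polys_over K}"
    proof (induct y rule: ring.simple_extension.induct[OF ring_complex, consumes 1, case_names zero lin])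
      case zero then show ?case by (auto intro: exI[of _ 0])
    next
      case (lin k1 k2)
      then obtain p where "k1 = poly p x" "p \<in> polys_over K" by auto
      with lin show ?case by (auto intro!: exI[of _ "pCons k2 p"] polys_over_pCons simp: algebra_simps)
    qed
  next
    fix y assume "y \<in> {poly p x | p. p \<in> polys_over K}"
    then obtain p where y: "y = poly p x" and p: "p \<in> polys_over K" by auto
    from p have "poly p x \<in> ring.simple_extension complex_field K x"
    proof (induct p)
      case 0 then show ?case using defs(1) by simp
    next
      case (pCons a p)
      have "a \<in> K" "p \<in> polys_over K" using pCons.prems
        by (auto simp: polys_over_def coeff_pCons split: nat.splits)
      then show ?case using defs(2)[OF pCons.hyps(2)] by (simp add: algebra_simps)
    qed
    then show "y \<in> ring.simple_extension complex_field K x" using y by simp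
  qed
qed

text \<open>Abstract polynomials are lists with the leading coefficient first.\<close>

lemma eval_complex: "ring.eval complex_field xs x = poly (Poly (rev xs)) x"
proof (induct xs)
  case Nil
  show ?case by (simp add: ring.eval.simps[OF ring_complex])
next
  case (Cons a xs)
  then show ?case
    by (simp add: ring.eval.simps[OF ring_complex] class_ring_simps Poly_append poly_monom algebra_simps)
qed

text \<open>The degree formula for simple extensions is known for the list-based minimal polynomial \<open>Irr\<close>. That
  polynomial and \<open>f\<close> divide each other, so their degrees agree.\<close>

lemma simple_extension_min_poly:
  assumes K: "complex_subfield K" and f: "is_min_poly K x f"
  shows "adjoin K {x} = {poly p x | p. p \<in> polys_over K}"
    and "ext_dim (degree f) K (adjoin K {x})"
proof -
  interpret complex_subfield K by fact
  have sf: "subfield K complex_field" using K by (simp add: complex_subfield_iff)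
  have sr: "subring K complex_field" using sf by (rule subfieldE(1))
  define fl where "fl = rev (coeffs f)"
  have fn: "f \<noteq> 0" using f by (auto simp: is_min_poly_def)
  have fl: "fl \<in> carrier (univ_poly complex_field K)" "fl \<noteq> []" "ring.eval complex_field fl x = 0"
  proof -
    have "set fl \<subseteq> K" using f by (auto simp: fl_def is_min_poly_def polys_over_def coeffs_def)
    moreover have "hd fl \<noteq> 0" using fn by (simp add: fl_def hd_rev last_coeffs_eq_coeff_degree)
    ultimately show "fl \<in> carrier (univ_poly complex_field K)"
      by (auto simp: univ_poly_def polynomial_def)
    show "fl \<noteq> []" using fn by (simp add: fl_def)
    show "ring.eval complex_field fl x = 0" using f by (simp add: eval_complex fl_def is_min_poly_def)
  qed
  have alg: "(ring.algebraic complex_field over K) x"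
    using ring.algebraicI[OF ring_complex fl(1,2)] fl(3) by simp
  have alg': "\<not> (ring.transcendental complex_field over K) x" using alg by (simp add: over_def)
  have ext: "adjoin K {x} = ring.simple_extension complex_field K x"
  proof (rule antisym)
    have "complex_subfield (ring.simple_extension complex_field K x)"
      unfolding complex_subfield_iff
      using domain.simple_extension_is_subfield[OF domain_complex sf, of x] alg' by (simp add: over_def)
    then show "adjoin K {x} \<subseteq> ring.simple_extension complex_field K x"
    proof (rule adjoin_least)
      have "k = poly [:k:] x \<and> [:k:] \<in> polys_over K" if "k \<in> K" for k
        using that by (simp add: polys_over_const)
      then show "K \<subseteq> ring.simple_extension complex_field K x"
        unfolding simple_extension_complex[OF K] by blast
      have "x = poly [:0, 1:] x \<and> [:0, 1:] \<in> polys_over K"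
        by (simp add: polys_over_const polys_over_pCons)
      then show "{x} \<subseteq> ring.simple_extension complex_field K x"
        unfolding simple_extension_complex[OF K] by blast
    qed
    show "ring.simple_extension complex_field K x \<subseteq> adjoin K {x}"
    proof -
      interpret A: complex_subfield "adjoin K {x}" by (rule adjoin_subfield)
      show ?thesis
        using polys_over_mono[OF base_subset_adjoin[of K "{x}"]] gens_subset_adjoin[of "{x}" K]
        by (auto simp: simple_extension_complex[OF K] intro!: A.poly_mem)
    qed
  qed
  then show "adjoin K {x} = {poly p x | p. p \<in> polys_over K}"
    by (simp add: simple_extension_complex[OF K])
  define I where "I = ring.Irr complex_field K x"
  have xc: "x \<in> carrier complex_field" by simp
  note Irr = domain.IrrE[OF domain_complex sf xc alg, folded I_def]
  have hdI: "Poly (rev I) \<noteq> 0" "degree (Poly (rev I)) = length I - 1"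
  proof -
    have ne: "I \<noteq> []" by (rule domain.pirreducibleE(1)[OF domain_complex sr Irr(1,2)])
    then have hd: "hd I = 1" using Irr(3) by simp
    then have "coeffs (Poly (rev I)) = rev I" using ne by (cases I) auto
    then show "degree (Poly (rev I)) = length I - 1" by (simp add: degree_eq_length_coeffs)
    show "Poly (rev I) \<noteq> 0"
    proof
      assume "Poly (rev I) = 0"
      with \<open>coeffs (Poly (rev I)) = rev I\<close> have "rev I = []" by (metis coeffs_0_eq_Nil)
      with ne show False by simp
    qed
  qed
  have "Poly (rev I) \<in> polys_over K"
    using Irr(1) by (auto simp: univ_poly_def polynomial_def polys_over_def nth_default_def coeff_Poly_eq)
      (metis length_rev nth_mem set_rev subset_iff)
  moreover have "poly (Poly (rev I)) x = 0" using Irr(4) by (simp add: eval_complex)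
  ultimately have "f dvd Poly (rev I)" using f by (auto simp: is_min_poly_def)
  then have "degree f \<le> length I - 1" using dvd_imp_degree_le hdI by metis
  moreover have "length I - 1 \<le> degree f"
  proof -
    have "I pdivides\<^bsub>complex_field\<^esub> fl"
      using domain.Irr_minimal[OF domain_complex sf xc alg fl(1)] fl(3) unfolding I_def by simp
    then have "length I - 1 \<le> length fl - 1"
      using domain.pdivides_imp_degree_le[OF domain_complex sr Irr(1) fl(1,2)] by simp
    then show ?thesis using fn by (simp add: fl_def degree_eq_length_coeffs)
  qed
  ultimately have "length I - 1 = degree f" by simp
  then show "ext_dim (degree f) K (adjoin K {x})"
    using domain.dimension_simple_extension[OF domain_complex sf xc alg] unfolding ext I_def by simp
qed

section \<open>Galois conjugates of roots of unity over the rationals\<close>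

text \<open>All inner binomial coefficients \<open>p choose k\<close> are multiples of \<open>p\<close>.\<close>

lemma prime_dvd_add_power:
  fixes x y :: "'a :: comm_ring_1"
  assumes p: "prime p"
  shows "of_nat p dvd (x + y) ^ p - (x ^ p + y ^ p)"
proof -
  have p0: "p > 0" using p by (simp add: prime_gt_0_nat)
  define g where "g = (\<lambda>k. of_nat (p choose k) * x ^ k * y ^ (p - k) :: 'a)"
  have "(x + y) ^ p = (\<Sum>k\<le>p. g k)" unfolding g_def by (rule binomial_ring)
  also have "{..p} = insert 0 (insert p {0<..<p})" using p0 by auto
  also have "sum g \<dots> = g 0 + (g p + sum g {0<..<p})" using p0 by (subst sum.insert) auto
  finally have "(x + y) ^ p - (x ^ p + y ^ p) = sum g {0<..<p}" by (simp add: g_def)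
  moreover have "of_nat p dvd g k" if "k \<in> {0<..<p}" for k
  proof -
    have "p dvd (p choose k)" using that p by (intro dvd_choose_prime) auto
    then have "(of_nat p :: 'a) dvd of_nat (p choose k)" by (auto elim!: dvdE)
    then show ?thesis unfolding g_def by (intro dvd_mult2)
  qed
  ultimately show ?thesis by (auto intro: dvd_sum)
qed

text \<open>The congruence \<open>(b + 1)\<^sup>p \<equiv> b\<^sup>p + 1\<close> makes the claims for \<open>b\<close> and \<open>b + 1\<close> equivalent; induction in both
  directions from \<open>0\<close> then reaches all integers.\<close>

lemma fermat_little_int:
  fixes a :: int
  assumes p: "prime p"
  shows "int p dvd a ^ p - a"
proof -
  have step: "int p dvd (b + 1) ^ p - (b + 1) \<longleftrightarrow> int p dvd b ^ p - b" for b
  proof -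
    have "(b + 1) ^ p - (b + 1) = ((b + 1) ^ p - (b ^ p + 1 ^ p)) + (b ^ p - b)" by simp
    then show ?thesis using dvd_add_right_iff[OF prime_dvd_add_power[OF p, of b 1]] by (metis of_nat_id)
  qed
  show ?thesis
  proof (induct a rule: int_induct[of _ 0])
    case base
    then show ?case using p by (simp add: prime_gt_0_nat zero_power)
  next
    case (step1 i) then show ?case using step[of i] by simp
  next
    case (step2 i) then show ?case using step[of "i - 1"] by simp
  qed
qed

text \<open>The congruence \<open>g(x\<^sup>p) \<equiv> g(x)\<^sup>p\<close> modulo \<open>p\<close>: raising to the \<open>p\<close>-th power is additive modulo \<open>p\<close> and fixes
  integer coefficients.\<close>

lemma prime_dvd_pcompose_power:
  fixes g :: "int poly"
  assumes p: "prime p"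
  shows "of_nat p dvd g \<circ>\<^sub>p monom 1 p - g ^ p"
proof (induct g)
  case 0
  then show ?case using p by (simp add: prime_gt_0_nat zero_power)
next
  case (pCons a g)
  have X: "monom 1 p = (monom 1 1 :: int poly) ^ p" by (simp add: monom_power)
  have e: "pCons a g = [:a:] + monom 1 1 * g" by (simp add: monom_altdef)
  have "pCons a g \<circ>\<^sub>p monom 1 p - pCons a g ^ p
      = [:a - a ^ p:] + monom 1 p * (g \<circ>\<^sub>p monom 1 p - g ^ p)
        - (([:a:] + monom 1 1 * g) ^ p - ([:a:] ^ p + (monom 1 1 * g) ^ p))"
    unfolding e[symmetric] by (simp add: pcompose_pCons X power_mult_distrib algebra_simps poly_const_pow)
  moreover have "of_nat p dvd [:a - a ^ p:]"
    using fermat_little_int[OF p, of a]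
    by (metis const_poly_dvd dvd_minus_iff minus_diff_eq of_nat_poly)
  ultimately show ?case using pCons(2) prime_dvd_add_power[OF p]
    by (metis (no_types, lifting) dvd_add dvd_diff dvd_mult)
qed

abbreviation ipoly :: "int poly \<Rightarrow> complex \<Rightarrow> complex" where
  "ipoly p x \<equiv> poly (of_int_poly p) x"

lemma ipoly_mult: "ipoly (p * q) x = ipoly p x * ipoly q x"
  by (simp add: hom_distribs)

text \<open>Gauss's lemma for roots of unity. A primitive integer polynomial of least degree divides every
  integer polynomial with root \<open>\<omega>\<close>: pseudo-division shows this up to an integer factor, and primitivity
  removes the factor. As it divides the monic polynomial \<open>x\<^sup>m - 1\<close>, its leading coefficient is a unit.\<close>

lemma monic_int_min_poly:
  assumes "\<omega> ^ m = 1" "m > 0"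
  obtains g :: "int poly" where "lead_coeff g = 1" "ipoly g \<omega> = 0"
    "\<And>p. ipoly p \<omega> = 0 \<Longrightarrow> g dvd p"
proof -
  define u :: "int poly" where "u = monom 1 m - 1"
  have u: "ipoly u \<omega> = 0" "lead_coeff u = 1"
  proof -
    show "ipoly u \<omega> = 0" using assms by (simp add: u_def hom_distribs poly_monom)
    have "coeff u m = 1" using assms(2) by (simp add: u_def)
    moreover have "degree u \<le> m" unfolding u_def by (intro degree_diff_le) (auto simp: degree_monom_le)
    ultimately have "degree u = m" by (metis le_antisym le_degree zero_neq_one)
    then show "lead_coeff u = 1" using assms(2) by (simp add: u_def)
  qed
  have un: "u \<noteq> 0" using u by auto
  define P where "P = (\<lambda>g::int poly. g \<noteq> 0 \<and> ipoly g \<omega> = 0)"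
  define g0 where "g0 = arg_min degree P"
  have P: "P g0" and min: "\<And>p. P p \<Longrightarrow> degree g0 \<le> degree p"
    using arg_min_nat_lemma[of P u degree] u un unfolding P_def[symmetric] g0_def by (auto simp: P_def)
  define g where "g = primitive_part g0"
  have g: "P g" "degree g = degree g0" "content g = 1"
  proof -
    have e: "Polynomial.smult (content g0) g = g0" by (simp add: g_def content_times_primitive_part)
    have "ipoly g0 \<omega> = of_int (content g0) * ipoly g \<omega>"
      by (subst e[symmetric]) (simp add: hom_distribs)
    then show "P g" using P e by (auto simp: P_def)
    show "degree g = degree g0" by (simp add: g_def)
    show "content g = 1" using P by (simp add: g_def P_def)
  qed
  have dvd: "g dvd p" if "ipoly p \<omega> = 0" for p
  proof -
    obtain q r where qr: "pseudo_divmod p g = (q, r)" by fastforce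
    define c where "c = coeff g (degree g) ^ (Suc (degree p) - degree g)"
    have gn: "g \<noteq> 0" using g by (auto simp: P_def)
    have e: "Polynomial.smult c p = g * q + r" and r: "r = 0 \<or> degree r < degree g"
      using pseudo_divmod[OF gn qr] unfolding c_def by auto
    have "ipoly (Polynomial.smult c p) \<omega> = 0" using that by (simp add: hom_distribs)
    then have "ipoly r \<omega> = 0" using g unfolding e by (simp add: hom_distribs P_def)
    then have "r \<noteq> 0 \<Longrightarrow> degree g0 \<le> degree r" using min[of r] by (simp add: P_def)
    then have "r = 0" using r g(2) by linarith
    then have "Polynomial.smult c p = g * q" using e by simp
    then have "Polynomial.smult (to_fract c) (map_poly to_fract p) = map_poly to_fract g * map_poly to_fract q"
      by (metis fract_poly_mult fract_poly_smult)
    then have "map_poly to_fract g dvd Polynomial.smult (to_fract c) (map_poly to_fract p)" by simp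
    moreover have "to_fract c \<noteq> 0" using gn by (simp add: c_def)
    ultimately have "map_poly to_fract g dvd map_poly to_fract p" by (simp add: dvd_smult_iff)
    then show "g dvd p" using g(3) by (rule fract_poly_dvdD)
  qed
  obtain h where h: "u = g * h" using dvd[OF u(1)] by (elim dvdE)
  then have "lead_coeff g * lead_coeff h = 1" using u(2) by (simp add: lead_coeff_mult)
  then have l: "lead_coeff g = 1 \<or> lead_coeff g = -1" using zmult_eq_1_iff by blast
  show thesis
  proof (cases "lead_coeff g = 1")
    case True
    then show thesis using that[of g] g dvd by (auto simp: P_def)
  next
    case False
    then show thesis using that[of "- g"] l g dvd by (auto simp: P_def hom_distribs)
  qed
qed

text \<open>Let \<open>g\<close> be the monic minimal polynomial of \<open>\<omega>\<close>, write \<open>x\<^sup>m - 1 = g h\<close>, and put \<open>\<zeta> = \<omega>\<^sup>p\<close>. If \<open>g(\<zeta>) \<noteq> 0\<close>, then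
  \<open>h(\<zeta>) = 0\<close>, and differentiating gives \<open>m \<zeta>\<^sup>m\<^sup>-\<^sup>1 = g(\<zeta>) h'(\<zeta>)\<close>. But \<open>g(\<zeta>) = g(\<omega>\<^sup>p)\<close> is \<open>p\<close> times an element of
  \<open>\<int>[\<omega>]\<close>, because \<open>g(x\<^sup>p) \<equiv> g(x)\<^sup>p\<close>. So \<open>p\<close> divides \<open>m\<close> in \<open>\<int>[\<omega>]\<close>, and comparing coordinates in the basis
  of powers of \<open>\<omega>\<close> below \<open>degree g\<close> shows that \<open>p\<close> divides \<open>m\<close>.\<close>

lemma ipoly_root_prime_power:
  assumes w: "\<omega> ^ m = 1" "m > 0" and p: "prime p" "\<not> p dvd m" and P: "ipoly P \<omega> = 0"
  shows "ipoly P (\<omega> ^ p) = 0"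
proof -
  obtain g :: "int poly" where g: "lead_coeff g = 1" "ipoly g \<omega> = 0"
    and dvd: "\<And>p. ipoly p \<omega> = 0 \<Longrightarrow> g dvd p" using monic_int_min_poly[OF w] by metis
  have gn: "g \<noteq> 0" using g by auto
  have dg: "degree g > 0"
  proof (rule ccontr)
    assume "\<not> degree g > 0"
    then obtain c where "g = [:c:]" by (auto elim: degree_eq_zeroE)
    with g show False by simp
  qed
  define \<zeta> where "\<zeta> = \<omega> ^ p"
  have "ipoly g \<zeta> = 0"
  proof (rule ccontr)
    assume ng: "ipoly g \<zeta> \<noteq> 0"
    have zm: "\<zeta> ^ m = 1" unfolding \<zeta>_def by (metis mult.commute power_mult power_one w(1))
    obtain h where h: "monom 1 m - 1 = g * h"
      using dvd[of "monom 1 m - 1"] w by (auto simp: hom_distribs poly_monom elim: dvdE)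
    have "ipoly (g * h) \<zeta> = 0" unfolding h[symmetric] using zm by (simp add: hom_distribs poly_monom)
    then have hz: "ipoly h \<zeta> = 0" using ng by (simp add: hom_distribs)
    have "pderiv (monom 1 m - 1) = g * pderiv h + h * pderiv g" unfolding h by (rule pderiv_mult)
    then have "ipoly (pderiv (monom 1 m - 1)) \<zeta> = ipoly g \<zeta> * ipoly (pderiv h) \<zeta>"
      using hz by (simp add: hom_distribs)
    then have d: "of_nat m * \<zeta> ^ (m - 1) = ipoly g \<zeta> * ipoly (pderiv h) \<zeta>"
      by (simp add: pderiv_monom pderiv_diff hom_distribs poly_monom)
    obtain k where k: "g \<circ>\<^sub>p monom 1 p - g ^ p = of_nat p * k"
      using prime_dvd_pcompose_power[OF p(1), of g] by (elim dvdE)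
    have comp: "ipoly (q \<circ>\<^sub>p monom 1 p) \<omega> = ipoly q \<zeta>" for q
      by (simp add: of_int_hom.map_poly_pcompose poly_pcompose \<zeta>_def poly_monom hom_distribs)
    have "ipoly (g \<circ>\<^sub>p monom 1 p) \<omega> = ipoly (g ^ p + of_nat p * k) \<omega>" using k by (simp add: algebra_simps)
    then have gz: "ipoly g \<zeta> = of_nat p * ipoly k \<omega>"
      using g(2) p(1) unfolding comp by (simp add: hom_distribs zero_power prime_gt_0_nat)
    \<comment> \<open>With this \<open>R\<close> the derivative identity, multiplied by \<open>\<zeta>\<close>, reads \<open>m = p R(\<omega>)\<close>.\<close>
    define R where "R = monom 1 p * k * (pderiv h \<circ>\<^sub>p monom 1 p)"
    have "of_nat m = \<zeta> * (of_nat m * \<zeta> ^ (m - 1))"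
      using zm w(2) by (simp add: power_eq_if)
    also have "\<dots> = of_nat p * ipoly R \<omega>" unfolding d gz R_def ipoly_mult comp
      by (simp add: hom_distribs poly_monom \<zeta>_def[symmetric])
    finally have mR: "of_nat m = of_nat p * ipoly R \<omega>" .
    obtain q r where qr: "pseudo_divmod R g = (q, r)" by fastforce
    have e: "R = g * q + r" and r: "r = 0 \<or> degree r < degree g"
      using pseudo_divmod[OF gn qr] g(1) by auto
    have "ipoly ([:int m:] - Polynomial.smult (int p) r) \<omega> = 0"
      using mR g(2) unfolding e by (simp add: hom_distribs)
    then have gd: "g dvd [:int m:] - Polynomial.smult (int p) r" by (rule dvd)
    have "degree r < degree g" using r dg by auto
    then have "degree ([:int m:] - Polynomial.smult (int p) r) < degree g" using dg
      by (intro degree_diff_less) (auto intro: le_less_trans[OF degree_smult_le])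
    then have "[:int m:] - Polynomial.smult (int p) r = 0" using gd dvd_imp_degree_le leD by blast
    then have "int m = int p * coeff r 0"
      by (metis coeff_pCons_0 coeff_smult eq_iff_diff_eq_0)
    then have "int p dvd int m" by simp
    then show False using p(2) by simp
  qed
  moreover obtain q where "P = g * q" using dvd[OF P] by (elim dvdE)
  ultimately show ?thesis by (simp add: hom_distribs \<zeta>_def)
qed

text \<open>Prime factors of \<open>t\<close> are split off one at a time; after each step \<open>\<omega>\<^sup>p\<close> takes the place of \<open>\<omega>\<close>.\<close>

lemma ipoly_root_coprime_power:
  assumes "\<omega> ^ m = 1" "m > 0" "coprime t m" "ipoly P \<omega> = 0"
  shows "ipoly P (\<omega> ^ t) = 0"
  using assms
proof (induct t arbitrary: \<omega> rule: less_induct)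
  case (less t)
  consider "t = 0" | "t = 1" | "t > 1" by linarith
  then show ?case
  proof cases
    case 1 then show ?thesis using less.prems by simp
  next
    case 2 then show ?thesis using less.prems by simp
  next
    case 3
    then obtain p s where p: "prime p" and t: "t = p * s"
      by (metis dvdE less_irrefl_nat prime_factor_nat)
    have "\<not> p dvd m" using less.prems(3) p t
      by (metis coprime_common_divisor coprime_mult_left_iff dvd_refl not_prime_unit)
    then have "ipoly P (\<omega> ^ p) = 0" using ipoly_root_prime_power p less.prems by blast
    moreover have "(\<omega> ^ p) ^ m = 1" using less.prems(1) by (metis mult.commute power_mult power_one)
    moreover have "s < t" "coprime s m" using t p 3 less.prems(3) prime_gt_1_nat[OF p] by (auto intro: Nat.gr0I)
    ultimately have "ipoly P ((\<omega> ^ p) ^ s) = 0" using less.hyps less.prems(2) by blast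
    then show ?thesis by (simp add: t power_mult)
  qed
qed

lemma clear_denominators:
  assumes "p \<in> polys_over \<rat>"
  obtains c :: int and q where "c \<noteq> 0" "Polynomial.smult (of_int c) p = of_int_poly q"
proof -
  have "\<exists>c q. c \<noteq> (0::int) \<and> Polynomial.smult (of_int c) p = of_int_poly q" using assms
  proof (induct p)
    case 0 then show ?case by (intro exI[of _ 1] exI[of _ 0]) auto
  next
    case (pCons a p)
    have "a \<in> \<rat>" "p \<in> polys_over \<rat>" using pCons.prems
      by (auto simp: polys_over_def coeff_pCons split: nat.splits)
    then obtain c q where q: "c \<noteq> (0::int)" "Polynomial.smult (of_int c) p = of_int_poly q" using pCons.hyps by auto
    obtain x y where a: "a = of_int x / of_int y" "y > 0" using \<open>a \<in> \<rat>\<close> by (cases a rule: Rats_cases') auto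
    have "Polynomial.smult (of_int (c * y)) (pCons a p) = of_int_poly (pCons (c * x) (Polynomial.smult y q))"
      using a q(2)[symmetric] by (simp add: map_poly_pCons hom_distribs mult.commute)
    then show ?case using q(1) a(2) by (intro exI[of _ "c * y"]) auto
  qed
  then show thesis using that by auto
qed

lemma rational_poly_root_coprime_power:
  assumes "\<omega> ^ m = 1" "m > 0" "coprime t m" "p \<in> polys_over \<rat>" "poly p \<omega> = 0"
  shows "poly p (\<omega> ^ t) = 0"
proof -
  obtain c q where q: "c \<noteq> 0" "Polynomial.smult (of_int c) p = of_int_poly q"
    using clear_denominators[OF assms(4)] by auto
  have e: "ipoly q x = of_int c * poly p x" for x unfolding q(2)[symmetric] by simp
  show ?thesis using ipoly_root_coprime_power[OF assms(1-3), of q] assms(5) q(1) by (simp add: e)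
qed

section \<open>Automorphisms of extensions generated by a root of unity\<close>

lemma galois_group_iff:
  "\<sigma> \<in> galois_group L F \<longleftrightarrow> \<sigma> \<in> extensional L \<and> bij_betw \<sigma> L L \<and> \<sigma> 1 = 1 \<and> (\<forall>x\<in>F. \<sigma> x = x) \<and>
     (\<forall>x\<in>L. \<forall>y\<in>L. \<sigma> (x * y) = \<sigma> x * \<sigma> y \<and> \<sigma> (x + y) = \<sigma> x + \<sigma> y)"
  unfolding galois_group_def ring_iso_def ring_hom_def bij_betw_def by auto

lemma galois_poly:
  assumes L: "complex_subfield L" and F: "F \<subseteq> L" and s: "\<sigma> \<in> galois_group L F"
    and x: "x \<in> L" and p: "p \<in> polys_over F"
  shows "\<sigma> (poly p x) = poly p (\<sigma> x)"
  using p
proof (induct p)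
  case 0
  interpret complex_subfield L by fact
  have "\<sigma> (0 + 0) = \<sigma> 0 + \<sigma> 0" using s unfolding galois_group_iff by blast
  then show ?case by simp
next
  case (pCons a p)
  interpret complex_subfield L by fact
  have a: "a \<in> F" "p \<in> polys_over F" using pCons.prems
    by (auto simp: polys_over_def coeff_pCons split: nat.splits)
  have "poly p x \<in> L" using a(2) F x polys_over_mono[OF F] by (auto intro: poly_mem)
  then have "\<sigma> (poly (pCons a p) x) = \<sigma> a + \<sigma> x * \<sigma> (poly p x)"
    using s a F x unfolding galois_group_iff by (auto simp: mult_mem)
  then show ?case using pCons.hyps(2)[OF a(2)] a s unfolding galois_group_iff by auto
qed

text \<open>The elements fixed by \<open>\<sigma>\<close> form a subfield.\<close>

lemma galois_fixes_adjoin: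
  assumes L: "complex_subfield L" and sub: "F \<subseteq> L" "S \<subseteq> L" and s: "\<sigma> \<in> galois_group L F"
    and gens: "\<And>y. y \<in> S \<Longrightarrow> \<sigma> y = y" and x: "x \<in> adjoin F S"
  shows "\<sigma> x = x"
proof -
  interpret L: complex_subfield L by (rule L)
  define E where "E = {y \<in> L. \<sigma> y = y}"
  note s' = s[unfolded galois_group_iff]
  have hom: "\<sigma> (x + y) = \<sigma> x + \<sigma> y" "\<sigma> (x * y) = \<sigma> x * \<sigma> y" if "x \<in> L" "y \<in> L" for x y
    using s' that by auto
  have s0: "\<sigma> 0 = 0" using hom(1)[of 0 0] by simp
  have "complex_subfield E"
  proof
    show "1 \<in> E" using s' by (simp add: E_def)
    show "- x \<in> E" if "x \<in> E" for x
      using that hom(1)[of x "- x"] s0 L.uminus_mem[of x] by (auto simp: E_def add_eq_0_iff)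
    show "inverse x \<in> E" if "x \<in> E" for x
    proof (cases "x = 0")
      case False
      have x: "x \<in> L" "\<sigma> x = x" using that by (auto simp: E_def)
      have i: "inverse x \<in> L" using x(1) by (rule L.inverse_mem)
      have "x * \<sigma> (inverse x) = \<sigma> (x * inverse x)" using hom(2)[OF x(1) i] x(2) by simp
      then have "x * \<sigma> (inverse x) = 1" using False s' by simp
      then have "\<sigma> (inverse x) = inverse x" by (rule inverse_unique[symmetric])
      then show ?thesis using i by (simp add: E_def)
    qed (use that in auto)
  qed (auto simp: E_def hom intro: L.add_mem L.mult_mem)
  then have "adjoin F S \<subseteq> E"
    using s' sub gens by (intro adjoin_least) (auto simp: E_def)
  with x show ?thesis by (auto simp: E_def)
qed

lemma (in complex_subfield) polys_over_pcompose:
  assumes "p \<in> polys_over K" "q \<in> polys_over K"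
  shows "p \<circ>\<^sub>p q \<in> polys_over K"
  using assms(1)
proof (induct p)
  case (pCons a p)
  have "a \<in> K" "p \<in> polys_over K" using pCons.prems
    by (auto simp: polys_over_def coeff_pCons split: nat.splits)
  with pCons.hyps assms(2) show ?case
    by (auto simp: pcompose_pCons intro: polys_over_add polys_over_const polys_over_mult)
qed auto

lemma primitive_root_powers_inj:
  assumes w: "primitive_root_of_unity m \<omega>"
  shows "inj_on (\<lambda>k. \<omega> ^ k) {0<..m}"
proof -
  have w0: "\<omega> \<noteq> 0" using w by (auto simp: primitive_root_of_unity_def power_0_left)
  have "i = j" if "i \<le> j" "i \<in> {0<..m}" "j \<in> {0<..m}" "\<omega> ^ i = \<omega> ^ j" for i j
  proof (rule ccontr)
    assume "i \<noteq> j"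
    then have "j - i \<in> {0<..<m}" using that by auto
    moreover have "\<omega> ^ (j - i) = 1" using that w0 by (simp add: power_diff)
    ultimately show False using w by (auto simp: primitive_root_of_unity_def)
  qed
  then show ?thesis by (intro inj_onI) (metis linear)
qed

lemma roots_of_unity_eq_powers:
  assumes w: "primitive_root_of_unity m \<omega>"
  shows "{z. z ^ m = 1} = (\<lambda>k. \<omega> ^ k) ` {0<..m}"
proof (rule sym, rule card_subset_eq)
  have m: "m > 0" and wm: "\<omega> ^ m = 1" using w by (auto simp: primitive_root_of_unity_def)
  show "finite {z::complex. z ^ m = 1}" using m by (intro finite_roots_unity) auto
  show "(\<lambda>k. \<omega> ^ k) ` {0<..m} \<subseteq> {z. z ^ m = 1}"
    using wm by auto (metis mult.commute power_mult power_one)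
  show "card ((\<lambda>k. \<omega> ^ k) ` {0<..m}) = card {z::complex. z ^ m = 1}"
    using card_image[OF primitive_root_powers_inj[OF w]] card_roots_unity_eq[OF m] by simp
qed

text \<open>The Galois group of \<open>F(\<omega>)\<close> over \<open>F\<close> is described by the exponents \<open>t\<close> for which \<open>\<omega>\<^sup>t\<close> is a root of the
  minimal polynomial \<open>f\<close> of \<open>\<omega>\<close>. Their number is the degree of \<open>f\<close>, as \<open>f\<close> divides the separable polynomial
  \<open>x\<^sup>m - 1\<close>.\<close>

locale root_of_unity_extension = complex_subfield F for F +
  fixes m :: nat and \<omega> :: complex and f :: "complex poly"
  assumes prim: "primitive_root_of_unity m \<omega>" and min_poly: "is_min_poly F \<omega> f"
begin

lemma m_pos: "m > 0" and \<omega>_power: "\<omega> ^ m = 1"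
  using prim by (auto simp: primitive_root_of_unity_def)

definition conj_exps :: "nat set" where
  "conj_exps = {t \<in> totatives m. poly f (\<omega> ^ t) = 0}"

lemma f_over: "f \<in> polys_over F" and f_monic: "lead_coeff f = 1" and f_root: "poly f \<omega> = 0"
  and f_dvd: "p \<in> polys_over F \<Longrightarrow> poly p \<omega> = 0 \<Longrightarrow> f dvd p"
  using min_poly by (auto simp: is_min_poly_def)

lemmas adjoin_eq = simple_extension_min_poly(1)[OF complex_subfield_axioms min_poly]

text \<open>If \<open>p(\<omega>) \<noteq> 0\<close>, then \<open>p(\<omega>)\<close> has an inverse \<open>q(\<omega>)\<close>, so \<open>f\<close> divides \<open>p q - 1\<close>, and evaluation at \<open>\<zeta>\<close> shows that
  \<open>p(\<zeta>) \<noteq> 0\<close>.\<close>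

lemma conjugate_root:
  assumes "poly f \<zeta> = 0" "p \<in> polys_over F"
  shows "poly p \<omega> = 0 \<longleftrightarrow> poly p \<zeta> = 0"
proof
  assume "poly p \<omega> = 0"
  then show "poly p \<zeta> = 0" using f_dvd[OF assms(2)] assms(1) by (auto elim!: dvdE)
next
  assume z: "poly p \<zeta> = 0"
  show "poly p \<omega> = 0"
  proof (rule ccontr)
    assume n: "poly p \<omega> \<noteq> 0"
    interpret L: complex_subfield "adjoin F {\<omega>}" by (rule adjoin_subfield)
    have "inverse (poly p \<omega>) \<in> adjoin F {\<omega>}" using assms(2) by (intro L.inverse_mem) (auto simp: adjoin_eq)
    then obtain q where q: "q \<in> polys_over F" "inverse (poly p \<omega>) = poly q \<omega>" by (auto simp: adjoin_eq)
    have "poly (p * q - 1) \<omega> = 0" using n by (simp add: q(2)[symmetric])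
    then have "f dvd p * q - 1"
      by (intro f_dvd polys_over_diff polys_over_mult assms q polys_over_1)
    then obtain k where "p * q - 1 = f * k" by (elim dvdE)
    then have "poly (p * q - 1) \<zeta> = poly f \<zeta> * poly k \<zeta>" by (simp only: poly_mult)
    then have "poly (p * q - 1) \<zeta> = 0" using assms(1) by simp
    with z show False by simp
  qed
qed

text \<open>A root \<open>\<zeta>\<close> of \<open>f\<close> satisfies the same equations over \<open>F\<close> as \<open>\<omega>\<close>. It is therefore an \<open>m\<close>-th root of unity
  \<open>\<omega>\<^sup>t\<close>, and it satisfies \<open>\<zeta>\<^sup>k = 1\<close> for \<open>k = m / gcd t m\<close>, which forces \<open>k = m\<close>.\<close>

lemma root_imp_conj_exp:
  assumes "poly f \<zeta> = 0"
  obtains t where "t \<in> conj_exps" "\<zeta> = \<omega> ^ t"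
proof -
  have "poly (monom 1 m - 1) \<omega> = 0" using \<omega>_power by (simp add: poly_monom)
  then have "poly (monom 1 m - 1) \<zeta> = 0"
    by (subst (asm) conjugate_root[OF assms]) (auto intro: polys_over_diff polys_over_monom)
  then have "\<zeta> \<in> {z. z ^ m = 1}" by (simp add: poly_monom)
  then obtain t where t: "t \<in> {0<..m}" "\<zeta> = \<omega> ^ t" unfolding roots_of_unity_eq_powers[OF prim] by auto
  define d where "d = gcd t m"
  obtain k where k: "m = d * k" using d_def by (metis dvdE gcd_dvd2)
  obtain l where l: "t = d * l" using d_def by (metis dvdE gcd_dvd1)
  have "\<zeta> ^ k = (\<omega> ^ m) ^ l" unfolding t(2) l k by (simp add: power_mult[symmetric] mult_ac)
  then have "\<zeta> ^ k = 1" by (simp add: \<omega>_power)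
  then have "poly (monom 1 k - 1) \<zeta> = 0" by (simp add: poly_monom)
  then have "poly (monom 1 k - 1) \<omega> = 0"
    by (subst conjugate_root[OF assms]) (auto intro: polys_over_diff polys_over_monom)
  then have "\<omega> ^ k = 1" by (simp add: poly_monom)
  then have "k \<notin> {0<..<m}" using prim by (auto simp: primitive_root_of_unity_def)
  moreover have "k > 0" using k m_pos by (metis gr0I mult_0_right)
  moreover have "k \<le> m" using m_pos by (intro dvd_imp_le) (simp_all add: k)
  ultimately have "k = m" by simp
  then have "d = 1" using k m_pos by simp
  then have "coprime t m" by (simp only: coprime_iff_gcd_eq_1 d_def)
  then have "t \<in> totatives m" using t(1) by (simp add: totatives_def)
  then show thesis using that[of t] t assms by (auto simp: conj_exps_def)
qed

lemma inj_on_conj_exps: "inj_on (\<lambda>t. \<omega> ^ t) (totatives m)"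
  by (rule inj_on_subset[OF primitive_root_powers_inj[OF prim]]) (auto simp: totatives_def)

text \<open>A common root of \<open>f\<close> and \<open>f'\<close> would be one of \<open>x\<^sup>m - 1\<close> and its derivative.\<close>

lemma degree_min_poly: "degree f = card conj_exps"
proof -
  have "f dvd monom 1 m - 1"
    using \<omega>_power by (intro f_dvd) (auto simp: poly_monom intro: polys_over_diff polys_over_monom)
  then obtain h where h: "monom 1 m - 1 = f * h" by (elim dvdE)
  have "rsquarefree f" unfolding rsquarefree_roots
  proof (intro allI notI, elim conjE)
    fix a assume a: "poly f a = 0" "poly (pderiv f) a = 0"
    have "poly (pderiv (monom 1 m - 1)) a = 0" unfolding h using a by (simp add: pderiv_mult)
    then have "a ^ (m - 1) = 0" using m_pos by (simp add: pderiv_diff pderiv_monom poly_monom)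
    then have "a ^ m = 0" by (metis m_pos power_eq_0_iff)
    moreover have "a ^ m = 1"
    proof -
      have "poly (monom 1 m - 1) a = 0" unfolding h using a by simp
      then show ?thesis by (simp add: poly_monom)
    qed
    ultimately show False by simp
  qed
  then have f: "f = (\<Prod>z | poly f z = 0. [:- z, 1:])"
    using complex_poly_decompose_rsquarefree[of f] f_monic by simp
  have "degree f = card {z. poly f z = 0}" by (subst f) (simp add: degree_prod_eq_sum_degree)
  also have "{z. poly f z = 0} = (\<lambda>t. \<omega> ^ t) ` conj_exps"
    by (auto simp: conj_exps_def elim!: root_imp_conj_exp)
  also have "card \<dots> = card conj_exps"
    by (rule card_image, rule inj_on_subset[OF inj_on_conj_exps]) (auto simp: conj_exps_def)
  finally show ?thesis .
qed

lemma dimension_adjoin: "ext_dim (card conj_exps) F (adjoin F {\<omega>})"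
  using simple_extension_min_poly(2)[OF complex_subfield_axioms min_poly] by (simp add: degree_min_poly)

lemma galois_conj_exp:
  assumes "\<sigma> \<in> galois_group (adjoin F {\<omega>}) F"
  obtains t where "t \<in> conj_exps" "\<sigma> \<omega> = \<omega> ^ t"
proof -
  have "\<sigma> (poly f \<omega>) = poly f (\<sigma> \<omega>)"
    using gens_subset_adjoin[of "{\<omega>}" F]
    by (intro galois_poly[OF adjoin_subfield base_subset_adjoin assms] f_over) auto
  moreover have "\<sigma> 0 = 0" using galois_poly[OF adjoin_subfield base_subset_adjoin assms, of 0 0]
      complex_subfield.zero_mem[OF adjoin_subfield] by simp
  ultimately have "poly f (\<sigma> \<omega>) = 0" by (simp add: f_root)
  then show thesis using root_imp_conj_exp that by metis
qed

text \<open>The map \<open>p(\<omega>) \<mapsto> p(\<omega>\<^sup>t)\<close> is well defined and injective because \<open>\<omega>\<close> and \<open>\<omega>\<^sup>t\<close> are roots of the same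
  polynomials over \<open>F\<close>, and surjective because \<open>\<omega>\<close> is a power of \<open>\<omega>\<^sup>t\<close>.\<close>

lemma conj_exp_galois:
  assumes t: "t \<in> conj_exps"
  obtains \<sigma> where "\<sigma> \<in> galois_group (adjoin F {\<omega>}) F" "\<sigma> \<omega> = \<omega> ^ t"
proof -
  let ?L = "adjoin F {\<omega>}"
  define \<zeta> where "\<zeta> = \<omega> ^ t"
  have z: "poly f \<zeta> = 0" using t by (simp add: conj_exps_def \<zeta>_def)
  define \<sigma> where "\<sigma> = (\<lambda>x\<in>?L. poly (SOME p. p \<in> polys_over F \<and> poly p \<omega> = x) \<zeta>)"
  interpret L: complex_subfield ?L by (rule adjoin_subfield)
  have \<sigma>: "\<sigma> (poly p \<omega>) = poly p \<zeta>" if p: "p \<in> polys_over F" for p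
  proof -
    define q where "q = (SOME q. q \<in> polys_over F \<and> poly q \<omega> = poly p \<omega>)"
    have q: "q \<in> polys_over F \<and> poly q \<omega> = poly p \<omega>" unfolding q_def by (rule someI[of _ p]) (use p in simp)
    have "poly (q - p) \<omega> = 0" using q by simp
    then have "poly (q - p) \<zeta> = 0"
      by (subst (asm) conjugate_root[OF z]) (use p q in \<open>auto intro: polys_over_diff\<close>)
    moreover have "poly p \<omega> \<in> ?L" using p by (auto simp: adjoin_eq)
    then have "\<sigma> (poly p \<omega>) = poly q \<zeta>" by (simp add: \<sigma>_def q_def)
    ultimately show ?thesis by simp
  qed
  have const: "\<sigma> a = a" if "a \<in> F" for a
    using \<sigma>[OF polys_over_const[OF that]] by simp
  have X: "[:0, 1:] \<in> polys_over F" by (intro polys_over_pCons polys_over_const) auto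
  have s\<omega>: "\<sigma> \<omega> = \<zeta>" using \<sigma>[OF X] by simp
  have hom: "\<sigma> (x * y) = \<sigma> x * \<sigma> y \<and> \<sigma> (x + y) = \<sigma> x + \<sigma> y" if xy: "x \<in> ?L" "y \<in> ?L" for x y
  proof -
    obtain p q where p: "p \<in> polys_over F" "x = poly p \<omega>" and q: "q \<in> polys_over F" "y = poly q \<omega>"
      using xy unfolding adjoin_eq by auto
    show ?thesis using \<sigma>[OF polys_over_mult[OF p(1) q(1)]] \<sigma>[OF polys_over_add[OF p(1) q(1)]]
      by (simp add: p(2) q(2) \<sigma>[OF p(1)] \<sigma>[OF q(1)])
  qed
  have "inj_on \<sigma> ?L"
  proof (rule inj_onI)
    fix x y assume xy: "x \<in> ?L" "y \<in> ?L" "\<sigma> x = \<sigma> y"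
    obtain p q where p: "p \<in> polys_over F" "x = poly p \<omega>" and q: "q \<in> polys_over F" "y = poly q \<omega>"
      using xy unfolding adjoin_eq by auto
    have "poly (p - q) \<zeta> = 0" using xy(3) by (simp add: p(2) q(2) \<sigma>[OF p(1)] \<sigma>[OF q(1)])
    then have "poly (p - q) \<omega> = 0"
      by (subst conjugate_root[OF z]) (use p q in \<open>auto intro: polys_over_diff\<close>)
    then show "x = y" by (simp add: p q)
  qed
  moreover have "\<sigma> ` ?L = ?L"
  proof
    have zL: "\<zeta> \<in> ?L" using gens_subset_adjoin[of "{\<omega>}" F] by (auto simp: \<zeta>_def intro: L.power_mem)
    show "\<sigma> ` ?L \<subseteq> ?L"
    proof
      fix y assume "y \<in> \<sigma> ` ?L"
      then obtain p where "p \<in> polys_over F" "y = \<sigma> (poly p \<omega>)" by (auto simp: adjoin_eq)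
      then show "y \<in> ?L" using \<sigma> polys_over_mono[OF base_subset_adjoin[of F "{\<omega>}"]] zL
        by (auto intro: L.poly_mem)
    qed
    have "coprime t m" using t by (auto simp: conj_exps_def totatives_def)
    then obtain s where s: "[t * s = 1] (mod m)" using cong_solve_coprime_nat by auto
    have "\<zeta> ^ s = \<omega>"
    proof -
      have "\<omega> ^ (t * s) = \<omega> ^ ((t * s) mod m)"
        by (metis \<omega>_power div_mult_mod_eq mult_1 mult.commute power_add power_mult power_one)
      also have "(t * s) mod m = 1 mod m" using s by (simp add: cong_def)
      also have "\<omega> ^ (1 mod m) = \<omega> ^ 1"
        by (metis \<omega>_power div_mult_mod_eq mult_1 mult.commute power_add power_mult power_one)
      finally show ?thesis by (simp add: \<zeta>_def power_mult)
    qed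
    show "?L \<subseteq> \<sigma> ` ?L"
    proof
      fix y assume "y \<in> ?L"
      then obtain p where p: "p \<in> polys_over F" "y = poly p \<omega>" by (auto simp: adjoin_eq)
      have pc: "p \<circ>\<^sub>p monom 1 s \<in> polys_over F" by (intro polys_over_pcompose p polys_over_monom one_mem)
      have "y = \<sigma> (poly (p \<circ>\<^sub>p monom 1 s) \<omega>)"
        unfolding \<sigma>[OF pc] by (simp add: poly_pcompose poly_monom p \<open>\<zeta> ^ s = \<omega>\<close>)
      moreover have "poly (p \<circ>\<^sub>p monom 1 s) \<omega> \<in> ?L" using pc by (auto simp: adjoin_eq)
      ultimately show "y \<in> \<sigma> ` ?L" by blast
    qed
  qed
  ultimately have "bij_betw \<sigma> ?L ?L" by (simp add: bij_betw_def)
  moreover have "\<sigma> \<in> extensional ?L" by (simp add: \<sigma>_def)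
  ultimately have "\<sigma> \<in> galois_group ?L F" using hom const by (auto simp: galois_group_iff)
  then show thesis using that s\<omega> by (simp add: \<zeta>_def)
qed

text \<open>Write \<open>x = p(\<omega>)\<close> with \<open>degree p < degree f\<close>. If all automorphisms fix \<open>x\<close>, then \<open>p - x\<close> has \<open>degree f\<close> many
  roots \<open>\<omega>\<^sup>t\<close>, so \<open>p\<close> is the constant \<open>x\<close>.\<close>

lemma fixed_field:
  assumes x: "x \<in> adjoin F {\<omega>}"
    and fix_x: "\<And>\<sigma>. \<sigma> \<in> galois_group (adjoin F {\<omega>}) F \<Longrightarrow> \<sigma> x = x"
  shows "x \<in> F"
proof -
  obtain p0 where p0: "p0 \<in> polys_over F" "x = poly p0 \<omega>" using x by (auto simp: adjoin_eq)
  define p where "p = p0 mod f"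
  have p: "p \<in> polys_over F" unfolding p_def by (intro polys_over_mod f_over p0)
  have fn: "f \<noteq> 0" using f_monic by auto
  have px: "poly p \<omega> = x"
    unfolding p_def p0(2) using f_root by (simp add: minus_mult_div_eq_mod[symmetric])
  have dp: "p = 0 \<or> degree p < degree f" unfolding p_def using degree_mod_less[OF fn] by blast
  have df: "degree f > 0"
  proof (rule ccontr)
    assume "\<not> degree f > 0"
    then obtain c where "f = [:c:]" by (auto elim: degree_eq_zeroE)
    with f_monic f_root show False by simp
  qed
  have roots: "poly (p - [:x:]) (\<omega> ^ t) = 0" if t: "t \<in> conj_exps" for t
  proof -
    obtain \<sigma> where s: "\<sigma> \<in> galois_group (adjoin F {\<omega>}) F" "\<sigma> \<omega> = \<omega> ^ t"
      using conj_exp_galois[OF t] by auto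
    have "x = \<sigma> (poly p \<omega>)" using fix_x[OF s(1)] px by simp
    also have "\<dots> = poly p (\<omega> ^ t)"
      using galois_poly[OF adjoin_subfield base_subset_adjoin s(1) _ p, of \<omega>] gens_subset_adjoin[of "{\<omega>}" F]
      by (simp add: s(2))
    finally show ?thesis by simp
  qed
  have "p - [:x:] = 0"
  proof (rule ccontr)
    assume n: "p - [:x:] \<noteq> 0"
    have "degree f = card ((\<lambda>t. \<omega> ^ t) ` conj_exps)" unfolding degree_min_poly
      by (rule sym, rule card_image, rule inj_on_subset[OF inj_on_conj_exps]) (auto simp: conj_exps_def)
    also have "\<dots> \<le> card {z. poly (p - [:x:]) z = 0}"
      using roots by (intro card_mono poly_roots_finite[OF n]) auto
    also have "\<dots> \<le> degree (p - [:x:])" by (rule card_poly_roots_bound[OF n])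
    also have "\<dots> < degree f" using dp df by (intro degree_diff_less) auto
    finally show False by simp
  qed
  then have "x = coeff p 0" by (metis coeff_pCons_0 eq_iff_diff_eq_0)
  then show ?thesis using p by (simp add: polys_over_def)
qed

end

lemma (in complex_subfield) root_of_unity_extension_exists:
  assumes "primitive_root_of_unity m \<omega>"
  obtains f where "root_of_unity_extension K m \<omega> f"
proof -
  have m: "m > 0" "\<omega> ^ m = 1" using assms by (auto simp: primitive_root_of_unity_def)
  have "coeff (monom 1 m - 1 :: complex poly) m = 1" using m by simp
  then have "monom 1 m - 1 \<noteq> (0 :: complex poly)" by (metis coeff_0 zero_neq_one)
  moreover have "monom 1 m - 1 \<in> polys_over K" by (intro polys_over_diff polys_over_monom) auto
  ultimately obtain f where "is_min_poly K \<omega> f"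
    using min_poly_exists[of "monom 1 m - 1" \<omega>] m by (auto simp: poly_monom)
  then show thesis using assms that by (auto simp: root_of_unity_extension_def root_of_unity_extension_axioms_def complex_subfield_axioms)
qed

lemma rational_conj_exps:
  assumes "root_of_unity_extension \<rat> m \<omega> f"
  shows "root_of_unity_extension.conj_exps m \<omega> f = totatives m"
proof -
  interpret root_of_unity_extension \<rat> m \<omega> f by fact
  show ?thesis
    using rational_poly_root_coprime_power[OF \<omega>_power m_pos _ f_over f_root]
    by (auto simp: conj_exps_def totatives_def)
qed

section \<open>Square classes and multiquadratic extensions\<close>

text \<open>As \<open>b\<close> is its own inverse, the subgroup \<open>H\<close> and its translate by \<open>b\<close> already form a subgroup.\<close>

lemma (in comm_group) generate_insert_involution:
  assumes b: "b \<in> carrier G" "b \<otimes> b = \<one>" and S: "S \<subseteq> carrier G"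
  shows "generate G (insert b S) = generate G S \<union> (\<lambda>h. b \<otimes> h) ` generate G S"
proof
  let ?H = "generate G S"
  have H: "subgroup ?H G" using S by (rule generate_is_subgroup)
  interpret H: subgroup ?H G by (rule H)
  have bb: "b \<otimes> (b \<otimes> h) = h" if "h \<in> ?H" for h
    using b that H.mem_carrier by (metis l_one m_assoc)
  show "?H \<union> (\<lambda>h. b \<otimes> h) ` ?H \<subseteq> generate G (insert b S)"
    using mono_generate[of S "insert b S"] by (auto intro: generate.eng generate.incl)
  have invb: "inv b = b" using b by (simp add: inv_equality)
  have "subgroup (?H \<union> (\<lambda>h. b \<otimes> h) ` ?H) G"
  proof (rule subgroupI)
    show "?H \<union> (\<lambda>h. b \<otimes> h) ` ?H \<subseteq> carrier G" using b H.mem_carrier by auto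
    show "?H \<union> (\<lambda>h. b \<otimes> h) ` ?H \<noteq> {}" using generate.one by auto
  next
    fix x assume "x \<in> ?H \<union> (\<lambda>h. b \<otimes> h) ` ?H"
    then consider "x \<in> ?H" | h where "h \<in> ?H" "x = b \<otimes> h" by auto
    then show "inv x \<in> ?H \<union> (\<lambda>h. b \<otimes> h) ` ?H"
    proof cases
      case 1 then show ?thesis by auto
    next
      case 2
      then have "inv x = b \<otimes> inv h" using b H.mem_carrier by (simp add: inv_mult invb)
      then show ?thesis using 2 H.m_inv_closed by auto
    qed
  next
    fix x y assume "x \<in> ?H \<union> (\<lambda>h. b \<otimes> h) ` ?H" "y \<in> ?H \<union> (\<lambda>h. b \<otimes> h) ` ?H"
    then consider "x \<in> ?H" "y \<in> ?H" | h where "h \<in> ?H" "x = b \<otimes> h" "y \<in> ?H"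
      | h where "h \<in> ?H" "y = b \<otimes> h" "x \<in> ?H" | h h' where "h \<in> ?H" "h' \<in> ?H" "x = b \<otimes> h" "y = b \<otimes> h'" by auto
    then show "x \<otimes> y \<in> ?H \<union> (\<lambda>h. b \<otimes> h) ` ?H"
    proof cases
      case 1 then show ?thesis by auto
    next
      case 2
      then have "x \<otimes> y = b \<otimes> (h \<otimes> y)" using b H.mem_carrier by (simp add: m_assoc)
      then show ?thesis using 2 H.m_closed by auto
    next
      case 3
      then have "x \<otimes> y = b \<otimes> (x \<otimes> h)" using b H.mem_carrier by (simp add: m_lcomm)
      then show ?thesis using 3 H.m_closed by auto
    next
      case 4
      then have "x \<otimes> y = h \<otimes> h'" using b H.mem_carrier bb
        by (metis H.m_closed m_assoc m_lcomm m_closed)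
      then show ?thesis using 4 H.m_closed by auto
    qed
  qed
  moreover have "b \<in> (\<lambda>h. b \<otimes> h) ` ?H"
    using b by (intro image_eqI[of _ _ \<one>]) (auto intro: generate.one)
  then have "insert b S \<subseteq> ?H \<union> (\<lambda>h. b \<otimes> h) ` ?H" by (auto intro: generate.incl)
  ultimately show "generate G (insert b S) \<subseteq> ?H \<union> (\<lambda>h. b \<otimes> h) ` ?H"
    by (intro generate_subgroup_incl)
qed

lemma (in comm_group) card_generate_insert_involution:
  assumes b: "b \<in> carrier G" "b \<otimes> b = \<one>" and S: "S \<subseteq> carrier G"
    and fin: "finite (generate G S)" and nb: "b \<notin> generate G S"
  shows "card (generate G (insert b S)) = card (generate G S) * 2"
proof -
  let ?H = "generate G S"
  interpret H: subgroup ?H G using S by (rule generate_is_subgroup)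
  have "inj_on (\<lambda>h. b \<otimes> h) ?H" using b H.mem_carrier by (auto intro!: inj_onI)
  then have c: "card ((\<lambda>h. b \<otimes> h) ` ?H) = card ?H" by (rule card_image)
  have "?H \<inter> (\<lambda>h. b \<otimes> h) ` ?H = {}"
  proof (rule ccontr)
    assume "?H \<inter> (\<lambda>h. b \<otimes> h) ` ?H \<noteq> {}"
    then obtain h where h: "h \<in> ?H" "b \<otimes> h \<in> ?H" by auto
    then have "(b \<otimes> h) \<otimes> inv h \<in> ?H" by auto
    then show False using nb h(1) b H.mem_carrier by (simp add: m_assoc)
  qed
  then show ?thesis unfolding generate_insert_involution[OF b S]
    using fin c by (simp add: card_Un_disjoint)
qed

text \<open>Membership in a field does not depend on the choice of the square root.\<close>

lemma csqrt_mem_iff: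
  assumes "complex_subfield F" "z ^ 2 = a"
  shows "csqrt a \<in> F \<longleftrightarrow> z \<in> F"
proof -
  interpret complex_subfield F by fact
  have "csqrt a = z \<or> csqrt a = - z" using assms(2) by (metis power2_csqrt power2_eq_iff)
  then show ?thesis using uminus_mem by (metis add.inverse_inverse)
qed

context complex_subfield
begin

lemma mult_group_simps [simp]:
  "carrier (mult_group K) = K - {0}" "x \<otimes>\<^bsub>mult_group K\<^esub> y = x * y" "\<one>\<^bsub>mult_group K\<^esub> = 1"
  by (simp_all add: mult_group_def mult_of_def)

lemma comm_group_mult_group: "comm_group (mult_group K)"
proof (rule comm_groupI)
  show "\<exists>y\<in>carrier (mult_group K). y \<otimes>\<^bsub>mult_group K\<^esub> x = \<one>\<^bsub>mult_group K\<^esub>"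
    if "x \<in> carrier (mult_group K)" for x
    using that by (intro bexI[of _ "inverse x"]) (auto intro: inverse_mem)
qed (auto intro: mult_mem)

lemma mult_group_inv: "x \<in> K - {0} \<Longrightarrow> inv\<^bsub>mult_group K\<^esub> x = inverse x"
  using group.inv_equality[OF comm_group.axioms(2)[OF comm_group_mult_group], of "inverse x" x]
  by (auto intro: inverse_mem)

lemma nonzero_squares_subgroup: "subgroup (nonzero_squares K) (mult_group K)"
proof (rule group.subgroupI[OF comm_group.axioms(2)[OF comm_group_mult_group]])
  show "nonzero_squares K \<subseteq> carrier (mult_group K)" by (auto simp: nonzero_squares_def intro: power_mem)
  show "nonzero_squares K \<noteq> {}" by (auto simp: nonzero_squares_def)
next
  fix a assume "a \<in> nonzero_squares K"
  then obtain k where k: "k \<in> K - {0}" "a = k ^ 2" by (auto simp: nonzero_squares_def)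
  then have "inv\<^bsub>mult_group K\<^esub> a = inverse k ^ 2" "inverse k \<in> K - {0}"
    by (auto simp: mult_group_inv power_mem power_inverse inverse_mem)
  then show "inv\<^bsub>mult_group K\<^esub> a \<in> nonzero_squares K" by (auto simp: nonzero_squares_def)
next
  fix a b assume "a \<in> nonzero_squares K" "b \<in> nonzero_squares K"
  then obtain k l where k: "k \<in> K - {0}" "a = k ^ 2" "l \<in> K - {0}" "b = l ^ 2" by (auto simp: nonzero_squares_def)
  then have "a * b = (k * l) ^ 2" "k * l \<in> K - {0}" by (auto simp: power_mult_distrib mult_mem)
  then show "a \<otimes>\<^bsub>mult_group K\<^esub> b \<in> nonzero_squares K" by (auto simp: nonzero_squares_def)
qed

lemma nonzero_squares_normal: "nonzero_squares K \<lhd> mult_group K"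
  by (rule comm_group.subgroup_imp_normal[OF comm_group_mult_group nonzero_squares_subgroup])

lemma comm_group_square_class_group: "comm_group (square_class_group K)"
  unfolding square_class_group_def
  by (rule comm_group.abelian_FactGroup[OF comm_group_mult_group nonzero_squares_subgroup])

abbreviation class_mult :: "complex set \<Rightarrow> complex set \<Rightarrow> complex set" (infixl \<open>\<star>\<close> 70) where
  "a \<star> b \<equiv> a \<otimes>\<^bsub>square_class_group K\<^esub> b"

lemma square_class_carrier: "a \<in> K - {0} \<Longrightarrow> square_class K a \<in> carrier (square_class_group K)"
  by (auto simp: square_class_group_def square_class_def FactGroup_def RCOSETS_def)

lemma square_class_mult:
  assumes "a \<in> K - {0}" "b \<in> K - {0}"
  shows "square_class K a \<star> square_class K b = square_class K (a * b)"
  using normal.rcos_sum[OF nonzero_squares_normal, of a b] assms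
  by (simp add: square_class_group_def square_class_def FactGroup_def)

lemma square_class_one_iff:
  assumes a: "a \<in> K - {0}"
  shows "square_class K a = \<one>\<^bsub>square_class_group K\<^esub> \<longleftrightarrow> csqrt a \<in> K"
proof
  assume "square_class K a = \<one>\<^bsub>square_class_group K\<^esub>"
  moreover have "a \<in> square_class K a"
    using group.rcos_self[OF comm_group.axioms(2)[OF comm_group_mult_group] _ nonzero_squares_subgroup] a
    by (simp add: square_class_def)
  ultimately have "a \<in> nonzero_squares K" by (simp add: square_class_group_def FactGroup_def)
  then show "csqrt a \<in> K"
    using csqrt_mem_iff[OF complex_subfield_axioms] by (auto simp: nonzero_squares_def)
next
  assume "csqrt a \<in> K"
  then have "a \<in> nonzero_squares K" using a
    by (auto simp: nonzero_squares_def intro!: exI[of _ "csqrt a"])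
  then show "square_class K a = \<one>\<^bsub>square_class_group K\<^esub>"
    using subgroup.rcos_const[OF nonzero_squares_subgroup comm_group.axioms(2)[OF comm_group_mult_group]]
    by (simp add: square_class_def square_class_group_def FactGroup_def)
qed

lemma square_class_square:
  assumes "a \<in> K - {0}"
  shows "square_class K a \<star> square_class K a = \<one>\<^bsub>square_class_group K\<^esub>"
  unfolding square_class_mult[OF assms assms]
proof (subst square_class_one_iff)
  show "a * a \<in> K - {0}" using assms by (auto intro: mult_mem)
  show "csqrt (a * a) \<in> K" using csqrt_mem_iff[OF complex_subfield_axioms, of a "a * a"] assms
    by (simp add: power2_eq_square)
qed

lemma quadratic_min_poly:
  assumes s: "s \<notin> K" "s ^ 2 \<in> K"
  shows "is_min_poly K s [:- (s ^ 2), 0, 1:]"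
proof -
  let ?f = "[:- (s ^ 2), 0, 1:]"
  have f: "?f \<in> polys_over K"
    using s(2) by (intro polys_over_pCons polys_over_0 uminus_mem) auto
  have "?f dvd p" if p: "p \<in> polys_over K" "poly p s = 0" for p
  proof -
    define r where "r = p mod ?f"
    have r: "r \<in> polys_over K" unfolding r_def by (rule polys_over_mod[OF f p(1)])
    have "degree r < 2" using degree_mod_less'[of ?f p] by (cases "r = 0") (auto simp: r_def)
    then have e: "r = [:coeff r 0, coeff r 1:]"
      by (intro poly_eqI) (auto simp: coeff_pCons coeff_eq_0 split: nat.splits)
    have "poly r s = 0" unfolding r_def
      using p(2) by (simp add: minus_mult_div_eq_mod[symmetric] power2_eq_square)
    then have z: "coeff r 0 + s * coeff r 1 = 0" by (subst (asm) e) simp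
    have "coeff r 1 = 0"
    proof (rule ccontr)
      assume n: "coeff r 1 \<noteq> 0"
      then have "s = - coeff r 0 / coeff r 1" using z by (simp add: field_simps add_eq_0_iff)
      moreover have "- coeff r 0 / coeff r 1 \<in> K"
        using r by (intro divide_mem uminus_mem) (auto simp: polys_over_def)
      ultimately show False using s(1) by simp
    qed
    then have "r = 0" using z e by simp
    then show ?thesis by (simp add: r_def mod_eq_0_iff_dvd)
  qed
  then show ?thesis using f by (auto simp: is_min_poly_def power2_eq_square)
qed

lemma quadratic_extension:
  assumes s: "s \<notin> K" "s ^ 2 \<in> K"
  shows "ext_dim 2 K (adjoin K {s})"
    and "x \<in> adjoin K {s} \<Longrightarrow> \<exists>u\<in>K. \<exists>v\<in>K. x = u + v * s"
proof -
  let ?f = "[:- (s ^ 2), 0, 1:]"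
  note mp = quadratic_min_poly[OF s]
  show "ext_dim 2 K (adjoin K {s})"
    using simple_extension_min_poly(2)[OF complex_subfield_axioms mp] by (simp add: numeral_2_eq_2)
  assume "x \<in> adjoin K {s}"
  then obtain p where p: "p \<in> polys_over K" "x = poly p s"
    using simple_extension_min_poly(1)[OF complex_subfield_axioms mp] by auto
  define r where "r = p mod ?f"
  have r: "r \<in> polys_over K" unfolding r_def
    using mp p(1) by (intro polys_over_mod) (auto simp: is_min_poly_def)
  have "degree r < 2" using degree_mod_less'[of ?f p] by (cases "r = 0") (auto simp: r_def)
  then have e: "r = [:coeff r 0, coeff r 1:]"
    by (intro poly_eqI) (auto simp: coeff_pCons coeff_eq_0 split: nat.splits)
  have "poly r s = x" unfolding r_def p(2)
    by (simp add: minus_mult_div_eq_mod[symmetric] power2_eq_square)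
  then have "x = coeff r 0 + coeff r 1 * s" by (subst (asm) e) (simp add: mult.commute)
  then show "\<exists>u\<in>K. \<exists>v\<in>K. x = u + v * s" using r by (auto simp: polys_over_def)
qed

definition square_class_span :: "complex set \<Rightarrow> complex set set" where
  "square_class_span S = generate (square_class_group K) (square_class K ` S)"

text \<open>The dimension formula and the characterisation of the squares are proved together, by induction on
  the set of radicands. Let \<open>F\<close> be the field reached so far. Adjoining the root of \<open>b\<close> changes \<open>F\<close> exactly
  if the class of \<open>b\<close> is new; then both the degree and the group of classes double. In that case,
  if the root of \<open>a\<close> is \<open>u + v \<surd>b\<close> with \<open>u, v \<in> F\<close>, squaring gives \<open>u v = 0\<close>, as \<open>\<surd>b \<notin> F\<close>. So the root of \<open>a\<close> or of \<open>a b\<close> lies in \<open>F\<close>, and the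
  induction hypothesis applies to \<open>a\<close> or \<open>a b\<close>.\<close>

theorem multiquadratic_extension:
  assumes "finite S" "S \<subseteq> K - {0}"
  shows "finite (square_class_span S) \<and>
    ext_dim (card (square_class_span S)) K (adjoin K (csqrt ` S)) \<and>
    (\<forall>a\<in>K - {0}. csqrt a \<in> adjoin K (csqrt ` S) \<longleftrightarrow> square_class K a \<in> square_class_span S)"
  using assms
proof (induct S rule: finite_induct)
  case empty
  interpret Q: comm_group "square_class_group K" by (rule comm_group_square_class_group)
  have "adjoin K {} = K"
    using adjoin_least[OF complex_subfield_axioms, of K "{}"] base_subset_adjoin[of K "{}"] by auto
  then show ?case
    using ring.dimension_one[OF ring_complex, of K] square_class_one_iff
      complex_subfield_axioms[unfolded complex_subfield_iff]
    by (simp add: square_class_span_def Q.generate_empty)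
next
  case (insert b S)
  interpret Q: comm_group "square_class_group K" by (rule comm_group_square_class_group)
  let ?F = "adjoin K (csqrt ` S)" and ?F' = "adjoin K (csqrt ` insert b S)"
  let ?M = "square_class_span S" and ?M' = "square_class_span (insert b S)"
  let ?c = "square_class K"
  have b: "b \<in> K - {0}" and S: "S \<subseteq> K - {0}" using insert.prems by auto
  have IH: "finite ?M" "ext_dim (card ?M) K ?F"
    "\<And>a. a \<in> K - {0} \<Longrightarrow> csqrt a \<in> ?F \<longleftrightarrow> ?c a \<in> ?M" using insert.hyps S by auto
  interpret F: complex_subfield ?F by (rule adjoin_subfield)
  interpret F': complex_subfield ?F' by (rule adjoin_subfield)
  have F'_eq: "?F' = adjoin ?F {csqrt b}" by (simp add: adjoin_adjoin)
  have KF: "K \<subseteq> ?F" by (rule base_subset_adjoin)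
  have FF': "?F \<subseteq> ?F'" unfolding F'_eq by (rule base_subset_adjoin)
  have bF': "csqrt b \<in> ?F'" unfolding F'_eq using gens_subset_adjoin by auto
  have cS: "?c ` S \<subseteq> carrier (square_class_group K)" using S square_class_carrier by auto
  have M'_eq: "?M' = ?M \<union> (\<lambda>h. ?c b \<star> h) ` ?M"
    unfolding square_class_span_def image_insert
    by (rule Q.generate_insert_involution[OF square_class_carrier[OF b] square_class_square[OF b] cS])
  have M: "subgroup ?M (square_class_group K)"
    unfolding square_class_span_def by (rule Q.generate_is_subgroup[OF cS])
  interpret M: subgroup ?M "square_class_group K" by (rule M)
  have coset: "?c a \<in> (\<lambda>h. ?c b \<star> h) ` ?M \<longleftrightarrow> ?c (a * b) \<in> ?M"
    if a: "a \<in> K - {0}" for a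
  proof
    have ab: "?c (a * b) = ?c b \<star> ?c a"
      using square_class_mult[OF b a] by (simp add: mult.commute)
    assume "?c a \<in> (\<lambda>h. ?c b \<star> h) ` ?M"
    then obtain h where h: "h \<in> ?M" "?c a = ?c b \<star> h" by auto
    have "?c (a * b) = (?c b \<star> ?c b) \<star> h"
      unfolding ab h(2) by (rule Q.m_assoc[symmetric]) (use square_class_carrier[OF b] h in auto)
    then show "?c (a * b) \<in> ?M" using h(1) M.mem_carrier by (simp add: square_class_square[OF b])
  next
    assume ab: "?c (a * b) \<in> ?M"
    have "?c b \<star> ?c (a * b)
        = ?c b \<star> (?c b \<star> ?c a)"
      using square_class_mult[OF b a] by (simp add: mult.commute)
    also have "\<dots> = (?c b \<star> ?c b) \<star> ?c a"
      by (rule Q.m_assoc[symmetric]) (use square_class_carrier a b in auto)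
    also have "\<dots> = ?c a" using square_class_carrier[OF a] by (simp add: square_class_square[OF b])
    finally show "?c a \<in> (\<lambda>h. ?c b \<star> h) ` ?M" using ab by (metis image_eqI)
  qed
  have ab_mem: "a * b \<in> K - {0}" if "a \<in> K - {0}" for a using that b by (auto intro: mult_mem)
  show ?case
  proof (cases "csqrt b \<in> ?F")
    case True
    then have "?F' = ?F" unfolding F'_eq
      using adjoin_least[OF F.complex_subfield_axioms, of ?F "{csqrt b}"] base_subset_adjoin by blast
    moreover have "?c b \<in> ?M" using True IH(3)[OF b] by simp
    then have "?M' = ?M" unfolding M'_eq by auto
    ultimately show ?thesis using IH by simp
  next
    case False
    have bF: "csqrt b ^ 2 \<in> ?F" using b KF by auto
    have "?c b \<notin> ?M" using False IH(3)[OF b] by simp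
    then have card: "card ?M' = card ?M * 2"
      unfolding square_class_span_def image_insert
      by (intro Q.card_generate_insert_involution square_class_carrier[OF b] square_class_square[OF b] cS
          IH(1)[unfolded square_class_span_def])
    have "ext_dim (card ?M * 2) K ?F'" unfolding F'_eq
      by (rule ring.telescopic_base[OF ring_complex _ _ IH(2) F.quadratic_extension(1)[OF False bF]])
        (use complex_subfield_axioms F.complex_subfield_axioms in \<open>simp_all add: complex_subfield_iff\<close>)
    moreover have "csqrt a \<in> ?F' \<longleftrightarrow> ?c a \<in> ?M'" if a: "a \<in> K - {0}" for a
    proof
      assume "csqrt a \<in> ?F'"
      then obtain u v where uv: "u \<in> ?F" "v \<in> ?F" "csqrt a = u + v * csqrt b"
        unfolding F'_eq using F.quadratic_extension(2)[OF False bF] by metis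
      have "a = (u + v * csqrt b) ^ 2" by (metis uv(3) power2_csqrt)
      then have sq: "a = u ^ 2 + v ^ 2 * b + 2 * u * v * csqrt b"
        by (simp add: power2_sum power_mult_distrib algebra_simps)
      have "u * v = 0"
      proof (rule ccontr)
        assume n: "u * v \<noteq> 0"
        then have "csqrt b = (a - u ^ 2 - v ^ 2 * b) / (2 * u * v)" using sq by (simp add: field_simps)
        moreover have "(a - u ^ 2 - v ^ 2 * b) / (2 * u * v) \<in> ?F"
          using uv a b KF by (intro F.divide_mem F.diff_mem F.mult_mem F.power_mem) auto
        ultimately show False using False by simp
      qed
      then consider "v = 0" | "u = 0" by auto
      then show "?c a \<in> ?M'"
      proof cases
        case 1
        then show ?thesis using uv IH(3)[OF a] by (simp add: M'_eq)
      next
        case 2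
        have "(v * b) ^ 2 = a * b" using sq 2 by (simp add: power2_eq_square)
        then have "csqrt (a * b) \<in> ?F \<longleftrightarrow> v * b \<in> ?F" by (rule csqrt_mem_iff[OF F.complex_subfield_axioms])
        then have "csqrt (a * b) \<in> ?F" using uv(2) b KF by (auto intro: F.mult_mem)
        then have "?c (a * b) \<in> ?M" using IH(3)[OF ab_mem[OF a]] by simp
        then show ?thesis using coset[OF a] by (simp add: M'_eq)
      qed
    next
      assume "?c a \<in> ?M'"
      then consider "?c a \<in> ?M" | "?c (a * b) \<in> ?M" using coset[OF a] by (auto simp: M'_eq)
      then show "csqrt a \<in> ?F'"
      proof cases
        case 1 then show ?thesis using IH(3)[OF a] FF' by auto
      next
        case 2
        then have "csqrt (a * b) \<in> ?F'" using IH(3)[OF ab_mem[OF a]] FF' by blast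
        then have m: "csqrt (a * b) / csqrt b \<in> ?F'" using bF' by (rule F'.divide_mem)
        have "(csqrt (a * b) / csqrt b) ^ 2 = a" using b by (simp add: power_divide)
        then show ?thesis using csqrt_mem_iff[OF F'.complex_subfield_axioms] m by blast
      qed
    qed
    moreover have "finite ?M'" unfolding M'_eq using IH(1) by auto
    ultimately show ?thesis using card by simp
  qed
qed

text \<open>Finitely many of the radicands suffice as soon as they generate the same field.\<close>

corollary multiquadratic_dimension:
  assumes S: "S \<subseteq> K - {0}" and S0: "finite S0" "S0 \<subseteq> S" "csqrt ` S \<subseteq> adjoin K (csqrt ` S0)"
  shows "ext_dim (card (square_class_span S)) K (adjoin K (csqrt ` S))"
proof -
  interpret Q: comm_group "square_class_group K" by (rule comm_group_square_class_group)
  have S0K: "S0 \<subseteq> K - {0}" using S S0 by auto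
  note main = multiquadratic_extension[OF S0(1) S0K]
  have "adjoin K (csqrt ` S) = adjoin K (csqrt ` S0)"
    using S0(2,3) gens_subset_adjoin[of "csqrt ` S" K]
    by (intro antisym adjoin_least adjoin_subfield base_subset_adjoin) auto
  moreover have "square_class_span S = square_class_span S0"
  proof (rule antisym)
    have "square_class K ` S \<subseteq> square_class_span S0" using main S S0(3) by auto
    then show "square_class_span S \<subseteq> square_class_span S0"
      unfolding square_class_span_def
      by (intro Q.generate_subgroup_incl Q.generate_is_subgroup) (use S0K square_class_carrier in auto)
    show "square_class_span S0 \<subseteq> square_class_span S"
      unfolding square_class_span_def by (intro Q.mono_generate image_mono S0(2))
  qed
  ultimately show ?thesis using main by simp
qed

end

section \<open>Irreducible constituents of translation-invariant function spaces\<close>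

text \<open>A linearly independent subset of \<open>W\<close> of maximal size spans \<open>W\<close>, and it has fewer than \<open>n\<close> elements
  because otherwise it would be a basis of the whole space.\<close>

lemma proper_subspace_spanning_set:
  assumes W: "VectorSpace.subspace complex_field W (module_vec TYPE(complex) n)" and ne: "W \<noteq> carrier_vec n"
  obtains B where "finite B" "B \<subseteq> W" "card B < n"
    "\<And>w. w \<in> W \<Longrightarrow> \<exists>a. \<forall>k<n. w $ k = (\<Sum>b\<in>B. a b * b $ k)"
proof -
  interpret V: vec_space "TYPE(complex)" n .
  have sm: "submodule complex_field W (module_vec TYPE(complex) n)" using W by (simp add: VectorSpace.subspace_def)
  have Wc: "W \<subseteq> carrier_vec n" using submodule.subset[OF sm] by (simp add: module_vec_def)
  define P where "P = (\<lambda>k. \<exists>B. B \<subseteq> W \<and> V.lin_indpt B \<and> card B = k)"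
  have bound: "finite B \<and> card B \<le> n" if "B \<subseteq> W" "V.lin_indpt B" for B
    using V.li_le_dim[of B] that Wc by (auto simp: V.dim_is_n)
  have "V.lin_indpt {}" by (simp add: V.lin_dep_def)
  then have "P 0" by (auto simp: P_def intro!: exI[of _ "{}"])
  moreover have "\<And>k. P k \<Longrightarrow> k \<le> n" using bound by (auto simp: P_def)
  ultimately obtain k where k: "P k" "\<And>k'. P k' \<Longrightarrow> k' \<le> k"
    using ex_has_greatest_nat[of P 0 id "Suc n"] by (metis id_apply le_imp_less_Suc)
  then obtain B where B: "B \<subseteq> W" "V.lin_indpt B" "card B = k" by (auto simp: P_def)
  have fB: "finite B" using bound B by auto
  have Bc: "B \<subseteq> carrier_vec n" using B(1) Wc by auto
  have span: "w \<in> V.span B" if w: "w \<in> W" for w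
  proof (cases "w \<in> B")
    case True
    then show ?thesis using V.span_mem[of B w] Bc by auto
  next
    case False
    have "V.lin_dep (B \<union> {w})"
    proof (rule ccontr)
      assume "V.lin_indpt (B \<union> {w})"
      then have "P (Suc k)" using B False w fB by (auto simp: P_def intro!: exI[of _ "insert w B"])
      then show False using k(2) by fastforce
    qed
    then show ?thesis using V.lin_dep_iff_in_span[of B w] B False w Wc Bc by auto
  qed
  have "card B < n"
  proof (rule ccontr)
    assume "\<not> card B < n"
    then have "V.basis B" using V.dim_li_is_basis[of B] B fB Bc by (auto simp: V.dim_is_n)
    then have "V.span B = carrier_vec n" by (auto simp: V.basis_def)
    moreover have "V.span B \<subseteq> W" by (rule V.span_is_subset[OF B(1) sm])
    ultimately show False using ne Wc by auto
  qed
  moreover have "\<exists>a. \<forall>k<n. w $ k = (\<Sum>b\<in>B. a b * b $ k)" if w: "w \<in> W" for w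
  proof -
    obtain a where "w = V.lincomb a B" using span[OF w] V.finite_span[OF fB, of] Bc by auto
    then show ?thesis using V.lincomb_index[OF _ Bc] by auto
  qed
  ultimately show thesis using that fB B(1) by auto
qed

locale finite_group = group G for G (structure) +
  assumes fin: "finite (carrier G)"

text \<open>A space of functions on several copies of the group, indexed by \<open>i\<close>: two copies for eigenfunctions
  of a semi-Cayley digraph, one copy for the range of a convolution operator. It is given by a predicate,
  and functions are compared only at group elements, so values elsewhere require no convention.\<close>

locale invariant_space = finite_group +
  fixes E :: "('i \<Rightarrow> 'a \<Rightarrow> complex) \<Rightarrow> bool"
  assumes lin: "E u \<Longrightarrow> E v \<Longrightarrow> E (\<lambda>i g. a * u i g + b * v i g)"
    and trans: "E u \<Longrightarrow> x \<in> carrier G \<Longrightarrow> E (\<lambda>i g. u i (g \<otimes> x))"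
begin

text \<open>A finite family in \<open>E\<close> whose span is a nonzero invariant subspace. The orbit of any nonzero function
  qualifies, so such families exist; those of minimal size turn out to be linearly independent.\<close>

definition invariant_family :: "'k set \<Rightarrow> ('k \<Rightarrow> 'i \<Rightarrow> 'a \<Rightarrow> complex) \<Rightarrow> bool" where
  "invariant_family I w \<longleftrightarrow> finite I \<and> (\<forall>k\<in>I. E (w k)) \<and>
     (\<exists>k\<in>I. \<exists>i. \<exists>g\<in>carrier G. w k i g \<noteq> 0) \<and>
     (\<forall>x\<in>carrier G. \<exists>A. \<forall>j\<in>I. \<forall>i. \<forall>g\<in>carrier G. w j i (g \<otimes> x) = (\<Sum>k\<in>I. A k j * w k i g))"

lemma invariant_family_reindex:
  assumes w: "invariant_family I w" and s: "bij_betw s J I"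
  shows "invariant_family J (\<lambda>j. w (s j))"
proof -
  have img: "s ` J = I" using s by (simp add: bij_betw_def)
  have "\<exists>A. \<forall>j\<in>J. \<forall>i. \<forall>g\<in>carrier G. w (s j) i (g \<otimes> x) = (\<Sum>k\<in>J. A k j * w (s k) i g)"
    if x: "x \<in> carrier G" for x
  proof -
    obtain A where A: "\<forall>j\<in>I. \<forall>i. \<forall>g\<in>carrier G. w j i (g \<otimes> x) = (\<Sum>k\<in>I. A k j * w k i g)"
      using w x unfolding invariant_family_def by blast
    have "w (s j) i (g \<otimes> x) = (\<Sum>k\<in>J. A (s k) (s j) * w (s k) i g)" if "j \<in> J" "g \<in> carrier G" for j i g
      using A img that sum.reindex_bij_betw[OF s, of "\<lambda>k. A k (s j) * w k i g"] by auto
    then show ?thesis by (intro exI[of _ "\<lambda>k j. A (s k) (s j)"]) auto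
  qed
  moreover have "finite J" using w s by (auto simp: invariant_family_def bij_betw_finite)
  ultimately show ?thesis using w img unfolding invariant_family_def by auto
qed

lemma invariant_family_nat:
  assumes "invariant_family I w"
  shows "\<exists>w' :: nat \<Rightarrow> _. invariant_family {..<card I} w'"
proof -
  have "finite I" using assms by (simp add: invariant_family_def)
  then obtain s where "bij_betw s {..<card I} I" by (metis atLeast0LessThan ex_bij_betw_nat_finite)
  then show ?thesis using invariant_family_reindex[OF assms] by blast
qed

lemma zero_fun: "E u \<Longrightarrow> E (\<lambda>i g. 0)"
  using lin[of u u 0 0] by simp

lemma sum_fun:
  assumes "finite I" "\<And>k. k \<in> I \<Longrightarrow> E (w k)" "E u"
  shows "E (\<lambda>i g. \<Sum>k\<in>I. c k * w k i g)"
  using assms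
proof (induct I)
  case (insert k I)
  then show ?case using lin[of "w k" "\<lambda>i g. \<Sum>k\<in>I. c k * w k i g" "c k" 1] by simp
qed (auto intro: zero_fun)

lemma orbit_family:
  assumes u: "E u" "g \<in> carrier G" "u i g \<noteq> 0"
  shows "invariant_family (carrier G) (\<lambda>h i g. u i (g \<otimes> h))"
proof -
  have "\<exists>A. \<forall>j\<in>carrier G. \<forall>i. \<forall>g\<in>carrier G. u i (g \<otimes> x \<otimes> j) = (\<Sum>k\<in>carrier G. A k j * u i (g \<otimes> k))"
    if x: "x \<in> carrier G" for x
  proof (intro exI[of _ "\<lambda>k j. if k = x \<otimes> j then 1 else 0"] ballI allI)
    fix j i g assume j: "j \<in> carrier G" and g: "g \<in> carrier G"
    have "(\<Sum>k\<in>carrier G. (if k = x \<otimes> j then 1 else 0) * u i (g \<otimes> k))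
        = (\<Sum>k\<in>carrier G. if k = x \<otimes> j then u i (g \<otimes> k) else 0)" by (intro sum.cong) auto
    then show "u i (g \<otimes> x \<otimes> j) = (\<Sum>k\<in>carrier G. (if k = x \<otimes> j then 1 else 0) * u i (g \<otimes> k))"
      using x j g fin by (simp add: m_assoc)
  qed
  moreover have "\<exists>k\<in>carrier G. \<exists>i. \<exists>g\<in>carrier G. u i (g \<otimes> k) \<noteq> 0"
    using u by (intro bexI[of _ \<one>] exI[of _ i] bexI[of _ g]) auto
  ultimately show ?thesis using fin u(1) trans by (auto simp: invariant_family_def)
qed

text \<open>Take an invariant family \<open>w\<close> with the least possible number \<open>n\<close> of members. It is linearly independent,
  since a dependent member could be dropped. Hence the matrices \<open>\<rho> x\<close> of right translation by \<open>x\<close> are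
  unique and form a representation. An invariant proper nonzero subspace of \<open>\<complex>\<^sup>n\<close> would be spanned by fewer
  than \<open>n\<close> vectors, and the corresponding combinations of \<open>w\<close> would be a smaller invariant family.\<close>

lemma irreducible_constituent:
  assumes u: "E u" "g0 \<in> carrier G" "u i0 g0 \<noteq> 0"
  obtains n \<rho> w where "irreducible_representation G n \<rho>" "\<And>j. j < n \<Longrightarrow> E (w j)"
    "\<And>x j i. x \<in> carrier G \<Longrightarrow> j < n \<Longrightarrow> w j i x = (\<Sum>k<n. \<rho> x $$ (k, j) * w k i \<one>)"
    "\<exists>j<n. \<exists>i. w j i \<one> \<noteq> 0"
proof -
  define P where "P = (\<lambda>n. \<exists>w :: nat \<Rightarrow> 'i \<Rightarrow> 'a \<Rightarrow> complex. invariant_family {..<n} w)"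
  define n where "n = (LEAST n. P n)"
  have "P (card (carrier G))" unfolding P_def using invariant_family_nat[OF orbit_family[OF u]] .
  then have "P n" unfolding n_def by (rule LeastI)
  then obtain w :: "nat \<Rightarrow> 'i \<Rightarrow> 'a \<Rightarrow> complex" where w: "invariant_family {..<n} w" by (auto simp: P_def)
  have min: "n \<le> card I" if "invariant_family I w'" for I :: "'k set" and w'
    unfolding n_def using invariant_family_nat[OF that] by (intro Least_le) (simp add: P_def)
  have wE: "\<And>j. j < n \<Longrightarrow> E (w j)" using w by (auto simp: invariant_family_def)
  obtain j1 i1 g1 where w1: "j1 < n" "g1 \<in> carrier G" "w j1 i1 g1 \<noteq> 0"
    using w by (auto simp: invariant_family_def)
  obtain A where A: "\<And>x j i g. x \<in> carrier G \<Longrightarrow> j < n \<Longrightarrow> g \<in> carrier G \<Longrightarrow>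
      w j i (g \<otimes> x) = (\<Sum>k<n. A x k j * w k i g)"
  proof -
    have "\<forall>x\<in>carrier G. \<exists>A. \<forall>j\<in>{..<n}. \<forall>i. \<forall>g\<in>carrier G.
        w j i (g \<otimes> x) = (\<Sum>k<n. A k j * w k i g)"
      using w unfolding invariant_family_def by blast
    then obtain A where "\<forall>x\<in>carrier G. \<forall>j\<in>{..<n}. \<forall>i. \<forall>g\<in>carrier G.
        w j i (g \<otimes> x) = (\<Sum>k<n. A x k j * w k i g)" by (subst (asm) bchoice_iff) blast
    then show thesis using that by auto
  qed
  have indep: "c l = 0" if c: "\<And>i g. g \<in> carrier G \<Longrightarrow> (\<Sum>k<n. c k * w k i g) = 0" and l: "l < n" for c l
  proof (rule ccontr)
    assume cl: "c l \<noteq> 0"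
    have wl: "w l i g = (\<Sum>k\<in>{..<n} - {l}. (- c k / c l) * w k i g)" if g: "g \<in> carrier G" for i g
    proof -
      have "0 = c l * w l i g + (\<Sum>k\<in>{..<n} - {l}. c k * w k i g)"
        using c[OF g] l by (subst (asm) sum.remove[of _ l]) auto
      then have "w l i g = - (\<Sum>k\<in>{..<n} - {l}. c k * w k i g) / c l"
        using cl by (simp add: field_simps add_eq_0_iff)
      also have "\<dots> = (\<Sum>k\<in>{..<n} - {l}. (- c k / c l) * w k i g)"
        by (simp add: sum_divide_distrib sum_negf)
      finally show ?thesis .
    qed
    have "invariant_family ({..<n} - {l}) w"
      unfolding invariant_family_def
    proof (intro conjI ballI)
      show "finite ({..<n} - {l})" by simp
      show "E (w k)" if "k \<in> {..<n} - {l}" for k using that wE by auto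
      show "\<exists>k\<in>{..<n} - {l}. \<exists>i. \<exists>g\<in>carrier G. w k i g \<noteq> 0"
      proof (rule ccontr)
        assume z: "\<not> ?thesis"
        then have "w l i g = 0" if "g \<in> carrier G" for i g using wl[OF that, of i] that by simp
        then show False using z w1 by (cases "j1 = l") auto
      qed
    next
      fix x assume x: "x \<in> carrier G"
      show "\<exists>B. \<forall>j\<in>{..<n} - {l}. \<forall>i. \<forall>g\<in>carrier G.
          w j i (g \<otimes> x) = (\<Sum>k\<in>{..<n} - {l}. B k j * w k i g)"
      proof (intro exI[of _ "\<lambda>k j. A x k j + A x l j * (- c k / c l)"] ballI allI)
        fix j i g assume j: "j \<in> {..<n} - {l}" and g: "g \<in> carrier G"
        have "w j i (g \<otimes> x) = A x l j * w l i g + (\<Sum>k\<in>{..<n} - {l}. A x k j * w k i g)"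
          using A[OF x _ g, of j i] j l by (subst sum.remove[of _ l, symmetric]) auto
        also have "\<dots> = (\<Sum>k\<in>{..<n} - {l}. (A x k j + A x l j * (- c k / c l)) * w k i g)"
          unfolding wl[OF g] by (simp add: sum_distrib_left sum.distrib[symmetric] algebra_simps)
        finally show "w j i (g \<otimes> x) = (\<Sum>k\<in>{..<n} - {l}. (A x k j + A x l j * (- c k / c l)) * w k i g)" .
      qed
    qed
    then have "n \<le> card ({..<n} - {l})" by (rule min)
    then show False using l by simp
  qed
  define \<rho> where "\<rho> x = mat n n (\<lambda>(k, j). A x k j)" for x
  have \<rho>c: "\<rho> x \<in> carrier_mat n n" for x by (simp add: \<rho>_def)
  have \<rho>1: "\<rho> \<one> = 1\<^sub>m n"
  proof (rule eq_matI)
    fix k j assume "k < dim_row (1\<^sub>m n :: complex mat)" "j < dim_col (1\<^sub>m n :: complex mat)"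
    then have k: "k < n" and j: "j < n" by auto
    have "(\<Sum>l<n. (A \<one> l j - (if l = j then 1 else 0)) * w l i g) = 0" if g: "g \<in> carrier G" for i g
    proof -
      have "(\<Sum>l<n. (A \<one> l j - (if l = j then 1 else 0)) * w l i g)
          = (\<Sum>l<n. A \<one> l j * w l i g) - (\<Sum>l<n. if l = j then w l i g else 0)"
        unfolding sum_subtractf[symmetric] by (intro sum.cong) (auto simp: algebra_simps)
      then show ?thesis using A[OF one_closed j g, of i] g j by simp
    qed
    then show "\<rho> \<one> $$ (k, j) = 1\<^sub>m n $$ (k, j)"
      using indep[of "\<lambda>l. A \<one> l j - (if l = j then 1 else 0)" k] k j by (auto simp: \<rho>_def)
  qed (auto simp: \<rho>_def)
  have \<rho>m: "\<rho> (x \<otimes> y) = \<rho> x * \<rho> y" if x: "x \<in> carrier G" and y: "y \<in> carrier G" for x y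
  proof (rule eq_matI)
    fix k j assume "k < dim_row (\<rho> x * \<rho> y)" "j < dim_col (\<rho> x * \<rho> y)"
    then have k: "k < n" and j: "j < n" by (auto simp: \<rho>_def)
    have "(\<Sum>l<n. (A (x \<otimes> y) l j - (\<Sum>r<n. A x l r * A y r j)) * w l i g) = 0" if g: "g \<in> carrier G" for i g
    proof -
      have "w j i (g \<otimes> (x \<otimes> y)) = w j i ((g \<otimes> x) \<otimes> y)" using g x y by (simp add: m_assoc)
      also have "\<dots> = (\<Sum>r<n. A y r j * w r i (g \<otimes> x))" using A[OF y j, of "g \<otimes> x"] g x by simp
      also have "\<dots> = (\<Sum>r<n. A y r j * (\<Sum>l<n. A x l r * w l i g))"
        using A[OF x _ g] by simp
      also have "\<dots> = (\<Sum>l<n. (\<Sum>r<n. A x l r * A y r j) * w l i g)"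
        unfolding sum_distrib_left sum_distrib_right
        by (subst sum.swap) (simp add: mult_ac)
      finally show ?thesis using A[of "x \<otimes> y" j g i] x y j g
        by (simp add: left_diff_distrib sum_subtractf)
    qed
    then have "A (x \<otimes> y) k j - (\<Sum>r<n. A x k r * A y r j) = 0"
      using indep[of "\<lambda>l. A (x \<otimes> y) l j - (\<Sum>r<n. A x l r * A y r j)" k] k by blast
    then show "\<rho> (x \<otimes> y) $$ (k, j) = (\<rho> x * \<rho> y) $$ (k, j)"
      using k j by (simp add: \<rho>_def scalar_prod_def atLeast0LessThan)
  qed (auto simp: \<rho>_def)
  have rep: "representation G n \<rho>"
    unfolding representation_def
  proof (rule homI)
    fix x assume x: "x \<in> carrier G"
    have "\<rho> x * \<rho> (inv x) = 1\<^sub>m n" "\<rho> (inv x) * \<rho> x = 1\<^sub>m n"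
      using \<rho>m[of x "inv x"] \<rho>m[of "inv x" x] x \<rho>1 by auto
    then show "\<rho> x \<in> carrier (units_of (ring_mat TYPE(complex) n ()))"
      using \<rho>c by (auto simp: units_of_def Units_def ring_mat_def)
  qed (simp add: \<rho>m units_of_def ring_mat_def)
  have "irreducible_representation G n \<rho>"
    unfolding irreducible_representation_def
  proof (intro conjI allI impI rep)
    show "0 < n" using w1 by auto
    fix W assume "VectorSpace.subspace complex_field W (module_vec TYPE(complex) n) \<and>
        (\<forall>g\<in>carrier G. \<forall>w\<in>W. \<rho> g *\<^sub>v w \<in> W)"
    then have W: "VectorSpace.subspace complex_field W (module_vec TYPE(complex) n)"
      and inv: "\<And>g w. g \<in> carrier G \<Longrightarrow> w \<in> W \<Longrightarrow> \<rho> g *\<^sub>v w \<in> W" by auto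
    have sm: "submodule complex_field W (module_vec TYPE(complex) n)" using W by (simp add: VectorSpace.subspace_def)
    have Wc: "W \<subseteq> carrier_vec n" using submodule.subset[OF sm] by (simp add: module_vec_def)
    have W0: "0\<^sub>v n \<in> W" using submodule.zero_closed[OF sm] by (simp add: module_vec_def)
    show "W = {0\<^sub>v n} \<or> W = carrier_vec n"
    proof (rule ccontr)
      assume "\<not> ?thesis"
      then have ne: "W \<noteq> {0\<^sub>v n}" "W \<noteq> carrier_vec n" by auto
      obtain B where B: "finite B" "B \<subseteq> W" "card B < n"
        and sp: "\<And>w. w \<in> W \<Longrightarrow> \<exists>a. \<forall>k<n. w $ k = (\<Sum>b\<in>B. a b * b $ k)"
        using proper_subspace_spanning_set[OF W ne(2)] by metis
      define v where "v b i g = (\<Sum>j<n. b $ j * w j i g)" for b i g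
      have "invariant_family B v" unfolding invariant_family_def
      proof (intro conjI ballI)
        show "E (v b)" if "b \<in> B" for b
          using sum_fun[of "{..<n}" w u "\<lambda>j. b $ j"] wE u(1) unfolding v_def by auto
        show "\<exists>b\<in>B. \<exists>i. \<exists>g\<in>carrier G. v b i g \<noteq> 0"
        proof (rule ccontr)
          assume z: "\<not> ?thesis"
          have Bz: "b $ k = 0" if "b \<in> B" "k < n" for b k
            by (rule indep[of "\<lambda>j. b $ j" k]) (use z that in \<open>auto simp: v_def\<close>)
          have "y = 0\<^sub>v n" if y: "y \<in> W" for y
          proof (rule eq_vecI)
            fix k assume "k < dim_vec (0\<^sub>v n :: complex vec)"
            then have k: "k < n" by simp
            obtain a where "\<forall>k<n. y $ k = (\<Sum>b\<in>B. a b * b $ k)" using sp[OF y] by blast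
            then have "y $ k = (\<Sum>b\<in>B. a b * b $ k)" using k by blast
            also have "\<dots> = 0" by (intro sum.neutral) (simp add: Bz k)
            finally show "y $ k = 0\<^sub>v n $ k" using k by simp
          next
            show "dim_vec y = dim_vec (0\<^sub>v n :: complex vec)" using y Wc by force
          qed
          then have "W \<subseteq> {0\<^sub>v n}" by blast
          with W0 ne(1) show False by blast
        qed
        fix x assume x: "x \<in> carrier G"
        have "\<exists>a. \<forall>k<n. (\<rho> x *\<^sub>v b) $ k = (\<Sum>b'\<in>B. a b' * b' $ k)" if "b \<in> B" for b
          using that B(2) by (intro sp inv[OF x]) auto
        then obtain a where a: "\<And>b. b \<in> B \<Longrightarrow> \<forall>k<n. (\<rho> x *\<^sub>v b) $ k = (\<Sum>b'\<in>B. a b b' * b' $ k)"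
          by metis
        show "\<exists>A. \<forall>j\<in>B. \<forall>i. \<forall>g\<in>carrier G. v j i (g \<otimes> x) = (\<Sum>k\<in>B. A k j * v k i g)"
        proof (intro exI[of _ "\<lambda>k j. a j k"] ballI allI)
          fix b i g assume b: "b \<in> B" and g: "g \<in> carrier G"
          have bd: "dim_vec b = n" using b B(2) Wc by auto
          have "v b i (g \<otimes> x) = (\<Sum>j<n. b $ j * (\<Sum>k<n. A x k j * w k i g))"
            unfolding v_def using A[OF x _ g] by simp
          also have "\<dots> = (\<Sum>k<n. (\<Sum>j<n. A x k j * b $ j) * w k i g)"
            unfolding sum_distrib_left sum_distrib_right by (subst sum.swap) (simp add: mult_ac)
          also have "\<dots> = (\<Sum>k<n. (\<rho> x *\<^sub>v b) $ k * w k i g)"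
            using bd by (intro sum.cong) (auto simp: \<rho>_def scalar_prod_def atLeast0LessThan)
          also have "\<dots> = (\<Sum>k<n. (\<Sum>b'\<in>B. a b b' * b' $ k) * w k i g)" using a[OF b] by simp
          also have "\<dots> = (\<Sum>b'\<in>B. a b b' * v b' i g)"
            unfolding v_def sum_distrib_left sum_distrib_right by (subst sum.swap) (simp add: mult_ac)
          finally show "v b i (g \<otimes> x) = (\<Sum>b'\<in>B. a b b' * v b' i g)" .
        qed
      qed (rule B)
      then have "n \<le> card B" by (rule min)
      then show False using B(3) by simp
    qed
  qed
  moreover have val: "w j i x = (\<Sum>k<n. \<rho> x $$ (k, j) * w k i \<one>)" if "x \<in> carrier G" "j < n" for x j i
    using A[OF that one_closed, of i] that by (simp add: \<rho>_def)
  moreover have "\<exists>j<n. \<exists>i. w j i \<one> \<noteq> 0"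
  proof (rule ccontr)
    assume "\<not> ?thesis"
    then have "w j1 i1 g1 = 0" using val[OF w1(2,1), of i1] by simp
    with w1(3) show False by simp
  qed
  ultimately show thesis using that wE by blast
qed

end

section \<open>Characters\<close>

lemma mat_trace_eq: "A \<in> carrier_mat n n \<Longrightarrow> mat_trace A = (\<Sum>i<n. A $$ (i, i))"
  by (auto simp: mat_trace_def diag_mat_def interv_sum_list_conv_sum_set_nat atLeast0LessThan)

lemma mult_mat_entry:
  assumes "A \<in> carrier_mat n n" "B \<in> carrier_mat n n" "i < n" "j < n"
  shows "(A * B) $$ (i, j) = (\<Sum>k<n. A $$ (i, k) * B $$ (k, j))"
  using assms by (auto simp: scalar_prod_def atLeast0LessThan)

lemma mat_trace_mult:
  assumes "A \<in> carrier_mat n n" "B \<in> carrier_mat n n"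
  shows "mat_trace (A * B) = (\<Sum>i<n. \<Sum>k<n. A $$ (i, k) * B $$ (k, i))"
  using assms mult_mat_entry[OF assms] by (simp add: mat_trace_eq[of _ n])

lemma mat_trace_comm:
  assumes "A \<in> carrier_mat n n" "B \<in> carrier_mat n n"
  shows "mat_trace (A * B) = mat_trace (B * A)"
  unfolding mat_trace_mult[OF assms] mat_trace_mult[OF assms(2,1)]
  by (subst sum.swap) (simp add: mult.commute)

lemma upper_triangular_pow:
  fixes B :: "complex mat"
  assumes B: "B \<in> carrier_mat n n" "upper_triangular B"
  shows "(\<forall>i<n. \<forall>j<i. (B ^\<^sub>m k) $$ (i, j) = 0) \<and> (\<forall>i<n. (B ^\<^sub>m k) $$ (i, i) = (B $$ (i, i)) ^ k)"
proof (induct k)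
  case 0
  then show ?case using B by auto
next
  case (Suc k)
  have Bk: "B ^\<^sub>m k \<in> carrier_mat n n" using B by simp
  have Bz: "B $$ (i, j) = 0" if "i < n" "j < i" for i j using B that by (auto simp: upper_triangular_def)
  have "(B ^\<^sub>m Suc k) $$ (i, j) = (\<Sum>l<n. (B ^\<^sub>m k) $$ (i, l) * B $$ (l, j))" if "i < n" "j < n" for i j
    using mult_mat_entry[OF Bk B(1) that] by simp
  moreover have "(\<Sum>l<n. (B ^\<^sub>m k) $$ (i, l) * B $$ (l, j)) = 0" if "i < n" "j < i" for i j
  proof (rule sum.neutral, intro ballI)
    fix l assume "l \<in> {..<n}"
    then show "(B ^\<^sub>m k) $$ (i, l) * B $$ (l, j) = 0" using Suc Bz that by (cases "l < i") auto
  qed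
  moreover have "(\<Sum>l<n. (B ^\<^sub>m k) $$ (i, l) * B $$ (l, i)) = (B ^\<^sub>m k) $$ (i, i) * B $$ (i, i)" if i: "i < n" for i
  proof -
    have "(\<Sum>l\<in>{..<n} - {i}. (B ^\<^sub>m k) $$ (i, l) * B $$ (l, i)) = 0"
    proof (rule sum.neutral, intro ballI)
      fix l assume "l \<in> {..<n} - {i}"
      then show "(B ^\<^sub>m k) $$ (i, l) * B $$ (l, i) = 0" using Suc Bz i by (cases "l < i") auto
    qed
    then show ?thesis using i by (subst sum.remove[of _ i]) auto
  qed
  ultimately show ?case using Suc by (auto simp: mult.commute simp del: pow_mat.simps)
qed

text \<open>The numbers \<open>es i\<close> are the diagonal entries of a triangular form of \<open>A\<close>; its powers have the powers of
  these entries on the diagonal.\<close>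

lemma finite_order_matrix_trace_powers:
  fixes A :: "complex mat"
  assumes A: "A \<in> carrier_mat n n" and m: "A ^\<^sub>m m = 1\<^sub>m n"
  obtains es :: "nat \<Rightarrow> complex" where "\<And>i. i < n \<Longrightarrow> es i ^ m = 1"
    "\<And>k. mat_trace (A ^\<^sub>m k) = (\<Sum>i<n. es i ^ k)"
proof -
  obtain as where "char_poly A = (\<Prod>a\<leftarrow>as. [:- a, 1:])" using char_poly_factorized[OF A] by auto
  then obtain B where B: "B \<in> carrier_mat n n" "upper_triangular B" "similar_mat A B"
    using schur_decomposition_exists[OF A] by auto
  obtain P Q where w: "similar_mat_wit A B P Q" using B(3) by (auto simp: similar_mat_def)
  note wD = similar_mat_witD2[OF A w]
  have pw: "A ^\<^sub>m k = P * B ^\<^sub>m k * Q" for k by (rule similar_mat_wit_pow_id[OF w])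
  have pw': "B ^\<^sub>m k = Q * A ^\<^sub>m k * P" for k by (rule similar_mat_wit_pow_id[OF similar_mat_wit_sym[OF w]])
  have tr: "mat_trace (A ^\<^sub>m k) = (\<Sum>i<n. (B $$ (i, i)) ^ k)" for k
  proof -
    have Bk: "B ^\<^sub>m k \<in> carrier_mat n n" using B by simp
    have "mat_trace (A ^\<^sub>m k) = mat_trace (P * (B ^\<^sub>m k * Q))"
      unfolding pw by (subst assoc_mult_mat[OF wD(6) Bk wD(7)]) simp
    also have "\<dots> = mat_trace (B ^\<^sub>m k * Q * P)" by (rule mat_trace_comm[OF wD(6)]) (use Bk wD in auto)
    also have "B ^\<^sub>m k * Q * P = B ^\<^sub>m k"
      by (subst assoc_mult_mat[OF Bk wD(7,6)]) (simp add: wD(2) right_mult_one_mat[OF Bk])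
    finally show ?thesis using mat_trace_eq[OF Bk] upper_triangular_pow[OF B(1,2)] by simp
  qed
  have "B ^\<^sub>m m = 1\<^sub>m n" unfolding pw' m using wD by simp
  then have "(B $$ (i, i)) ^ m = 1" if "i < n" for i
    using upper_triangular_pow[OF B(1,2), of m] that by simp
  then show thesis using that[of "\<lambda>i. B $$ (i, i)"] tr by blast
qed

lemma scalar_from_eigenspace:
  fixes A :: "complex mat"
  assumes A: "A \<in> carrier_mat n n" and all: "\<And>v. v \<in> carrier_vec n \<Longrightarrow> A *\<^sub>v v = c \<cdot>\<^sub>v v"
    and "i < n" "j < n"
  shows "A $$ (i, j) = (if i = j then c else 0)"
proof -
  have "(A *\<^sub>v unit_vec n j) $ i = (c \<cdot>\<^sub>v unit_vec n j) $ i" by (subst all) auto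
  then show ?thesis using A assms(3,4) by (auto simp: scalar_prod_right_unit)
qed

lemma eigenspace_subspace:
  fixes A :: "complex mat"
  assumes A: "A \<in> carrier_mat n n"
  shows "VectorSpace.subspace complex_field {v \<in> carrier_vec n. A *\<^sub>v v = c \<cdot>\<^sub>v v} (module_vec TYPE(complex) n)"
proof -
  have "submodule complex_field {v \<in> carrier_vec n. A *\<^sub>v v = c \<cdot>\<^sub>v v} (module_vec TYPE(complex) n)"
    by (rule submodule.intro[OF vec_module])
      (use A in \<open>auto simp: module_vec_def mult_add_distrib_mat_vec smult_add_distrib_vec
        mult_mat_vec smult_smult_assoc mult.commute\<close>)
  then show ?thesis unfolding VectorSpace.subspace_def using vec_vs[where ?'a = complex] by auto
qed

definition class_function :: "('a, 'b) monoid_scheme \<Rightarrow> ('a \<Rightarrow> complex) \<Rightarrow> bool" where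
  "class_function G f \<longleftrightarrow> (\<forall>g\<in>carrier G. \<forall>x\<in>carrier G. f (g \<otimes>\<^bsub>G\<^esub> x \<otimes>\<^bsub>G\<^esub> inv\<^bsub>G\<^esub> g) = f x)"

context finite_group
begin

lemma sum_shift_left: "x \<in> carrier G \<Longrightarrow> (\<Sum>t\<in>carrier G. f (x \<otimes> t)) = (\<Sum>t\<in>carrier G. f t)"
  by (rule sum.reindex_bij_witness[of _ "\<lambda>t. inv x \<otimes> t" "\<lambda>t. x \<otimes> t"])
    (auto simp: m_assoc[symmetric])

lemma sum_inverse: "(\<Sum>t\<in>carrier G. f (inv t)) = (\<Sum>t\<in>carrier G. f t)"
  by (rule sum.reindex_bij_witness[of _ "\<lambda>t. inv t" "\<lambda>t. inv t"]) auto

lemma conj_inverse: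
  assumes "g \<in> carrier G" "x \<in> carrier G"
  shows "inv g \<otimes> (g \<otimes> x \<otimes> inv g) \<otimes> g = x" "g \<otimes> (inv g \<otimes> x \<otimes> g) \<otimes> inv g = x"
proof -
  have "inv g \<otimes> (g \<otimes> x \<otimes> inv g) \<otimes> g = (inv g \<otimes> g) \<otimes> x \<otimes> (inv g \<otimes> g)"
    using assms by (simp only: m_assoc inv_closed m_closed)
  then show "inv g \<otimes> (g \<otimes> x \<otimes> inv g) \<otimes> g = x" using assms by simp
  have "g \<otimes> (inv g \<otimes> x \<otimes> g) \<otimes> inv g = (g \<otimes> inv g) \<otimes> x \<otimes> (g \<otimes> inv g)"
    using assms by (simp only: m_assoc inv_closed m_closed)
  then show "g \<otimes> (inv g \<otimes> x \<otimes> g) \<otimes> inv g = x" using assms by simp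
qed

lemma sum_conjugate:
  assumes x: "x \<in> carrier G"
  shows "(\<Sum>t\<in>carrier G. f (x \<otimes> t \<otimes> inv x)) = (\<Sum>t\<in>carrier G. f t)"
  using x conj_inverse[OF x]
  by (intro sum.reindex_bij_witness[of _ "\<lambda>t. inv x \<otimes> t \<otimes> x" "\<lambda>t. x \<otimes> t \<otimes> inv x"]) auto

end

locale irreducible_rep = finite_group G for G (structure) +
  fixes n :: nat and \<rho> :: "'a \<Rightarrow> complex mat"
  assumes irr: "irreducible_representation G n \<rho>"
begin

definition char :: "'a \<Rightarrow> complex" where
  "char = (\<lambda>g\<in>carrier G. mat_trace (\<rho> g))"

lemma char_irr: "char \<in> irr_chars G"
  using irr by (auto simp: irr_chars_def char_def)

lemma rep_hom: "\<rho> \<in> hom G (units_of (ring_mat TYPE(complex) n ()))" and n_pos: "n > 0"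
  using irr by (auto simp: irreducible_representation_def representation_def)

lemma rep_carrier [simp]: "x \<in> carrier G \<Longrightarrow> \<rho> x \<in> carrier_mat n n"
  using hom_in_carrier[OF rep_hom] by (auto simp: units_of_def Units_def ring_mat_def)

lemma rep_mult: "x \<in> carrier G \<Longrightarrow> y \<in> carrier G \<Longrightarrow> \<rho> (x \<otimes> y) = \<rho> x * \<rho> y"
  using hom_mult[OF rep_hom] by (auto simp: units_of_def ring_mat_def)

lemma rep_one: "\<rho> \<one> = 1\<^sub>m n"
proof -
  have "\<rho> \<one> \<in> Units (ring_mat TYPE(complex) n ())" using hom_in_carrier[OF rep_hom one_closed] by (simp add: units_of_def)
  then obtain B where B: "B \<in> carrier_mat n n" "B * \<rho> \<one> = 1\<^sub>m n" by (auto simp: Units_def ring_mat_def)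
  have r: "\<rho> \<one> \<in> carrier_mat n n" by simp
  have "1\<^sub>m n = B * (\<rho> \<one> * \<rho> \<one>)" using B(2) rep_mult[OF one_closed one_closed] by simp
  also have "\<dots> = (B * \<rho> \<one>) * \<rho> \<one>" by (rule assoc_mult_mat[OF B(1) r r, symmetric])
  also have "\<dots> = \<rho> \<one>" unfolding B(2) by (rule left_mult_one_mat[OF r])
  finally show ?thesis by simp
qed

lemma rep_pow: "x \<in> carrier G \<Longrightarrow> \<rho> (x [^] k) = \<rho> x ^\<^sub>m k"
proof (induct k)
  case 0
  then show ?case by (simp add: rep_one carrier_matD(1)[OF rep_carrier])
next
  case (Suc k) then show ?case by (simp add: rep_mult)
qed

lemma char_eq: "x \<in> carrier G \<Longrightarrow> char x = (\<Sum>i<n. \<rho> x $$ (i, i))"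
  by (simp add: char_def mat_trace_eq[OF rep_carrier])

lemma char_one: "char \<one> = of_nat n"
  by (simp add: char_eq rep_one)

lemma char_powers:
  assumes "x \<in> carrier G" "x [^] m = \<one>"
  obtains es :: "nat \<Rightarrow> complex" where "\<And>i. i < n \<Longrightarrow> es i ^ m = 1"
    "\<And>k. char (x [^] k) = (\<Sum>i<n. es i ^ k)"
proof -
  have "\<rho> x ^\<^sub>m m = 1\<^sub>m n" using rep_pow[OF assms(1), of m] assms(2) rep_one by simp
  then show thesis
    using finite_order_matrix_trace_powers[OF rep_carrier[OF assms(1)], of m] that assms(1)
    by (auto simp: char_def rep_pow)
qed

text \<open>The inverse of \<open>x\<close> is a power of \<open>x\<close>, and the inverse of a root of unity is its complex conjugate.\<close>

lemma char_inverse: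
  assumes x: "x \<in> carrier G"
  shows "char (inv x) = cnj (char x)"
proof -
  define m where "m = ord x"
  have m: "x [^] m = \<one>" "m > 0" using x ord_ge_1[OF fin x] by (auto simp: m_def)
  obtain es :: "nat \<Rightarrow> complex" where es: "\<And>i. i < n \<Longrightarrow> es i ^ m = 1"
    "\<And>k. char (x [^] k) = (\<Sum>i<n. es i ^ k)" using char_powers[OF x m(1)] by blast
  have "x [^] (m - 1) \<otimes> x = \<one>" using m x by (metis Suc_diff_1 nat_pow_Suc)
  then have "inv x = x [^] (m - 1)" using x by (intro inv_equality) auto
  then have "char (inv x) = (\<Sum>i<n. es i ^ (m - 1))" using es(2) by simp
  also have "\<dots> = (\<Sum>i<n. cnj (es i))"
  proof (intro sum.cong refl)
    fix i assume i: "i \<in> {..<n}"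
    have "norm (es i) ^ m = 1" using es(1)[of i] i by (simp add: norm_power[symmetric])
    then have "norm (es i) = 1" using m(2) by (metis norm_ge_zero power_eq_1_iff gr_implies_not0 abs_norm_cancel real_norm_def)
    then have "es i * cnj (es i) = 1" by (simp add: complex_norm_square[symmetric])
    moreover have "es i * es i ^ (m - 1) = 1" using es(1)[of i] i m(2) by (simp add: power_eq_if)
    ultimately show "es i ^ (m - 1) = cnj (es i)" by (metis mult.commute mult.left_commute mult.right_neutral)
  qed
  also have "\<dots> = cnj (char x)" using es(2)[of 1] x by simp
  finally show ?thesis .
qed

text \<open>An eigenspace of \<open>A\<close> is invariant under the representation and nonzero, hence everything.\<close>

lemma schur:
  assumes A: "A \<in> carrier_mat n n" and comm: "\<And>x. x \<in> carrier G \<Longrightarrow> A * \<rho> x = \<rho> x * A"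
  obtains c where "\<And>i j. i < n \<Longrightarrow> j < n \<Longrightarrow> A $$ (i, j) = (if i = j then c else 0)"
proof -
  obtain c v where v: "v \<in> carrier_vec n" "v \<noteq> 0\<^sub>v n" "A *\<^sub>v v = c \<cdot>\<^sub>v v"
    using spectrum_non_empty[OF A n_pos] A by (auto simp: spectrum_def eigenvalue_def eigenvector_def)
  define W where "W = {v \<in> carrier_vec n. A *\<^sub>v v = c \<cdot>\<^sub>v v}"
  have "\<rho> g *\<^sub>v w \<in> W" if g: "g \<in> carrier G" and w: "w \<in> W" for g w
  proof -
    have wc: "w \<in> carrier_vec n" "A *\<^sub>v w = c \<cdot>\<^sub>v w" using w by (auto simp: W_def)
    have "A *\<^sub>v (\<rho> g *\<^sub>v w) = \<rho> g *\<^sub>v (A *\<^sub>v w)"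
      using comm[OF g] A rep_carrier[OF g] wc(1) by (metis assoc_mult_mat_vec)
    also have "\<dots> = c \<cdot>\<^sub>v (\<rho> g *\<^sub>v w)" unfolding wc(2) by (rule mult_mat_vec[OF rep_carrier[OF g] wc(1)])
    finally show ?thesis using rep_carrier[OF g] wc(1) by (auto simp: W_def)
  qed
  then have "W = {0\<^sub>v n} \<or> W = carrier_vec n"
    using irr eigenspace_subspace[OF A, of c] unfolding irreducible_representation_def W_def by blast
  moreover have "v \<in> W" using v by (simp add: W_def)
  ultimately have "W = carrier_vec n" using v(2) by blast
  then have "\<And>v. v \<in> carrier_vec n \<Longrightarrow> A *\<^sub>v v = c \<cdot>\<^sub>v v" by (auto simp: W_def)
  then show thesis using scalar_from_eigenspace[OF A] that by blast
qed

text \<open>The matrix of these sums commutes with the representation. The trace identifies the scalar.\<close>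

lemma class_sum_scalar:
  assumes f: "class_function G f" and ij: "i < n" "j < n"
  shows "(\<Sum>t\<in>carrier G. f t * \<rho> t $$ (i, j)) =
    (if i = j then (\<Sum>t\<in>carrier G. f t * char t) / of_nat n else 0)"
proof -
  define A where "A = mat n n (\<lambda>(i, j). \<Sum>t\<in>carrier G. f t * \<rho> t $$ (i, j))"
  have A: "A \<in> carrier_mat n n" by (simp add: A_def)
  have "A * \<rho> x = \<rho> x * A" if x: "x \<in> carrier G" for x
  proof (rule eq_matI)
    fix i j assume "i < dim_row (\<rho> x * A)" "j < dim_col (\<rho> x * A)"
    then have ij: "i < n" "j < n" using rep_carrier[OF x] A by auto
    have "(A * \<rho> x) $$ (i, j) = (\<Sum>t\<in>carrier G. f t * (\<rho> t * \<rho> x) $$ (i, j))"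
      unfolding mult_mat_entry[OF A rep_carrier[OF x] ij]
      using ij by (simp add: A_def sum_distrib_right mult_mat_entry[OF _ rep_carrier[OF x] ij] sum_distrib_left
          mult.assoc sum.swap[of _ "carrier G"])
    also have "\<dots> = (\<Sum>t\<in>carrier G. f (x \<otimes> t \<otimes> inv x) * \<rho> (x \<otimes> t \<otimes> inv x \<otimes> x) $$ (i, j))"
      using x by (subst sum_conjugate[OF x, symmetric]) (simp add: rep_mult)
    also have "\<dots> = (\<Sum>t\<in>carrier G. f t * (\<rho> x * \<rho> t) $$ (i, j))"
      using f x by (intro sum.cong) (auto simp: class_function_def m_assoc rep_mult)
    also have "\<dots> = (\<rho> x * A) $$ (i, j)"
      unfolding mult_mat_entry[OF rep_carrier[OF x] A ij]
      using ij by (simp add: A_def sum_distrib_right mult_mat_entry[OF rep_carrier[OF x] _ ij] sum_distrib_left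
          mult.left_commute sum.swap[of _ "carrier G"])
    finally show "(A * \<rho> x) $$ (i, j) = (\<rho> x * A) $$ (i, j)" .
  qed (use A rep_carrier[OF x] in auto)
  then obtain c where c: "\<And>i j. i < n \<Longrightarrow> j < n \<Longrightarrow> A $$ (i, j) = (if i = j then c else 0)"
    using schur[OF A] by blast
  have "(\<Sum>t\<in>carrier G. f t * char t) = (\<Sum>i<n. A $$ (i, i))"
    by (simp add: char_eq A_def sum_distrib_left sum.swap[of _ "carrier G"])
  also have "\<dots> = of_nat n * c" using c by simp
  finally have "c = (\<Sum>t\<in>carrier G. f t * char t) / of_nat n" using n_pos by simp
  then show ?thesis using c[OF ij] ij by (simp add: A_def)
qed

end

lemma irr_charsE:
  assumes "\<chi> \<in> irr_chars G" "finite_group G"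
  obtains n \<rho> where "irreducible_rep G n \<rho>" "\<chi> = irreducible_rep.char G \<rho>"
proof -
  obtain n \<rho> where r: "irreducible_representation G n \<rho>" "\<chi> = (\<lambda>g\<in>carrier G. mat_trace (\<rho> g))"
    using assms(1) by (auto simp: irr_chars_def)
  then have i: "irreducible_rep G n \<rho>"
    using assms(2) by (simp add: irreducible_rep_def irreducible_rep_axioms_def)
  show thesis using that[OF i] r(2) by (simp add: irreducible_rep.char_def[OF i])
qed

text \<open>Suppose \<open>f \<noteq> 0\<close> and let \<open>F\<close> be the operator \<open>(F v)(h) = \<Sum>\<^sub>t f(t) v(t h)\<close>. Its range is nonzero and invariant
  under right translation, so it contains a function \<open>w = F v\<close> built from an irreducible representation
  \<open>\<rho>\<close>. The adjoint of \<open>F\<close> is given by \<open>t \<mapsto> f(t\<^sup>-\<^sup>1)\<close>; the corresponding class sum of \<open>\<rho>\<close> is the scalar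
  \<open>cnj (\<Sum>\<^sub>t f(t) \<chi>(t)) / n = 0\<close>, so the adjoint annihilates \<open>w\<close>. Then \<open>\<langle>w, w\<rangle> = \<langle>w, F v\<rangle> = 0\<close>, a contradiction.\<close>

theorem (in finite_group) class_function_determined_by_characters:
  assumes f: "class_function G f" and real: "\<And>t. f t \<in> \<real>"
    and zero: "\<And>\<chi>. \<chi> \<in> irr_chars G \<Longrightarrow> (\<Sum>t\<in>carrier G. f t * \<chi> t) = 0"
    and t0: "t0 \<in> carrier G"
  shows "f t0 = 0"
proof (rule ccontr)
  assume n0: "f t0 \<noteq> 0"
  define E :: "(unit \<Rightarrow> 'a \<Rightarrow> complex) \<Rightarrow> bool" where
    "E u \<longleftrightarrow> (\<exists>v. \<forall>i. \<forall>h\<in>carrier G. u i h = (\<Sum>t\<in>carrier G. f t * v (t \<otimes> h)))" for u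
  interpret E: invariant_space G E
  proof
    fix u v :: "unit \<Rightarrow> 'a \<Rightarrow> complex" and a b assume "E u" "E v"
    then obtain p q where "\<forall>i. \<forall>h\<in>carrier G. u i h = (\<Sum>t\<in>carrier G. f t * p (t \<otimes> h))"
      "\<forall>i. \<forall>h\<in>carrier G. v i h = (\<Sum>t\<in>carrier G. f t * q (t \<otimes> h))" by (auto simp: E_def)
    then show "E (\<lambda>i g. a * u i g + b * v i g)" unfolding E_def
      by (intro exI[of _ "\<lambda>g. a * p g + b * q g"])
        (simp add: sum_distrib_left distrib_left sum.distrib mult.left_commute)
  next
    fix u :: "unit \<Rightarrow> 'a \<Rightarrow> complex" and x assume "E u" and x: "x \<in> carrier G"
    then obtain p where "\<forall>i. \<forall>h\<in>carrier G. u i h = (\<Sum>t\<in>carrier G. f t * p (t \<otimes> h))" by (auto simp: E_def)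
    then show "E (\<lambda>i g. u i (g \<otimes> x))" unfolding E_def
      using x by (intro exI[of _ "\<lambda>g. p (g \<otimes> x)"]) (auto simp: m_assoc intro!: sum.cong)
  qed
  define u :: "unit \<Rightarrow> 'a \<Rightarrow> complex" where
    "u i h = (\<Sum>t\<in>carrier G. f t * (if t \<otimes> h = t0 then 1 else 0))" for i h
  have "E u" by (auto simp: E_def u_def intro!: exI[of _ "\<lambda>g. if g = t0 then 1 else 0"])
  moreover have "u () \<one> = f t0"
  proof -
    have "u () \<one> = (\<Sum>t\<in>carrier G. if t = t0 then f t else 0)" unfolding u_def by (intro sum.cong) auto
    then show ?thesis using t0 fin by simp
  qed
  ultimately obtain n \<rho> w where r: "irreducible_representation G n \<rho>" and wE: "\<And>j. j < n \<Longrightarrow> E (w j)"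
    and w: "\<And>x j i. x \<in> carrier G \<Longrightarrow> j < n \<Longrightarrow> w j i x = (\<Sum>k<n. \<rho> x $$ (k, j) * w k i \<one>)"
    and nz: "\<exists>j<n. \<exists>i. w j i \<one> \<noteq> 0"
    using E.irreducible_constituent[of u \<one> "()"] n0 by auto
  interpret r: irreducible_rep G n \<rho> by standard (rule r)
  obtain j where j: "j < n" "w j () \<one> \<noteq> 0" using nz by auto
  define f' where "f' t = f (inv t)" for t
  have cf': "class_function G f'"
  proof -
    have "inv (g \<otimes> x \<otimes> inv g) = g \<otimes> inv x \<otimes> inv g" if "g \<in> carrier G" "x \<in> carrier G" for g x
      using that by (simp add: inv_mult_group m_assoc)
    then show ?thesis using f by (auto simp: class_function_def f'_def)
  qed
  have "(\<Sum>t\<in>carrier G. f' t * r.char t) = (\<Sum>t\<in>carrier G. f t * r.char (inv t))"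
    by (subst sum_inverse[symmetric]) (simp add: f'_def)
  also have "\<dots> = cnj (\<Sum>t\<in>carrier G. f t * r.char t)"
    using real by (simp add: r.char_inverse Reals_cnj_iff)
  finally have "(\<Sum>t\<in>carrier G. f' t * r.char t) = 0" using zero[OF r.char_irr] by simp
  then have ann: "(\<Sum>t\<in>carrier G. f' t * \<rho> t $$ (i, k)) = 0" if "i < n" "k < n" for i k
    using r.class_sum_scalar[OF cf' that] by simp
  \<comment> \<open>The adjoint operator annihilates the constituent.\<close>
  have F': "(\<Sum>t\<in>carrier G. f t * w j () (inv t \<otimes> g)) = 0" if g: "g \<in> carrier G" for g
  proof -
    have "(\<Sum>t\<in>carrier G. f t * w j () (inv t \<otimes> g)) = (\<Sum>t\<in>carrier G. f' t * w j () (t \<otimes> g))"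
      by (subst sum_inverse[symmetric]) (simp add: f'_def)
    also have "\<dots> = (\<Sum>t\<in>carrier G. f' t * (\<Sum>k<n. (\<Sum>l<n. \<rho> t $$ (k, l) * \<rho> g $$ (l, j)) * w k () \<one>))"
    proof (rule sum.cong[OF refl])
      fix t assume t: "t \<in> carrier G"
      have "w j () (t \<otimes> g) = (\<Sum>k<n. \<rho> (t \<otimes> g) $$ (k, j) * w k () \<one>)"
        using t g by (intro w j(1)) auto
      also have "\<dots> = (\<Sum>k<n. (\<Sum>l<n. \<rho> t $$ (k, l) * \<rho> g $$ (l, j)) * w k () \<one>)"
        using t g j(1) by (intro sum.cong) (auto simp: r.rep_mult mult_mat_entry[of _ n])
      finally show "f' t * w j () (t \<otimes> g)
          = f' t * (\<Sum>k<n. (\<Sum>l<n. \<rho> t $$ (k, l) * \<rho> g $$ (l, j)) * w k () \<one>)" by simp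
    qed
    also have "\<dots> = (\<Sum>t\<in>carrier G. \<Sum>k<n. \<Sum>l<n. (f' t * \<rho> t $$ (k, l)) * (\<rho> g $$ (l, j) * w k () \<one>))"
      by (simp only: sum_distrib_left sum_distrib_right mult.assoc)
    also have "\<dots> = (\<Sum>k<n. \<Sum>t\<in>carrier G. \<Sum>l<n. (f' t * \<rho> t $$ (k, l)) * (\<rho> g $$ (l, j) * w k () \<one>))"
      by (rule sum.swap)
    also have "\<dots> = (\<Sum>k<n. \<Sum>l<n. \<Sum>t\<in>carrier G. (f' t * \<rho> t $$ (k, l)) * (\<rho> g $$ (l, j) * w k () \<one>))"
      by (intro sum.cong refl sum.swap)
    also have "\<dots> = (\<Sum>k<n. \<Sum>l<n. (\<Sum>t\<in>carrier G. f' t * \<rho> t $$ (k, l)) * (\<rho> g $$ (l, j) * w k () \<one>))"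
      by (simp only: sum_distrib_right)
    also have "\<dots> = 0" using ann by simp
    finally show ?thesis .
  qed
  obtain v where v: "\<forall>h\<in>carrier G. w j () h = (\<Sum>t\<in>carrier G. f t * v (t \<otimes> h))"
    using wE[OF j(1)] by (auto simp: E_def)
  have "(\<Sum>h\<in>carrier G. w j () h * cnj (w j () h))
      = (\<Sum>h\<in>carrier G. \<Sum>t\<in>carrier G. f t * (w j () h * cnj (v (t \<otimes> h))))"
    using v real by (intro sum.cong) (auto simp: sum_distrib_left Reals_cnj_iff mult_ac)
  also have "\<dots> = (\<Sum>t\<in>carrier G. \<Sum>h\<in>carrier G. f t * (w j () h * cnj (v (t \<otimes> h))))"
    by (rule sum.swap)
  also have "\<dots> = (\<Sum>t\<in>carrier G. \<Sum>h\<in>carrier G. f t * (w j () (inv t \<otimes> h) * cnj (v h)))"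
  proof (rule sum.cong[OF refl])
    fix t assume t: "t \<in> carrier G"
    show "(\<Sum>h\<in>carrier G. f t * (w j () h * cnj (v (t \<otimes> h))))
        = (\<Sum>h\<in>carrier G. f t * (w j () (inv t \<otimes> h) * cnj (v h)))"
      using t by (subst sum_shift_left[of "inv t", symmetric])
        (auto simp: m_assoc[symmetric] intro!: sum.cong)
  qed
  also have "\<dots> = (\<Sum>h\<in>carrier G. (\<Sum>t\<in>carrier G. f t * w j () (inv t \<otimes> h)) * cnj (v h))"
    by (subst sum.swap) (simp add: sum_distrib_right mult.assoc)
  also have "\<dots> = 0" using F' by simp
  finally have "complex_of_real (\<Sum>h\<in>carrier G. (norm (w j () h))\<^sup>2) = 0"
    by (simp only: of_real_sum complex_norm_square)
  then have "(\<Sum>h\<in>carrier G. (norm (w j () h))\<^sup>2) = 0" by (simp only: of_real_eq_0_iff)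
  then have "norm (w j () \<one>) = 0" using fin by (simp add: sum_nonneg_eq_0_iff)
  with j(2) show False by simp
qed

section \<open>The spectrum of a quasi-abelian semi-Cayley digraph\<close>

text \<open>Eigenvectors become functions on the vertices, which removes the chosen order of the vertices.\<close>

lemma adjacency_spectrum_iff:
  assumes fin: "finite (pverts D)"
  shows "c \<in> spectrum (adjacency_matrix D) \<longleftrightarrow>
    (\<exists>f. (\<exists>v\<in>pverts D. f v \<noteq> 0) \<and>
      (\<forall>v\<in>pverts D. (\<Sum>w\<in>pverts D. if (v, w) \<in> parcs D then f w else 0) = c * f v))"
proof -
  define vs where "vs = vertex_list D"
  define n where "n = length vs"
  have vs: "distinct vs" "set vs = pverts D"
  proof -
    obtain xs where "distinct xs \<and> set xs = pverts D" using finite_distinct_list[OF fin] by auto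
    then have "distinct vs \<and> set vs = pverts D" unfolding vs_def vertex_list_def by (rule someI)
    then show "distinct vs" "set vs = pverts D" by auto
  qed
  define A where "A = adjacency_matrix D"
  have A: "A = mat n n (\<lambda>(i, j). if (vs ! i, vs ! j) \<in> parcs D then 1 else 0)"
    by (simp add: A_def adjacency_matrix_def Let_def vs_def n_def)
  have bij: "bij_betw (\<lambda>i. vs ! i) {..<n} (pverts D)"
    using bij_betw_nth[OF vs(1), of "{..<n}" "pverts D"] vs by (simp add: n_def)
  have sum: "(\<Sum>w\<in>pverts D. g w) = (\<Sum>j<n. g (vs ! j))" for g :: "_ \<Rightarrow> complex"
    using sum.reindex_bij_betw[OF bij, of g] by simp
  have ball: "(\<forall>v\<in>pverts D. P v) \<longleftrightarrow> (\<forall>i<n. P (vs ! i))" for P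
    unfolding bij_betw_imp_surj_on[OF bij, symmetric] by auto
  have app: "(A *\<^sub>v v) $ i = (\<Sum>j<n. if (vs ! i, vs ! j) \<in> parcs D then v $ j else 0)"
    if "i < n" "v \<in> carrier_vec n" for v i
    using that by (auto simp: A scalar_prod_def atLeast0LessThan intro!: sum.cong)
  show ?thesis
  proof
    assume "c \<in> spectrum (adjacency_matrix D)"
    then obtain v where v: "v \<in> carrier_vec n" "v \<noteq> 0\<^sub>v n" "A *\<^sub>v v = c \<cdot>\<^sub>v v"
      by (auto simp: spectrum_def eigenvalue_def eigenvector_def A_def[symmetric]) (simp add: A)
    define f where "f w = v $ (the_inv_into {..<n} (\<lambda>i. vs ! i) w)" for w
    have f: "f (vs ! i) = v $ i" if "i < n" for i
      using the_inv_into_f_f[of "\<lambda>i. vs ! i" "{..<n}" i] bij that by (simp add: f_def bij_betw_def)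
    have "\<exists>i<n. v $ i \<noteq> 0" using v(1,2) by (metis carrier_vecD eq_vecI index_zero_vec)
    then have "\<exists>w\<in>pverts D. f w \<noteq> 0" using f vs n_def by (metis nth_mem)
    moreover have "(\<Sum>j<n. if (vs ! i, vs ! j) \<in> parcs D then f (vs ! j) else 0) = c * f (vs ! i)"
      if i: "i < n" for i
    proof -
      have "(\<Sum>j<n. if (vs ! i, vs ! j) \<in> parcs D then f (vs ! j) else 0) = (A *\<^sub>v v) $ i"
        unfolding app[OF i v(1)] by (intro sum.cong) (auto simp: f)
      then show ?thesis using v i by (simp add: f)
    qed
    ultimately show "\<exists>f. (\<exists>v\<in>pverts D. f v \<noteq> 0) \<and>
      (\<forall>v\<in>pverts D. (\<Sum>w\<in>pverts D. if (v, w) \<in> parcs D then f w else 0) = c * f v)"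
      unfolding sum by (intro exI[of _ f] conjI) (auto simp: ball)
  next
    assume "\<exists>f. (\<exists>v\<in>pverts D. f v \<noteq> 0) \<and>
      (\<forall>v\<in>pverts D. (\<Sum>w\<in>pverts D. if (v, w) \<in> parcs D then f w else 0) = c * f v)"
    then obtain f where f: "\<exists>v\<in>pverts D. f v \<noteq> 0"
      "\<forall>v\<in>pverts D. (\<Sum>w\<in>pverts D. if (v, w) \<in> parcs D then f w else 0) = c * f v" by auto
    define v where "v = vec n (\<lambda>i. f (vs ! i))"
    have v: "v \<in> carrier_vec n" by (simp add: v_def)
    have "A *\<^sub>v v = c \<cdot>\<^sub>v v"
    proof (rule eq_vecI)
      fix i assume "i < dim_vec (c \<cdot>\<^sub>v v)"
      then have i: "i < n" by (simp add: v_def)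
      have "(A *\<^sub>v v) $ i = (\<Sum>j<n. if (vs ! i, vs ! j) \<in> parcs D then f (vs ! j) else 0)"
        unfolding app[OF i v] by (intro sum.cong) (auto simp: v_def)
      also have "\<dots> = c * f (vs ! i)" using f(2) i unfolding sum ball by blast
      finally show "(A *\<^sub>v v) $ i = (c \<cdot>\<^sub>v v) $ i" using i by (simp add: v_def)
    qed (simp add: A v_def)
    moreover have "v \<noteq> 0\<^sub>v n"
    proof
      assume z: "v = 0\<^sub>v n"
      have "f (vs ! i) = 0" if "i < n" for i
      proof -
        have "v $ i = 0" using z that by simp
        then show ?thesis using that by (simp add: v_def)
      qed
      then have "\<forall>v\<in>pverts D. f v = 0" by (simp add: ball)
      with f(1) show False by blast
    qed
    ultimately show "c \<in> spectrum (adjacency_matrix D)"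
      unfolding A_def[symmetric] spectrum_def eigenvalue_def eigenvector_def
      using v by (auto simp: A intro!: exI[of _ v])
  qed
qed

subsection \<open>Sums over unions of conjugacy classes\<close>

lemma (in finite_group) union_of_conj_classes_iff:
  assumes S: "union_of_conj_classes G S" and g: "g \<in> carrier G" and x: "x \<in> carrier G"
  shows "g \<otimes> x \<otimes> inv g \<in> S \<longleftrightarrow> x \<in> S"
proof -
  have closed: "h \<otimes> y \<otimes> inv h \<in> S" if y: "y \<in> S" and h: "h \<in> carrier G" for y h
  proof -
    obtain R where R: "R \<subseteq> carrier G" "S = (\<Union>x\<in>R. conj_class G x)"
      using S by (auto simp: union_of_conj_classes_def)
    then obtain r k where r: "r \<in> R" "k \<in> carrier G" "y = k \<otimes> r \<otimes> inv k"
      using y by (auto simp: conj_class_def)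
    then have "r \<in> carrier G" using R by auto
    note r = r this
    have "h \<otimes> y \<otimes> inv h = (h \<otimes> k) \<otimes> r \<otimes> inv (h \<otimes> k)"
      using r h by (simp add: m_assoc inv_mult_group)
    then show ?thesis using r h R(2) by (auto simp: conj_class_def)
  qed
  have "inv g \<otimes> (g \<otimes> x \<otimes> inv g) \<otimes> inv (inv g) = x" using g x conj_inverse(1) by simp
  then show ?thesis using closed[of x g] closed[of "g \<otimes> x \<otimes> inv g" "inv g"] g by auto
qed

context irreducible_rep
begin

definition char_avg :: "'a set \<Rightarrow> complex" where
  "char_avg S = (\<Sum>t\<in>S. char t) / of_nat n"

lemma rep_sum_scalar:
  assumes S: "union_of_conj_classes G S" "S \<subseteq> carrier G" and ij: "i < n" "j < n"
  shows "(\<Sum>t\<in>S. \<rho> t $$ (i, j)) = (if i = j then char_avg S else 0)"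
proof -
  define f :: "'a \<Rightarrow> complex" where "f t = (if t \<in> S then 1 else 0)" for t
  have "class_function G f"
    using union_of_conj_classes_iff[OF S(1)] by (simp add: class_function_def f_def)
  moreover have "(\<Sum>t\<in>carrier G. f t * g t) = (\<Sum>t\<in>S. g t)" for g
  proof -
    have "(\<Sum>t\<in>carrier G. f t * g t) = (\<Sum>t\<in>carrier G. if t \<in> S then g t else 0)"
      by (intro sum.cong) (auto simp: f_def)
    also have "\<dots> = (\<Sum>t\<in>S. g t)"
      using sum.inter_restrict[OF fin, of g S] S(2) by (simp add: Int_absorb1)
    finally show ?thesis .
  qed
  ultimately show ?thesis using class_sum_scalar[of f i j] ij by (simp add: char_avg_def)
qed

text \<open>The left-hand side is the trace of a product of two class sums, which are scalar matrices.\<close>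

lemma char_product_sum:
  assumes S: "union_of_conj_classes G S" "S \<subseteq> carrier G"
    and S': "union_of_conj_classes G S'" "S' \<subseteq> carrier G"
  shows "(\<Sum>x\<in>S. \<Sum>y\<in>S'. char (x \<otimes> y)) = of_nat n * char_avg S * char_avg S'"
proof -
  have "(\<Sum>x\<in>S. \<Sum>y\<in>S'. char (x \<otimes> y)) = (\<Sum>x\<in>S. \<Sum>y\<in>S'. \<Sum>i<n. \<Sum>k<n. \<rho> x $$ (i, k) * \<rho> y $$ (k, i))"
  proof (intro sum.cong refl)
    fix x y assume "x \<in> S" "y \<in> S'"
    then have "x \<in> carrier G" "y \<in> carrier G" using S S' by auto
    then show "char (x \<otimes> y) = (\<Sum>i<n. \<Sum>k<n. \<rho> x $$ (i, k) * \<rho> y $$ (k, i))"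
      by (simp add: char_def rep_mult mat_trace_mult[of _ n])
  qed
  also have "\<dots> = (\<Sum>x\<in>S. \<Sum>i<n. \<Sum>k<n. \<rho> x $$ (i, k) * (\<Sum>y\<in>S'. \<rho> y $$ (k, i)))"
    unfolding sum_distrib_left by (intro sum.cong refl) (subst sum.swap, intro sum.cong refl, rule sum.swap)
  also have "\<dots> = (\<Sum>x\<in>S. \<Sum>i<n. \<rho> x $$ (i, i) * char_avg S')"
  proof (intro sum.cong refl)
    fix x i assume i: "i \<in> {..<n}"
    have "(\<Sum>k<n. \<rho> x $$ (i, k) * (\<Sum>y\<in>S'. \<rho> y $$ (k, i)))
        = (\<Sum>k<n. if k = i then \<rho> x $$ (i, i) * char_avg S' else 0)"
      using i by (intro sum.cong) (auto simp: rep_sum_scalar[OF S'])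
    then show "(\<Sum>k<n. \<rho> x $$ (i, k) * (\<Sum>y\<in>S'. \<rho> y $$ (k, i))) = \<rho> x $$ (i, i) * char_avg S'"
      using i by simp
  qed
  also have "\<dots> = (\<Sum>i<n. (\<Sum>x\<in>S. \<rho> x $$ (i, i)) * char_avg S')"
    unfolding sum_distrib_right by (rule sum.swap)
  also have "\<dots> = of_nat n * char_avg S * char_avg S'" using rep_sum_scalar[OF S] by simp
  finally show ?thesis .
qed

lemma rep_sum_mult:
  assumes S: "union_of_conj_classes G S" "S \<subseteq> carrier G" and h: "h \<in> carrier G" and ij: "i < n" "j < n"
  shows "(\<Sum>t\<in>S. \<rho> (t \<otimes> h) $$ (i, j)) = char_avg S * \<rho> h $$ (i, j)"
proof -
  have "(\<Sum>t\<in>S. \<rho> (t \<otimes> h) $$ (i, j)) = (\<Sum>t\<in>S. \<Sum>k<n. \<rho> t $$ (i, k) * \<rho> h $$ (k, j))"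
    using S h ij by (intro sum.cong) (auto simp: rep_mult mult_mat_entry[of _ n] subset_iff)
  also have "\<dots> = (\<Sum>k<n. (\<Sum>t\<in>S. \<rho> t $$ (i, k)) * \<rho> h $$ (k, j))"
    unfolding sum_distrib_right by (rule sum.swap)
  also have "\<dots> = (\<Sum>k<n. if k = i then char_avg S * \<rho> h $$ (i, j) else 0)"
    using ij by (intro sum.cong) (auto simp: rep_sum_scalar[OF S])
  also have "\<dots> = char_avg S * \<rho> h $$ (i, j)" using ij by simp
  finally show ?thesis .
qed

end

subsection \<open>Character sums over multisets\<close>

lemma char_sum_empty: "char_sum \<chi> {#} = 0"
  by (simp add: char_sum_def)

lemma char_sum_add: "char_sum \<chi> (A + B) = char_sum \<chi> A + char_sum \<chi> B"
  by (simp add: char_sum_def)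

lemma char_sum_repeat: "char_sum \<chi> (repeat_mset k A) = of_nat k * char_sum \<chi> A"
  by (induct k) (simp_all add: char_sum_add char_sum_empty distrib_right)

lemma char_sum_mset_set: "char_sum \<chi> (mset_set S) = (\<Sum>t\<in>S. \<chi> t)"
  by (simp add: char_sum_def sum_unfold_sum_mset)

lemma char_sum_mset_prod:
  "char_sum \<chi> (mset_prod G A B) = (\<Sum>x\<in>#A. \<Sum>y\<in>#B. \<chi> (x \<otimes>\<^bsub>G\<^esub> y))"
  by (induct A) (auto simp: mset_prod_def char_sum_def multiset.map_comp comp_def)

lemma char_sum_diff:
  "char_sum \<chi> (A - B) - char_sum \<chi> (B - A) = char_sum \<chi> A - char_sum \<chi> B"
proof -
  have "(A - B) + B = (B - A) + A" by (rule multiset_eqI) simp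
  then have "char_sum \<chi> (A - B) + char_sum \<chi> B = char_sum \<chi> (B - A) + char_sum \<chi> A"
    by (metis char_sum_add)
  then show ?thesis by (simp add: algebra_simps)
qed

text \<open>The right-hand side is the characteristic equation with the square completed.\<close>

lemma two_by_two_eigenvalue_iff:
  fixes a b c d x :: complex
  shows "(\<exists>u v. (u \<noteq> 0 \<or> v \<noteq> 0) \<and> a * u + b * v = x * u \<and> c * u + d * v = x * v) \<longleftrightarrow>
    (2 * x - (a + d)) ^ 2 = (a - d) ^ 2 + 4 * b * c"
proof -
  have disc: "(2 * x - (a + d)) ^ 2 = (a - d) ^ 2 + 4 * b * c \<longleftrightarrow> (x - a) * (x - d) = b * c"
  proof -
    have "(2 * x - (a + d)) ^ 2 - ((a - d) ^ 2 + 4 * b * c) = 4 * ((x - a) * (x - d) - b * c)"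
      by (simp add: power2_eq_square algebra_simps)
    then show ?thesis by (metis eq_iff_diff_eq_0 mult_eq_0_iff zero_neq_numeral)
  qed
  show ?thesis unfolding disc
  proof
    assume "\<exists>u v. (u \<noteq> 0 \<or> v \<noteq> 0) \<and> a * u + b * v = x * u \<and> c * u + d * v = x * v"
    then obtain u v where nz: "u \<noteq> 0 \<or> v \<noteq> 0" and "a * u + b * v = x * u" "c * u + d * v = x * v" by blast
    then have "(x - a) * u = b * v" "(x - d) * v = c * u"
      unfolding left_diff_distrib by (metis add_diff_cancel_left', metis add_diff_cancel_right')
    note uv = nz this
    have "((x - a) * (x - d) - b * c) * u = (x - d) * ((x - a) * u) - b * (c * u)" by (simp add: algebra_simps)
    also have "\<dots> = 0" unfolding uv(2) uv(3)[symmetric] by (simp add: algebra_simps)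
    finally have 1: "((x - a) * (x - d) - b * c) * u = 0" .
    have "((x - a) * (x - d) - b * c) * v = (x - a) * ((x - d) * v) - c * (b * v)" by (simp add: algebra_simps)
    also have "\<dots> = 0" unfolding uv(3) uv(2)[symmetric] by (simp add: algebra_simps)
    finally show "(x - a) * (x - d) = b * c" using 1 uv(1) by auto
  next
    assume e: "(x - a) * (x - d) = b * c"
    \<comment> \<open>The columns of the adjugate of \<open>x\<close> minus the matrix are eigenvectors; if both vanish, the matrix is scalar.\<close>
    have "a * b + b * (x - a) = x * b" "c * b + d * (x - a) = x * (x - a)"
      "a * (x - d) + b * c = x * (x - d)" "c * (x - d) + d * c = x * c"
      using e by (simp_all add: algebra_simps)
    moreover have "a * 1 + b * 0 = x * 1" "c * 1 + d * 0 = x * 0" if "x = a" "c = 0" using that by auto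
    ultimately show "\<exists>u v. (u \<noteq> 0 \<or> v \<noteq> 0) \<and> a * u + b * v = x * u \<and> c * u + d * v = x * v"
      by (metis right_minus_eq one_neq_zero)
  qed
qed

subsection \<open>Eigenvalues\<close>

locale quasi_abelian_semi_cayley = finite_group G for G (structure) +
  fixes T11 T22 T12 T21 :: "'a set"
  assumes sub: "T11 \<subseteq> carrier G" "T22 \<subseteq> carrier G" "T12 \<subseteq> carrier G" "T21 \<subseteq> carrier G"
    and qa: "quasi_abelian G T11 T22 T12 T21"
begin

lemma classes: "union_of_conj_classes G T11" "union_of_conj_classes G T22"
  "union_of_conj_classes G T12" "union_of_conj_classes G T21"
  using qa by (auto simp: quasi_abelian_def)

abbreviation \<Gamma> where "\<Gamma> \<equiv> semi_cayley G T11 T22 T12 T21"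

text \<open>The index \<open>True\<close> stands for the first copy of the group and \<open>False\<close> for the second.\<close>

definition eigenfunction :: "complex \<Rightarrow> (bool \<Rightarrow> 'a \<Rightarrow> complex) \<Rightarrow> bool" where
  "eigenfunction c u \<longleftrightarrow> (\<forall>h\<in>carrier G.
     (\<Sum>t\<in>T11. u True (t \<otimes> h)) + (\<Sum>t\<in>T12. u False (t \<otimes> h)) = c * u True h \<and>
     (\<Sum>t\<in>T21. u True (t \<otimes> h)) + (\<Sum>t\<in>T22. u False (t \<otimes> h)) = c * u False h)"

lemma neighbour_sum:
  assumes "S \<subseteq> carrier G" "h \<in> carrier G"
  shows "(\<Sum>g\<in>carrier G. if g \<otimes> inv h \<in> S then f g else (0::complex)) = (\<Sum>t\<in>S. f (t \<otimes> h))"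
proof -
  have 1: "g \<otimes> inv h \<otimes> h = g" "t \<otimes> h \<otimes> inv h = t" if "g \<in> carrier G" "t \<in> carrier G" for g t
    using that assms(2) by (simp_all add: m_assoc)
  have "(\<Sum>g\<in>carrier G. if g \<otimes> inv h \<in> S then f g else 0) = (\<Sum>g\<in>{g \<in> carrier G. g \<otimes> inv h \<in> S}. f g)"
    using fin by (simp add: sum.inter_filter)
  also have "\<dots> = (\<Sum>t\<in>S. f (t \<otimes> h))"
    using assms 1 by (intro sum.reindex_bij_witness[of _ "\<lambda>t. t \<otimes> h" "\<lambda>g. g \<otimes> inv h"]) auto
  finally show ?thesis .
qed

lemma spectrum_eigenfunction_iff:
  "c \<in> spectrum (adjacency_matrix \<Gamma>) \<longleftrightarrow>
    (\<exists>u. eigenfunction c u \<and> (\<exists>i. \<exists>g\<in>carrier G. u i g \<noteq> 0))"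
proof -
  have V: "pverts \<Gamma> = carrier G <+> carrier G" by (simp add: semi_cayley_def)
  have arcs: "(Inl h, Inl g) \<in> parcs \<Gamma> \<longleftrightarrow> g \<otimes> inv h \<in> T11"
    "(Inl h, Inr g) \<in> parcs \<Gamma> \<longleftrightarrow> g \<otimes> inv h \<in> T12"
    "(Inr h, Inl g) \<in> parcs \<Gamma> \<longleftrightarrow> g \<otimes> inv h \<in> T21"
    "(Inr h, Inr g) \<in> parcs \<Gamma> \<longleftrightarrow> g \<otimes> inv h \<in> T22"
    if "g \<in> carrier G" "h \<in> carrier G" for g h using that by (auto simp: semi_cayley_def)
  have sums: "(\<Sum>w\<in>pverts \<Gamma>. if (Inl h, w) \<in> parcs \<Gamma> then f w else (0::complex))
      = (\<Sum>t\<in>T11. f (Inl (t \<otimes> h))) + (\<Sum>t\<in>T12. f (Inr (t \<otimes> h)))"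
    "(\<Sum>w\<in>pverts \<Gamma>. if (Inr h, w) \<in> parcs \<Gamma> then f w else (0::complex))
      = (\<Sum>t\<in>T21. f (Inl (t \<otimes> h))) + (\<Sum>t\<in>T22. f (Inr (t \<otimes> h)))"
    if h: "h \<in> carrier G" for h f
    unfolding V using fin h
    by (simp_all add: sum.Plus arcs neighbour_sum sub cong: sum.cong)
  have fin_V: "finite (pverts \<Gamma>)" using fin by (simp add: V)
  show ?thesis unfolding adjacency_spectrum_iff[OF fin_V]
  proof
    assume "\<exists>f. (\<exists>v\<in>pverts \<Gamma>. f v \<noteq> 0) \<and>
      (\<forall>v\<in>pverts \<Gamma>. (\<Sum>w\<in>pverts \<Gamma>. if (v, w) \<in> parcs \<Gamma> then f w else 0) = c * f v)"
    then obtain f v0 where f: "v0 \<in> pverts \<Gamma>" "f v0 \<noteq> 0"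
      "\<And>v. v \<in> pverts \<Gamma> \<Longrightarrow> (\<Sum>w\<in>pverts \<Gamma>. if (v, w) \<in> parcs \<Gamma> then f w else 0) = c * f v" by blast
    define u where "u i g = f (if i then Inl g else Inr g)" for i g
    have "eigenfunction c u" unfolding eigenfunction_def
    proof (rule ballI)
      fix h assume h: "h \<in> carrier G"
      have "Inl h \<in> pverts \<Gamma>" "Inr h \<in> pverts \<Gamma>" using h by (auto simp: V)
      from this[THEN f(3)]
      show "(\<Sum>t\<in>T11. u True (t \<otimes> h)) + (\<Sum>t\<in>T12. u False (t \<otimes> h)) = c * u True h \<and>
        (\<Sum>t\<in>T21. u True (t \<otimes> h)) + (\<Sum>t\<in>T22. u False (t \<otimes> h)) = c * u False h"
        unfolding sums[OF h] by (simp add: u_def)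
    qed
    moreover have "\<exists>i. \<exists>g\<in>carrier G. u i g \<noteq> 0"
      using f(1,2) unfolding V by (auto simp: u_def intro: exI[of _ True] exI[of _ False])
    ultimately show "\<exists>u. eigenfunction c u \<and> (\<exists>i. \<exists>g\<in>carrier G. u i g \<noteq> 0)" by blast
  next
    assume "\<exists>u. eigenfunction c u \<and> (\<exists>i. \<exists>g\<in>carrier G. u i g \<noteq> 0)"
    then obtain u i0 g0 where u: "eigenfunction c u" "g0 \<in> carrier G" "u i0 g0 \<noteq> 0" by blast
    define f where "f = case_sum (u True) (u False)"
    have "\<exists>v\<in>pverts \<Gamma>. f v \<noteq> 0"
      using u(2,3) unfolding V
      by (intro bexI[of _ "if i0 then Inl g0 else Inr g0"]) (auto simp: f_def)
    moreover have "(\<Sum>w\<in>pverts \<Gamma>. if (v, w) \<in> parcs \<Gamma> then f w else 0) = c * f v" if "v \<in> pverts \<Gamma>" for v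
      using that[unfolded V] u(1) sums unfolding eigenfunction_def by (auto simp: f_def)
    ultimately show "\<exists>f. (\<exists>v\<in>pverts \<Gamma>. f v \<noteq> 0) \<and>
      (\<forall>v\<in>pverts \<Gamma>. (\<Sum>w\<in>pverts \<Gamma>. if (v, w) \<in> parcs \<Gamma> then f w else 0) = c * f v)" by blast
  qed
qed

definition I1 where "I1 = mset_set T11 + mset_set T22"
definition I2 where "I2 = mset_prod G (mset_set T11) (mset_set T11) + mset_prod G (mset_set T22) (mset_set T22)
  + repeat_mset 4 (mset_prod G (mset_set T12) (mset_set T21))"
definition I3 where "I3 = repeat_mset 2 (mset_prod G (mset_set T11) (mset_set T22))"
definition \<delta> where "\<delta> \<chi> = char_sum \<chi> (I2 - I3) - char_sum \<chi> (I3 - I2)"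
definition \<Delta> where "\<Delta> \<chi> = \<chi> \<one> * \<delta> \<chi>"

definition eigenvalues :: "('a \<Rightarrow> complex) \<Rightarrow> complex set" where
  "eigenvalues \<chi> = {(char_sum \<chi> I1 + csqrt (\<Delta> \<chi>)) / (2 * \<chi> \<one>), (char_sum \<chi> I1 - csqrt (\<Delta> \<chi>)) / (2 * \<chi> \<one>)}"

end

locale semi_cayley_irreducible = quasi_abelian_semi_cayley G T11 T22 T12 T21 + irreducible_rep G n \<rho>
  for G (structure) and T11 T22 T12 T21 n \<rho>
begin

lemma char_I1: "char_sum char I1 = of_nat n * (char_avg T11 + char_avg T22)"
  using n_pos by (simp add: I1_def char_sum_add char_sum_mset_set char_avg_def add_divide_distrib[symmetric])

lemma \<delta>_char: "\<delta> char = of_nat n * ((char_avg T11 - char_avg T22) ^ 2 + 4 * char_avg T12 * char_avg T21)"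
proof -
  have prod: "char_sum char (mset_prod G (mset_set S) (mset_set S')) = of_nat n * char_avg S * char_avg S'"
    if "union_of_conj_classes G S" "S \<subseteq> carrier G" "union_of_conj_classes G S'" "S' \<subseteq> carrier G" for S S'
    unfolding char_sum_mset_prod sum_unfold_sum_mset[symmetric] by (rule char_product_sum[OF that])
  have "\<delta> char = char_sum char I2 - char_sum char I3" unfolding \<delta>_def by (rule char_sum_diff)
  then show ?thesis
    by (simp add: I2_def I3_def char_sum_add char_sum_repeat prod classes sub power2_eq_square algebra_simps)
qed

lemma \<Delta>_char: "\<Delta> char = (of_nat n) ^ 2 * ((char_avg T11 - char_avg T22) ^ 2 + 4 * char_avg T12 * char_avg T21)"
  by (simp add: \<Delta>_def \<delta>_char char_one power2_eq_square)

lemma eigenvalue_formula_iff: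
  "(\<exists>u v. (u \<noteq> 0 \<or> v \<noteq> 0) \<and> char_avg T11 * u + char_avg T12 * v = c * u \<and>
      char_avg T21 * u + char_avg T22 * v = c * v) \<longleftrightarrow> c \<in> eigenvalues char"
proof -
  have n0: "(of_nat n :: complex) \<noteq> 0" using n_pos by simp
  have "(2 * c - (char_avg T11 + char_avg T22)) ^ 2 = (char_avg T11 - char_avg T22) ^ 2 + 4 * char_avg T12 * char_avg T21
    \<longleftrightarrow> of_nat n ^ 2 * (2 * c - (char_avg T11 + char_avg T22)) ^ 2 = \<Delta> char"
    using n0 unfolding \<Delta>_char by simp
  also have "\<dots> \<longleftrightarrow> (2 * of_nat n * c - char_sum char I1) ^ 2 = csqrt (\<Delta> char) ^ 2"
    unfolding char_I1 power_mult_distrib[symmetric] by (simp add: algebra_simps)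
  also have "\<dots> \<longleftrightarrow> 2 * of_nat n * c - char_sum char I1 = csqrt (\<Delta> char) \<or>
      2 * of_nat n * c - char_sum char I1 = - csqrt (\<Delta> char)" by (rule power2_eq_iff)
  also have "\<dots> \<longleftrightarrow> c \<in> eigenvalues char"
    using n0 unfolding eigenvalues_def char_one by (auto simp: field_simps)
  finally show ?thesis unfolding two_by_two_eigenvalue_iff .
qed

text \<open>An eigenvector \<open>(u, v)\<close> of the 2 by 2 matrix, multiplied by a fixed matrix entry of the representation,
  is an eigenfunction.\<close>

lemma eigenvalue_in_spectrum:
  assumes uv: "u \<noteq> 0 \<or> v \<noteq> 0" "char_avg T11 * u + char_avg T12 * v = c * u"
    "char_avg T21 * u + char_avg T22 * v = c * v"
  shows "c \<in> spectrum (adjacency_matrix \<Gamma>)"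
proof -
  define w where "w i g = (if i then u else v) * \<rho> g $$ (0, 0)" for i g
  have s: "(\<Sum>t\<in>S. w i (t \<otimes> h)) = char_avg S * (if i then u else v) * \<rho> h $$ (0, 0)"
    if "union_of_conj_classes G S" "S \<subseteq> carrier G" "h \<in> carrier G" for S i h
    unfolding w_def sum_distrib_left[symmetric] rep_sum_mult[OF that n_pos n_pos] by simp
  have "eigenfunction c w"
    unfolding eigenfunction_def using uv(2,3)
    by (auto simp: s classes sub distrib_right[symmetric] simp flip: mult.assoc) (auto simp: w_def)
  moreover have "w True \<one> \<noteq> 0 \<or> w False \<one> \<noteq> 0" using uv(1) n_pos by (simp add: w_def rep_one)
  ultimately show ?thesis unfolding spectrum_eigenfunction_iff by blast
qed

end

text \<open>For the inclusion from left to right, an irreducible constituent of the eigenspace is evaluated at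
  the identity: there the eigenvalue equation becomes that of the 2 by 2 matrix.\<close>

theorem (in quasi_abelian_semi_cayley) spectrum_semi_cayley:
  "c \<in> spectrum (adjacency_matrix \<Gamma>) \<longleftrightarrow> (\<exists>\<chi>\<in>irr_chars G. c \<in> eigenvalues \<chi>)"
proof
  assume "\<exists>\<chi>\<in>irr_chars G. c \<in> eigenvalues \<chi>"
  then obtain \<chi> where \<chi>: "\<chi> \<in> irr_chars G" "c \<in> eigenvalues \<chi>" by blast
  obtain n \<rho> where r: "irreducible_rep G n \<rho>" "\<chi> = irreducible_rep.char G \<rho>"
    using irr_charsE[OF \<chi>(1) finite_group_axioms] by metis
  interpret irreducible_rep G n \<rho> by (rule r)
  interpret semi_cayley_irreducible G T11 T22 T12 T21 n \<rho> ..
  show "c \<in> spectrum (adjacency_matrix \<Gamma>)"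
    using \<chi>(2) eigenvalue_in_spectrum unfolding r(2) eigenvalue_formula_iff[symmetric] by blast
next
  assume "c \<in> spectrum (adjacency_matrix \<Gamma>)"
  then obtain u i0 g0 where u: "eigenfunction c u" "g0 \<in> carrier G" "u i0 g0 \<noteq> 0"
    unfolding spectrum_eigenfunction_iff by blast
  interpret E: invariant_space G "eigenfunction c"
  proof
    fix u v a b assume "eigenfunction c u" "eigenfunction c v"
    then show "eigenfunction c (\<lambda>i g. a * u i g + b * v i g)"
    proof -
      have eq: "a * x1 + b * y1 + (a * x2 + b * y2) = c * (a * x + b * y)"
        if "x1 + x2 = c * x" "y1 + y2 = c * y" for x1 x2 y1 y2 x y
      proof -
        have "a * x1 + b * y1 + (a * x2 + b * y2) = a * (x1 + x2) + b * (y1 + y2)"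
          by (simp add: algebra_simps)
        then show ?thesis unfolding that by (simp add: algebra_simps)
      qed
      show ?thesis
        using \<open>eigenfunction c u\<close> \<open>eigenfunction c v\<close>
        unfolding eigenfunction_def sum.distrib sum_distrib_left[symmetric] by (blast intro: eq)
    qed
  next
    fix u x assume "eigenfunction c u" and x: "x \<in> carrier G"
    then have "\<And>h. h \<in> carrier G \<Longrightarrow>
     (\<Sum>t\<in>T11. u True (t \<otimes> (h \<otimes> x))) + (\<Sum>t\<in>T12. u False (t \<otimes> (h \<otimes> x))) = c * u True (h \<otimes> x) \<and>
     (\<Sum>t\<in>T21. u True (t \<otimes> (h \<otimes> x))) + (\<Sum>t\<in>T22. u False (t \<otimes> (h \<otimes> x))) = c * u False (h \<otimes> x)"
      by (simp add: eigenfunction_def)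
    moreover have "(\<Sum>t\<in>S. u i (t \<otimes> h \<otimes> x)) = (\<Sum>t\<in>S. u i (t \<otimes> (h \<otimes> x)))"
      if "S \<subseteq> carrier G" "h \<in> carrier G" for S i h
      using that x by (intro sum.cong) (auto simp: m_assoc)
    ultimately show "eigenfunction c (\<lambda>i g. u i (g \<otimes> x))" by (simp add: eigenfunction_def sub)
  qed
  obtain n \<rho> w where r: "irreducible_representation G n \<rho>" and wE: "\<And>j. j < n \<Longrightarrow> eigenfunction c (w j)"
    and w: "\<And>x j i. x \<in> carrier G \<Longrightarrow> j < n \<Longrightarrow> w j i x = (\<Sum>k<n. \<rho> x $$ (k, j) * w k i \<one>)"
    and nz: "\<exists>j<n. \<exists>i. w j i \<one> \<noteq> 0"
    using E.irreducible_constituent[OF u] by blast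
  interpret r: irreducible_rep G n \<rho> by standard (rule r)
  interpret semi_cayley_irreducible G T11 T22 T12 T21 n \<rho> ..
  obtain j i where j: "j < n" "w j i \<one> \<noteq> 0" using nz by auto
  have s: "(\<Sum>t\<in>S. w j i (t \<otimes> \<one>)) = r.char_avg S * w j i \<one>"
    if S: "union_of_conj_classes G S" "S \<subseteq> carrier G" for S i
  proof -
    have "(\<Sum>t\<in>S. w j i (t \<otimes> \<one>)) = (\<Sum>t\<in>S. \<Sum>k<n. \<rho> t $$ (k, j) * w k i \<one>)"
    proof (intro sum.cong refl)
      fix t assume "t \<in> S"
      then have t: "t \<in> carrier G" using S(2) by auto
      then show "w j i (t \<otimes> \<one>) = (\<Sum>k<n. \<rho> t $$ (k, j) * w k i \<one>)"
        using w[OF t j(1), of i] by (simp only: r_one)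
    qed
    also have "\<dots> = (\<Sum>k<n. (\<Sum>t\<in>S. \<rho> t $$ (k, j)) * w k i \<one>)"
      unfolding sum_distrib_right by (rule sum.swap)
    also have "\<dots> = (\<Sum>k<n. if k = j then r.char_avg S * w j i \<one> else 0)"
      using j(1) by (intro sum.cong) (auto simp: r.rep_sum_scalar[OF S])
    also have "\<dots> = r.char_avg S * w j i \<one>" using j(1) by simp
    finally show ?thesis .
  qed
  have "r.char_avg T11 * w j True \<one> + r.char_avg T12 * w j False \<one> = c * w j True \<one> \<and>
    r.char_avg T21 * w j True \<one> + r.char_avg T22 * w j False \<one> = c * w j False \<one>"
    using bspec[OF wE[OF j(1), unfolded eigenfunction_def] one_closed]
    unfolding s[OF classes(1) sub(1)] s[OF classes(2) sub(2)] s[OF classes(3) sub(3)] s[OF classes(4) sub(4)] .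
  moreover have "w j True \<one> \<noteq> 0 \<or> w j False \<one> \<noteq> 0" using j(2) by (cases i) auto
  ultimately have "c \<in> eigenvalues r.char"
    unfolding eigenvalue_formula_iff[symmetric] by blast
  then show "\<exists>\<chi>\<in>irr_chars G. c \<in> eigenvalues \<chi>" using r.char_irr by blast
qed

section \<open>Conjugation-invariant multisets and power maps\<close>

context finite_group
begin

text \<open>Invariance is stated through images and not through multiplicities, because products and powers
  commute with images.\<close>

definition class_mset :: "'a multiset \<Rightarrow> bool" where
  "class_mset A \<longleftrightarrow> set_mset A \<subseteq> carrier G \<and> (\<forall>g\<in>carrier G. image_mset (\<lambda>x. g \<otimes> x \<otimes> inv g) A = A)"

lemma class_mset_count:
  assumes A: "class_mset A" and g: "g \<in> carrier G" and x: "x \<in> carrier G"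
  shows "count A (g \<otimes> x \<otimes> inv g) = count A x"
proof -
  have inj: "y = x" if "y \<in># A" "g \<otimes> y \<otimes> inv g = g \<otimes> x \<otimes> inv g" for y
    using conj_inverse(1)[OF g, of y] conj_inverse(1)[OF g x] that A by (auto simp: class_mset_def)
  have "(\<lambda>x. g \<otimes> x \<otimes> inv g) -` {g \<otimes> x \<otimes> inv g} \<inter> set_mset A = {x} \<inter> set_mset A"
    using inj by blast
  then have "count (image_mset (\<lambda>x. g \<otimes> x \<otimes> inv g) A) (g \<otimes> x \<otimes> inv g) = sum (count A) ({x} \<inter> set_mset A)"
    by (simp only: count_image_mset)
  also have "\<dots> = count A x" by (cases "x \<in># A") (simp_all add: not_in_iff)
  finally show ?thesis using A g by (simp add: class_mset_def)
qed

lemma class_mset_add: "class_mset A \<Longrightarrow> class_mset B \<Longrightarrow> class_mset (A + B)"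
  by (simp add: class_mset_def)

lemma class_mset_repeat: "class_mset A \<Longrightarrow> class_mset (repeat_mset k A)"
proof (induct k)
  case (Suc k)
  then show ?case using class_mset_add by simp
qed (simp add: class_mset_def)

lemma class_mset_set:
  assumes S: "union_of_conj_classes G S" "S \<subseteq> carrier G"
  shows "class_mset (mset_set S)"
  unfolding class_mset_def
proof (intro conjI ballI)
  have "finite S" using S(2) fin by (rule finite_subset)
  then show "set_mset (mset_set S) \<subseteq> carrier G" using S(2) by simp
  fix g assume g: "g \<in> carrier G"
  have "inj_on (\<lambda>x. g \<otimes> x \<otimes> inv g) S" using conj_inverse(1)[OF g] S(2) by (intro inj_onI) (metis subsetD)
  moreover have "(\<lambda>x. g \<otimes> x \<otimes> inv g) ` S = S"
  proof (intro subset_antisym subsetI)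
    fix y assume "y \<in> S"
    moreover then have "y \<in> carrier G" using S(2) by auto
    ultimately show "y \<in> (\<lambda>x. g \<otimes> x \<otimes> inv g) ` S"
      using union_of_conj_classes_iff[OF S(1) g, of "inv g \<otimes> y \<otimes> g"] conj_inverse(2)[OF g] g
      by (intro image_eqI[of _ _ "inv g \<otimes> y \<otimes> g"]) auto
  qed (use union_of_conj_classes_iff[OF S(1) g] S(2) in auto)
  ultimately show "image_mset (\<lambda>x. g \<otimes> x \<otimes> inv g) (mset_set S) = mset_set S" by (simp add: image_mset_mset_set)
qed

lemma class_mset_prod:
  assumes A: "class_mset A" and B: "class_mset B"
  shows "class_mset (mset_prod G A B)"
proof -
  have sub: "set_mset A \<subseteq> carrier G" "set_mset B \<subseteq> carrier G" using A B by (auto simp: class_mset_def)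
  have fixed: "image_mset (\<lambda>x. g \<otimes> x \<otimes> inv g) A = A" "image_mset (\<lambda>x. g \<otimes> x \<otimes> inv g) B = B"
    if "g \<in> carrier G" for g using A B that by (auto simp: class_mset_def)
  show ?thesis unfolding class_mset_def
  proof (intro conjI ballI)
    show "set_mset (mset_prod G A B) \<subseteq> carrier G" using sub by (auto simp: mset_prod_def)
    fix g assume g: "g \<in> carrier G"
    have conj: "g \<otimes> (x \<otimes> y) \<otimes> inv g = (g \<otimes> x \<otimes> inv g) \<otimes> (g \<otimes> y \<otimes> inv g)"
      if "x \<in> carrier G" "y \<in> carrier G" for x y
    proof -
      have "(g \<otimes> x \<otimes> inv g) \<otimes> (g \<otimes> y \<otimes> inv g) = g \<otimes> x \<otimes> (inv g \<otimes> g) \<otimes> y \<otimes> inv g"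
        using g that by (simp only: m_assoc inv_closed m_closed)
      then show ?thesis using g that by (simp add: m_assoc)
    qed
    have "image_mset (\<lambda>x. g \<otimes> x \<otimes> inv g) (mset_prod G A B)
        = (\<Sum>x\<in>#A. image_mset (\<lambda>y. g \<otimes> (x \<otimes> y) \<otimes> inv g) B)"
      unfolding mset_prod_def by (induct A) (auto simp: multiset.map_comp comp_def)
    also have "\<dots> = (\<Sum>x\<in>#A. image_mset (\<lambda>y. (g \<otimes> x \<otimes> inv g) \<otimes> y) (image_mset (\<lambda>x. g \<otimes> x \<otimes> inv g) B))"
    proof (intro arg_cong[of _ _ sum_mset] image_mset_cong)
      fix x assume x: "x \<in># A"
      show "image_mset (\<lambda>y. g \<otimes> (x \<otimes> y) \<otimes> inv g) B
          = image_mset (\<lambda>y. (g \<otimes> x \<otimes> inv g) \<otimes> y) (image_mset (\<lambda>x. g \<otimes> x \<otimes> inv g) B)"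
        unfolding multiset.map_comp comp_def using x sub conj by (intro image_mset_cong) auto
    qed
    also have "\<dots> = (\<Sum>x\<in>#image_mset (\<lambda>x. g \<otimes> x \<otimes> inv g) A. image_mset (\<lambda>y. x \<otimes> y) B)"
      unfolding fixed(2)[OF g] by (simp add: multiset.map_comp comp_def)
    also have "\<dots> = mset_prod G A B" unfolding fixed(1)[OF g] mset_prod_def ..
    finally show "image_mset (\<lambda>x. g \<otimes> x \<otimes> inv g) (mset_prod G A B) = mset_prod G A B" .
  qed
qed

lemma conj_pow: "g \<in> carrier G \<Longrightarrow> x \<in> carrier G \<Longrightarrow> (g \<otimes> x \<otimes> inv g) [^] (k::nat) = g \<otimes> x [^] k \<otimes> inv g"
proof (induct k)
  case (Suc k)
  have "(g \<otimes> x [^] k \<otimes> inv g) \<otimes> (g \<otimes> x \<otimes> inv g) = g \<otimes> x [^] k \<otimes> (inv g \<otimes> g) \<otimes> x \<otimes> inv g"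
    using Suc.prems by (simp only: m_assoc inv_closed m_closed nat_pow_closed)
  then show ?case using Suc by (simp add: m_assoc)
qed simp

lemma class_mset_pow:
  assumes A: "class_mset A"
  shows "class_mset (mset_pow G A k)"
proof -
  have sub: "set_mset A \<subseteq> carrier G" using A by (auto simp: class_mset_def)
  show ?thesis unfolding class_mset_def
  proof (intro conjI ballI)
    show "set_mset (mset_pow G A k) \<subseteq> carrier G" using sub by (auto simp: mset_pow_def)
    fix g assume g: "g \<in> carrier G"
    have "image_mset (\<lambda>x. g \<otimes> x \<otimes> inv g) (mset_pow G A k) = image_mset (\<lambda>x. (g \<otimes> x \<otimes> inv g) [^] k) A"
      unfolding mset_pow_def multiset.map_comp comp_def
      using sub g conj_pow by (intro image_mset_cong) auto
    also have "\<dots> = mset_pow G (image_mset (\<lambda>x. g \<otimes> x \<otimes> inv g) A) k"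
      by (simp add: mset_pow_def multiset.map_comp comp_def)
    finally show "image_mset (\<lambda>x. g \<otimes> x \<otimes> inv g) (mset_pow G A k) = mset_pow G A k"
      using A g by (simp add: class_mset_def)
  qed
qed

lemma char_sum_count:
  assumes "set_mset A \<subseteq> carrier G"
  shows "char_sum \<chi> A = (\<Sum>t\<in>carrier G. of_nat (count A t) * \<chi> t)"
  using assms
proof (induct A)
  case (add a A)
  have "(\<Sum>t\<in>carrier G. of_nat (count (add_mset a A) t) * \<chi> t)
      = (\<Sum>t\<in>carrier G. (if t = a then \<chi> t else 0) + of_nat (count A t) * \<chi> t)"
    by (intro sum.cong) (auto simp: algebra_simps)
  also have "\<dots> = \<chi> a + (\<Sum>t\<in>carrier G. of_nat (count A t) * \<chi> t)"
    using add.prems fin by (simp add: sum.distrib)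
  finally show ?case using add by (simp add: char_sum_def)
qed (simp add: char_sum_def)

lemma class_mset_determined_by_characters:
  assumes A: "class_mset A" and B: "class_mset B"
    and eq: "\<And>\<chi>. \<chi> \<in> irr_chars G \<Longrightarrow> char_sum \<chi> A = char_sum \<chi> B"
  shows "A = B"
proof (rule multiset_eqI)
  fix t
  have sub: "set_mset A \<subseteq> carrier G" "set_mset B \<subseteq> carrier G" using A B by (auto simp: class_mset_def)
  define f :: "'a \<Rightarrow> complex" where "f t = of_nat (count A t) - of_nat (count B t)" for t
  show "count A t = count B t"
  proof (cases "t \<in> carrier G")
    case True
    have "f t = 0"
    proof (rule class_function_determined_by_characters[OF _ _ _ True])
      show "class_function G f" using A B by (simp add: class_function_def f_def class_mset_count)
      show "f t \<in> \<real>" for t by (simp add: f_def)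
      fix \<chi> assume "\<chi> \<in> irr_chars G"
      then show "(\<Sum>t\<in>carrier G. f t * \<chi> t) = 0"
        using eq[of \<chi>] by (simp add: char_sum_count sub f_def left_diff_distrib sum_subtractf)
    qed
    then show ?thesis by (simp add: f_def)
  next
    case False
    then have "t \<notin># A" "t \<notin># B" using sub by auto
    then show ?thesis by (simp add: not_in_iff)
  qed
qed

end

text \<open>Since \<open>A\<close> and \<open>B\<close> are disjoint, \<open>A\<close> is contained in \<open>A'\<close>, and the sizes agree.\<close>

lemma disjoint_mset_eq_of_cross_sum:
  fixes A B A' B' :: "'a multiset"
  assumes e: "A' + B = A + B'" and disj: "A \<inter># B = {#}" and size: "size A' = size A"
  shows "A' = A \<and> B' = B"
proof -
  have "A \<subseteq># A'"
  proof (rule mset_subset_eqI)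
    fix z
    have "min (count A z) (count B z) = 0" using disj by (metis count_empty count_inter_mset)
    moreover have "count A' z + count B z = count A z + count B' z" using e by (metis count_union)
    ultimately show "count A z \<le> count A' z" by linarith
  qed
  then obtain C where C: "A' = A + C" by (metis mset_subset_eq_exists_conv)
  then have "C = {#}" using size by simp
  then show ?thesis using e C by simp
qed

section \<open>The Galois action on character sums\<close>

locale semi_cayley_cyclotomic = quasi_abelian_semi_cayley G T11 T22 T12 T21
  for G (structure) and T11 T22 T12 T21 +
  fixes m :: nat and \<omega> :: complex
  assumes m: "m = group_exponent G" and prim: "primitive_root_of_unity m \<omega>"
begin

lemma pow_exponent: "x \<in> carrier G \<Longrightarrow> x [^] m = \<one>"
  by (subst pow_eq_id) (auto simp: m group_exponent_def)

text \<open>With eigenvalues \<open>\<omega>\<^sup>e\<close> of the representing matrix, \<open>P\<close> is the sum of the monomials \<open>x\<^sup>e\<close>. One polynomial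
  for all powers of \<open>x\<close> makes the Galois action visible: applying \<open>\<sigma>\<close> to \<open>P(\<omega>)\<close> gives \<open>P(\<sigma> \<omega>)\<close>.\<close>

lemma char_value_poly:
  assumes \<chi>: "\<chi> \<in> irr_chars G" and x: "x \<in> carrier G"
  shows "\<exists>P\<in>polys_over \<rat>. \<forall>k::nat. \<chi> (x [^] k) = poly P (\<omega> ^ k)"
proof -
  obtain n \<rho> where r: "irreducible_rep G n \<rho>" "\<chi> = irreducible_rep.char G \<rho>"
    using irr_charsE[OF \<chi> finite_group_axioms] by metis
  interpret irreducible_rep G n \<rho> by (rule r)
  interpret Q: complex_subfield \<rat> by (rule Rats_subfield)
  obtain es :: "nat \<Rightarrow> complex" where es: "\<And>i. i < n \<Longrightarrow> es i ^ m = 1"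
    "\<And>k. char (x [^] k) = (\<Sum>i<n. es i ^ k)" using char_powers[OF x pow_exponent[OF x]] by blast
  have "\<forall>i\<in>{..<n}. \<exists>e. es i = \<omega> ^ e"
    using es(1) roots_of_unity_eq_powers[OF prim] by auto
  then obtain e where e: "\<forall>i\<in>{..<n}. es i = \<omega> ^ e i" by (subst (asm) bchoice_iff) blast
  define P where "P = (\<Sum>i<n. monom (1::complex) (e i))"
  have "P \<in> polys_over \<rat>" unfolding P_def polys_over_def
    by (auto simp: coeff_sum intro!: Q.sum_mem)
  moreover have "\<chi> (x [^] k) = poly P (\<omega> ^ k)" for k :: nat
    unfolding r(2) es(2) P_def poly_sum
    using e by (intro sum.cong) (auto simp: poly_monom power_mult[symmetric] mult.commute)
  ultimately show ?thesis by blast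
qed

lemma char_sum_poly:
  assumes \<chi>: "\<chi> \<in> irr_chars G" and A: "set_mset A \<subseteq> carrier G"
  shows "\<exists>P\<in>polys_over \<rat>. \<forall>k::nat. char_sum \<chi> (mset_pow G A k) = poly P (\<omega> ^ k)"
  using A
proof (induct A)
  case empty
  interpret Q: complex_subfield \<rat> by (rule Rats_subfield)
  show ?case by (intro bexI[of _ 0]) (auto simp: mset_pow_def char_sum_def)
next
  case (add a A)
  interpret Q: complex_subfield \<rat> by (rule Rats_subfield)
  obtain P where P: "P \<in> polys_over \<rat>" "\<And>k::nat. char_sum \<chi> (mset_pow G A k) = poly P (\<omega> ^ k)"
    using add by auto
  obtain R where R: "R \<in> polys_over \<rat>" "\<And>k::nat. \<chi> (a [^] k) = poly R (\<omega> ^ k)"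
    using char_value_poly[OF \<chi>, of a] add.prems by auto
  have "char_sum \<chi> (mset_pow G (add_mset a A) k) = poly (R + P) (\<omega> ^ k)" for k :: nat
    using P(2)[of k] R(2)[of k] by (simp add: mset_pow_def char_sum_def)
  then show ?case using Q.polys_over_add[OF R(1) P(1)] by blast
qed

lemma mset_pow_1: "set_mset A \<subseteq> carrier G \<Longrightarrow> mset_pow G A 1 = A"
  by (simp add: mset_pow_def subset_iff cong: image_mset_cong)

abbreviation cyc_field :: "complex set" where
  "cyc_field \<equiv> adjoin \<rat> {\<omega>}"

lemma char_sum_cyclotomic:
  assumes \<chi>: "\<chi> \<in> irr_chars G" and A: "set_mset A \<subseteq> carrier G"
  shows "char_sum \<chi> A \<in> cyc_field"
    and "\<sigma> \<in> galois_group cyc_field \<rat> \<Longrightarrow> \<sigma> \<omega> = \<omega> ^ t \<Longrightarrow>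
      \<sigma> (char_sum \<chi> A) = char_sum \<chi> (mset_pow G A t)"
proof -
  interpret L: complex_subfield cyc_field by (rule adjoin_subfield)
  obtain P where P: "P \<in> polys_over \<rat>" "\<And>k::nat. char_sum \<chi> (mset_pow G A k) = poly P (\<omega> ^ k)"
    using char_sum_poly[OF assms] by blast
  have e: "char_sum \<chi> A = poly P \<omega>" using P(2)[of 1] mset_pow_1[OF A] by simp
  have w: "\<omega> \<in> cyc_field" using gens_subset_adjoin[of "{\<omega>}" \<rat>] by auto
  show "char_sum \<chi> A \<in> cyc_field" unfolding e
    using polys_over_mono[OF L.Rats_subset] P(1) w by (auto intro: L.poly_mem)
  assume "\<sigma> \<in> galois_group cyc_field \<rat>" "\<sigma> \<omega> = \<omega> ^ t"
  then show "\<sigma> (char_sum \<chi> A) = char_sum \<chi> (mset_pow G A t)"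
    unfolding e P(2) using galois_poly[OF adjoin_subfield L.Rats_subset _ w P(1)] by metis
qed

lemma class_msets: "class_mset I1" "class_mset I2" "class_mset I3"
  unfolding I1_def I2_def I3_def
  by (intro class_mset_add class_mset_repeat class_mset_prod class_mset_set classes sub)+

lemma msets_in_carrier: "set_mset I1 \<subseteq> carrier G" "set_mset I2 \<subseteq> carrier G" "set_mset I3 \<subseteq> carrier G"
  using class_msets by (auto simp: class_mset_def)

lemma \<delta>_eq: "\<delta> \<chi> = char_sum \<chi> I2 - char_sum \<chi> I3"
  unfolding \<delta>_def by (rule char_sum_diff)

definition T where
  "T = {t \<in> totatives m. mset_pow G I1 t = I1 \<and>
    mset_pow G (I2 - I3) t = I2 - I3 \<and> mset_pow G (I3 - I2) t = I3 - I2}"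

definition gens where
  "gens = (\<lambda>\<chi>. char_sum \<chi> I1) ` irr_chars G \<union> \<delta> ` irr_chars G"

definition K where "K = adjoin \<rat> gens"

sublocale K: complex_subfield K unfolding K_def by (rule adjoin_subfield)

sublocale L: complex_subfield cyc_field by (rule adjoin_subfield)

lemma gens_cyclotomic: "gens \<subseteq> cyc_field"
  using char_sum_cyclotomic(1) msets_in_carrier by (auto simp: gens_def \<delta>_eq intro: L.diff_mem)

lemma K_subset_cyclotomic: "K \<subseteq> cyc_field"
  unfolding K_def by (rule adjoin_Rats_subset[OF adjoin_subfield gens_cyclotomic])

text \<open>As \<open>\<delta> \<chi> = \<chi>(I\<^sub>2) - \<chi>(I\<^sub>3)\<close>, fixing all \<open>\<delta> \<chi>\<close> means that \<open>I\<^sub>2\<^sup>t + I\<^sub>3\<close> and \<open>I\<^sub>2 + I\<^sub>3\<^sup>t\<close> have the same character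
  sums, so they are equal. Cancelling the common part \<open>Z\<close> of \<open>I\<^sub>2\<close> and \<open>I\<^sub>3\<close>, and its power, leaves the same
  equation for the disjoint multisets \<open>I\<^sub>2 - I\<^sub>3\<close> and \<open>I\<^sub>3 - I\<^sub>2\<close>.\<close>

lemma galois_fixes_gens_iff:
  assumes s: "\<sigma> \<in> galois_group cyc_field \<rat>" and t: "\<sigma> \<omega> = \<omega> ^ t" "t \<in> totatives m"
  shows "(\<forall>y\<in>gens. \<sigma> y = y) \<longleftrightarrow> t \<in> T"
proof -
  have I1: "\<sigma> (char_sum \<chi> I1) = char_sum \<chi> (mset_pow G I1 t)" if "\<chi> \<in> irr_chars G" for \<chi>
    by (rule char_sum_cyclotomic(2)[OF that msets_in_carrier(1) s t(1)])
  have d: "\<sigma> (\<delta> \<chi>) = char_sum \<chi> (mset_pow G I2 t) - char_sum \<chi> (mset_pow G I3 t)"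
    if \<chi>: "\<chi> \<in> irr_chars G" for \<chi>
  proof -
    note c = char_sum_cyclotomic[OF \<chi> msets_in_carrier(2)] char_sum_cyclotomic[OF \<chi> msets_in_carrier(3)]
    have "\<delta> \<chi> \<in> cyc_field" using c(1,3) by (auto simp: \<delta>_eq intro: L.diff_mem)
    then have "\<sigma> (\<delta> \<chi> + char_sum \<chi> I3) = \<sigma> (\<delta> \<chi>) + \<sigma> (char_sum \<chi> I3)"
      using s c(3) unfolding galois_group_iff by blast
    moreover have "\<delta> \<chi> + char_sum \<chi> I3 = char_sum \<chi> I2" by (simp add: \<delta>_eq)
    ultimately show ?thesis using c(2)[OF s t(1)] c(4)[OF s t(1)] by simp
  qed
  define Z where "Z = I2 \<inter># I3"
  have Z: "I2 = (I2 - I3) + Z" "I3 = (I3 - I2) + Z" by (auto simp: Z_def multiset_eq_iff)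
  have pow_add: "mset_pow G (A + B) t = mset_pow G A t + mset_pow G B t" for A B
    by (simp add: mset_pow_def)
  have pow_Z: "mset_pow G I2 t = mset_pow G (I2 - I3) t + mset_pow G Z t"
    "mset_pow G I3 t = mset_pow G (I3 - I2) t + mset_pow G Z t" using Z pow_add by metis+
  show ?thesis
  proof
    assume T: "t \<in> T"
    have "\<sigma> (\<delta> \<chi>) = \<delta> \<chi>" if "\<chi> \<in> irr_chars G" for \<chi>
      unfolding d[OF that] pow_Z using T by (simp add: T_def char_sum_add \<delta>_def)
    with T show "\<forall>y\<in>gens. \<sigma> y = y" by (auto simp: gens_def I1 T_def)
  next
    assume fixed: "\<forall>y\<in>gens. \<sigma> y = y"
    have "mset_pow G I1 t = I1"
      by (rule class_mset_determined_by_characters)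
        (use fixed I1 in \<open>auto simp: gens_def intro: class_mset_pow class_msets\<close>)
    moreover have "mset_pow G I2 t + I3 = I2 + mset_pow G I3 t"
    proof (rule class_mset_determined_by_characters)
      fix \<chi> assume \<chi>: "\<chi> \<in> irr_chars G"
      then have "\<sigma> (\<delta> \<chi>) = \<delta> \<chi>" using fixed by (auto simp: gens_def)
      then show "char_sum \<chi> (mset_pow G I2 t + I3) = char_sum \<chi> (I2 + mset_pow G I3 t)"
        unfolding d[OF \<chi>] by (simp add: \<delta>_eq char_sum_add algebra_simps)
    qed (intro class_mset_add class_mset_pow class_msets)+
    then have "(mset_pow G (I2 - I3) t + mset_pow G Z t) + ((I3 - I2) + Z)
        = ((I2 - I3) + Z) + (mset_pow G (I3 - I2) t + mset_pow G Z t)"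
      by (simp only: pow_Z[symmetric] Z[symmetric])
    then have "mset_pow G (I2 - I3) t + (I3 - I2) = (I2 - I3) + mset_pow G (I3 - I2) t"
      by (simp add: ac_simps)
    then have "mset_pow G (I2 - I3) t = I2 - I3 \<and> mset_pow G (I3 - I2) t = I3 - I2"
      by (rule disjoint_mset_eq_of_cross_sum) (auto simp: mset_pow_def multiset_eq_iff)
    ultimately show "t \<in> T" using t(2) by (simp add: T_def)
  qed
qed

lemma galois_group_mono: "F \<subseteq> F' \<Longrightarrow> galois_group M F' \<subseteq> galois_group M F"
  by (auto simp: galois_group_def)

lemma cyclotomic_char_galois:
  assumes "\<sigma> \<in> galois_group cyc_field \<rat>"
  shows "cyclotomic_char m \<omega> \<sigma> \<in> totatives m" "\<sigma> \<omega> = \<omega> ^ cyclotomic_char m \<omega> \<sigma>"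
proof -
  interpret Q: complex_subfield \<rat> by (rule Rats_subfield)
  obtain f where "root_of_unity_extension \<rat> m \<omega> f" using Q.root_of_unity_extension_exists[OF prim] by blast
  then interpret R: root_of_unity_extension \<rat> m \<omega> f .
  obtain t where "t \<in> R.conj_exps" "\<sigma> \<omega> = \<omega> ^ t" using R.galois_conj_exp[OF assms] by blast
  then have t: "t \<in> totatives m \<and> \<sigma> \<omega> = \<omega> ^ t" by (simp add: R.conj_exps_def)
  moreover have "t' = t" if "t' \<in> totatives m \<and> \<sigma> \<omega> = \<omega> ^ t'" for t'
    using R.inj_on_conj_exps t that by (auto dest: inj_onD)
  ultimately have "cyclotomic_char m \<omega> \<sigma> \<in> totatives m \<and> \<sigma> \<omega> = \<omega> ^ cyclotomic_char m \<omega> \<sigma>"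
    unfolding cyclotomic_char_def by (rule theI)
  then show "cyclotomic_char m \<omega> \<sigma> \<in> totatives m" "\<sigma> \<omega> = \<omega> ^ cyclotomic_char m \<omega> \<sigma>" by auto
qed

lemma galois_fixes_K:
  assumes "\<sigma> \<in> galois_group cyc_field \<rat>" "\<sigma> \<omega> = \<omega> ^ t" "t \<in> T" "x \<in> K"
  shows "\<sigma> x = x"
  using galois_fixes_adjoin[OF adjoin_subfield L.Rats_subset gens_cyclotomic assms(1), of x]
    galois_fixes_gens_iff[OF assms(1,2)] assms(3,4) by (auto simp: K_def T_def)

lemma adjoin_K_\<omega>: "adjoin K {\<omega>} = cyc_field"
  using K_subset_cyclotomic K.Rats_subset gens_subset_adjoin[of "{\<omega>}" \<rat>] gens_subset_adjoin[of "{\<omega>}" K]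
    base_subset_adjoin[of K "{\<omega>}"]
  by (intro antisym adjoin_least adjoin_subfield) auto

text \<open>An automorphism over \<open>\<rat>\<close> fixes \<open>K\<close> if and only if it fixes the generators. For \<open>t \<in> T\<close> an automorphism with
  \<open>\<omega> \<mapsto> \<omega>\<^sup>t\<close> is available because every exponent prime to \<open>m\<close> occurs over \<open>\<rat>\<close>.\<close>

lemma conj_exps_K:
  assumes "root_of_unity_extension K m \<omega> f"
  shows "root_of_unity_extension.conj_exps m \<omega> f = T"
proof -
  interpret R: root_of_unity_extension K m \<omega> f by fact
  interpret Q: complex_subfield \<rat> by (rule Rats_subfield)
  obtain f0 where f0: "root_of_unity_extension \<rat> m \<omega> f0" using Q.root_of_unity_extension_exists[OF prim] by blast
  then interpret R0: root_of_unity_extension \<rat> m \<omega> f0 .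
  show ?thesis
  proof (intro antisym subsetI)
    fix t assume t: "t \<in> R.conj_exps"
    then obtain \<sigma> where s: "\<sigma> \<in> galois_group cyc_field K" "\<sigma> \<omega> = \<omega> ^ t"
      using R.conj_exp_galois unfolding adjoin_K_\<omega> by metis
    have "\<sigma> \<in> galois_group cyc_field \<rat>" using s(1) galois_group_mono[OF K.Rats_subset] by blast
    moreover have "\<forall>y\<in>gens. \<sigma> y = y"
      using s(1) gens_subset_adjoin[of gens \<rat>] by (auto simp: galois_group_def K_def)
    ultimately show "t \<in> T" using galois_fixes_gens_iff s(2) t by (auto simp: R.conj_exps_def)
  next
    fix t assume t: "t \<in> T"
    then have tt: "t \<in> totatives m" by (simp add: T_def)
    then obtain \<sigma> where s: "\<sigma> \<in> galois_group cyc_field \<rat>" "\<sigma> \<omega> = \<omega> ^ t"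
      using R0.conj_exp_galois rational_conj_exps[OF f0] by blast
    have "\<sigma> \<in> galois_group cyc_field K"
      using s(1) galois_fixes_K[OF s t] by (auto simp: galois_group_def)
    then obtain t' where t': "t' \<in> R.conj_exps" "\<sigma> \<omega> = \<omega> ^ t'"
      using R.galois_conj_exp unfolding adjoin_K_\<omega> by blast
    then have "t = t'" using R.inj_on_conj_exps tt s(2) by (auto simp: R.conj_exps_def dest: inj_onD)
    then show "t \<in> R.conj_exps" using t' by simp
  qed
qed

theorem K_fixed_field:
  "K = {x \<in> cyc_field. \<forall>\<sigma>\<in>{\<sigma> \<in> galois_group cyc_field \<rat>. cyclotomic_char m \<omega> \<sigma> \<in> T}. \<sigma> x = x}"
  (is "_ = ?R")
proof (intro antisym subsetI)
  fix x assume "x \<in> K"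
  then show "x \<in> ?R"
    using K_subset_cyclotomic galois_fixes_K cyclotomic_char_galois(2) by blast
next
  fix x assume x: "x \<in> ?R"
  obtain f where f: "root_of_unity_extension K m \<omega> f" using K.root_of_unity_extension_exists[OF prim] by blast
  then interpret R: root_of_unity_extension K m \<omega> f .
  show "x \<in> K"
  proof (rule R.fixed_field)
    show "x \<in> adjoin K {\<omega>}" using x by (simp add: adjoin_K_\<omega>)
    fix \<sigma> assume "\<sigma> \<in> galois_group (adjoin K {\<omega>}) K"
    then have s: "\<sigma> \<in> galois_group cyc_field K" "\<sigma> \<in> galois_group cyc_field \<rat>"
      using galois_group_mono[OF K.Rats_subset] by (auto simp: adjoin_K_\<omega>)
    have "\<forall>y\<in>gens. \<sigma> y = y"
      using s(1) gens_subset_adjoin[of gens \<rat>] by (auto simp: galois_group_def K_def)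
    then have "cyclotomic_char m \<omega> \<sigma> \<in> T"
      using galois_fixes_gens_iff[OF s(2)] cyclotomic_char_galois[OF s(2)] by blast
    then show "\<sigma> x = x" using x s(2) by blast
  qed
qed

text \<open>The field \<open>K\<close> has finite degree as a subspace of \<open>\<rat>(\<omega>)\<close>; the tower law then compares \<open>\<phi>(m)\<close>, the degree of
  \<open>\<rat>(\<omega>)\<close> over \<open>\<rat>\<close>, with \<open>|T|\<close>, its degree over \<open>K\<close>.\<close>

lemma K_dimension:
  obtains k where "ext_dim k \<rat> K" "k * card T = totient m"
proof -
  interpret Q: complex_subfield \<rat> by (rule Rats_subfield)
  obtain f0 where f0: "root_of_unity_extension \<rat> m \<omega> f0" using Q.root_of_unity_extension_exists[OF prim] by blast
  then interpret R0: root_of_unity_extension \<rat> m \<omega> f0 .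
  obtain f where f: "root_of_unity_extension K m \<omega> f" using K.root_of_unity_extension_exists[OF prim] by blast
  then interpret R: root_of_unity_extension K m \<omega> f .
  have dQ: "ext_dim (totient m) \<rat> cyc_field"
    using R0.dimension_adjoin rational_conj_exps[OF f0] by (simp add: totient_def)
  have dK: "ext_dim (card T) K cyc_field"
    using R.dimension_adjoin conj_exps_K[OF f] by (simp add: adjoin_K_\<omega>)
  have sQ: "subfield \<rat> complex_field" and sK: "subfield K complex_field"
    using Rats_subfield K.complex_subfield_axioms by (auto simp: complex_subfield_iff)
  have "subalgebra \<rat> K complex_field"
    using subring.axioms(1)[OF subfieldE(1)[OF sK]] K.Rats_subset
    by (auto simp: subalgebra_def subalgebra_axioms_def intro: K.mult_mem)
  then have "ring.finite_dimension complex_field \<rat> K"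
    by (rule ring.subalbegra_incl_imp_finite_dimension[OF ring_complex sQ
          ring.finite_dimensionI[OF ring_complex dQ] _ K_subset_cyclotomic])
  then obtain k where k: "ext_dim k \<rat> K"
    by (auto simp: ring.finite_dimension_def[OF ring_complex])
  have "ext_dim (k * card T) \<rat> cyc_field"
    by (rule ring.telescopic_base[OF ring_complex sQ sK k dK])
  then have "k * card T = totient m"
    using ring.dimension_is_inj[OF ring_complex sQ] dQ by blast
  then show thesis using that k by blast
qed

section \<open>The splitting field and its degree\<close>

lemma char_degree:
  assumes "\<chi> \<in> irr_chars G"
  obtains n :: nat where "\<chi> \<one> = of_nat n" "n > 0"
proof -
  obtain n \<rho> where r: "irreducible_rep G n \<rho>" "\<chi> = irreducible_rep.char G \<rho>"
    using irr_charsE[OF assms finite_group_axioms] by metis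
  show thesis using that[of n] irreducible_rep.char_one[OF r(1)] irreducible_rep.n_pos[OF r(1)] r(2) by simp
qed

lemma \<Delta>_mem_K: "\<chi> \<in> irr_chars G \<Longrightarrow> \<Delta> \<chi> \<in> K"
proof -
  assume \<chi>: "\<chi> \<in> irr_chars G"
  obtain n :: nat where n: "\<chi> \<one> = of_nat n" using char_degree[OF \<chi>] by blast
  have "\<delta> \<chi> \<in> K" using \<chi> gens_subset_adjoin[of gens \<rat>] by (auto simp: K_def gens_def)
  then show "\<Delta> \<chi> \<in> K" by (simp add: \<Delta>_def n K.mult_mem)
qed

lemma splitting_field_eq:
  "splitting_field \<Gamma> = adjoin \<rat> ((\<lambda>\<chi>. char_sum \<chi> I1) ` irr_chars G \<union> (\<lambda>\<chi>. csqrt (\<Delta> \<chi>)) ` irr_chars G)"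
  (is "_ = adjoin \<rat> ?S")
proof (rule antisym)
  interpret N: complex_subfield "adjoin \<rat> ?S" by (rule adjoin_subfield)
  interpret SF: complex_subfield "splitting_field \<Gamma>" unfolding splitting_field_def by (rule adjoin_subfield)
  have S: "char_sum \<chi> I1 \<in> adjoin \<rat> ?S" "csqrt (\<Delta> \<chi>) \<in> adjoin \<rat> ?S" if "\<chi> \<in> irr_chars G" for \<chi>
    using that gens_subset_adjoin[of ?S \<rat>] by auto
  show "splitting_field \<Gamma> \<subseteq> adjoin \<rat> ?S" unfolding splitting_field_def
  proof (rule adjoin_Rats_subset[OF adjoin_subfield], rule subsetI)
    fix c assume "c \<in> spectrum (adjacency_matrix \<Gamma>)"
    then obtain \<chi> where \<chi>: "\<chi> \<in> irr_chars G" "c \<in> eigenvalues \<chi>" unfolding spectrum_semi_cayley by blast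
    obtain n :: nat where n: "\<chi> \<one> = of_nat n" using char_degree[OF \<chi>(1)] by blast
    show "c \<in> adjoin \<rat> ?S" using \<chi>(2) S[OF \<chi>(1)] unfolding eigenvalues_def n
      by (auto intro!: N.divide_mem N.mult_mem N.add_mem N.diff_mem)
  qed
  show "adjoin \<rat> ?S \<subseteq> splitting_field \<Gamma>"
  proof (rule adjoin_Rats_subset[OF SF.complex_subfield_axioms], rule subsetI)
    fix y assume "y \<in> ?S"
    then obtain \<chi> where \<chi>: "\<chi> \<in> irr_chars G" "y = char_sum \<chi> I1 \<or> y = csqrt (\<Delta> \<chi>)" by auto
    obtain n :: nat where n: "\<chi> \<one> = of_nat n" "n > 0" using char_degree[OF \<chi>(1)] by blast
    define c1 where "c1 = (char_sum \<chi> I1 + csqrt (\<Delta> \<chi>)) / (2 * \<chi> \<one>)"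
    define c2 where "c2 = (char_sum \<chi> I1 - csqrt (\<Delta> \<chi>)) / (2 * \<chi> \<one>)"
    have "c1 \<in> spectrum (adjacency_matrix \<Gamma>)" "c2 \<in> spectrum (adjacency_matrix \<Gamma>)"
      unfolding spectrum_semi_cayley eigenvalues_def c1_def c2_def using \<chi>(1) by blast+
    then have c: "c1 \<in> splitting_field \<Gamma>" "c2 \<in> splitting_field \<Gamma>"
      using gens_subset_adjoin by (auto simp: splitting_field_def)
    have "char_sum \<chi> I1 = of_nat n * (c1 + c2)" "csqrt (\<Delta> \<chi>) = of_nat n * (c1 - c2)"
      using n(2) unfolding c1_def c2_def n(1) by (simp_all add: field_simps)
    then show "y \<in> splitting_field \<Gamma>" using \<chi>(2) c
      by (auto intro!: SF.mult_mem SF.add_mem SF.diff_mem)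
  qed
qed

lemma splitting_field_eq_K:
  "splitting_field \<Gamma> = adjoin K ((\<lambda>\<chi>. csqrt (\<Delta> \<chi>)) ` irr_chars G)"
  unfolding splitting_field_eq
proof (rule antisym)
  let ?S = "(\<lambda>\<chi>. char_sum \<chi> I1) ` irr_chars G \<union> (\<lambda>\<chi>. csqrt (\<Delta> \<chi>)) ` irr_chars G"
  let ?N = "adjoin \<rat> ?S" and ?N' = "adjoin K ((\<lambda>\<chi>. csqrt (\<Delta> \<chi>)) ` irr_chars G)"
  interpret N: complex_subfield ?N by (rule adjoin_subfield)
  have "char_sum \<chi> I1 \<in> ?N'" if "\<chi> \<in> irr_chars G" for \<chi>
    using that gens_subset_adjoin[of gens \<rat>] base_subset_adjoin[of K] by (auto simp: K_def gens_def)
  then show "?N \<subseteq> ?N'"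
    using gens_subset_adjoin[of "(\<lambda>\<chi>. csqrt (\<Delta> \<chi>)) ` irr_chars G" K]
    by (intro adjoin_Rats_subset adjoin_subfield) auto
  have "\<delta> \<chi> \<in> ?N" if \<chi>: "\<chi> \<in> irr_chars G" for \<chi>
  proof -
    obtain n :: nat where n: "\<chi> \<one> = of_nat n" "n > 0" using char_degree[OF \<chi>] by blast
    have "\<delta> \<chi> = csqrt (\<Delta> \<chi>) ^ 2 / of_nat n" using n by (simp add: \<Delta>_def)
    moreover have "csqrt (\<Delta> \<chi>) \<in> ?N" using \<chi> gens_subset_adjoin[of ?S \<rat>] by auto
    ultimately show ?thesis by (simp only:) (intro N.divide_mem N.power_mem N.of_nat_mem)
  qed
  then have "K \<subseteq> ?N" unfolding K_def
    using gens_subset_adjoin[of ?S \<rat>] by (intro adjoin_Rats_subset adjoin_subfield) (auto simp: gens_def)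
  then show "?N' \<subseteq> ?N"
    using gens_subset_adjoin[of ?S \<rat>] by (intro adjoin_least adjoin_subfield) auto
qed

definition radicands :: "complex set" where
  "radicands = {\<Delta> \<chi> | \<chi>. \<chi> \<in> irr_chars G \<and> \<Delta> \<chi> \<noteq> 0}"

lemma radicands_subset: "radicands \<subseteq> K - {0}"
  using \<Delta>_mem_K by (auto simp: radicands_def)

lemma splitting_field_radicands: "splitting_field \<Gamma> = adjoin K (csqrt ` radicands)"
  unfolding splitting_field_eq_K
proof (rule antisym)
  interpret N: complex_subfield "adjoin K (csqrt ` radicands)" by (rule adjoin_subfield)
  have "csqrt (\<Delta> \<chi>) \<in> adjoin K (csqrt ` radicands)" if "\<chi> \<in> irr_chars G" for \<chi>
  proof (cases "\<Delta> \<chi> = 0")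
    case True
    then show ?thesis by (simp only: csqrt_0 N.zero_mem)
  next
    case False
    then show ?thesis using that gens_subset_adjoin[of "csqrt ` radicands" K] by (auto simp: radicands_def)
  qed
  then show "adjoin K ((\<lambda>\<chi>. csqrt (\<Delta> \<chi>)) ` irr_chars G) \<subseteq> adjoin K (csqrt ` radicands)"
    using base_subset_adjoin[of K "csqrt ` radicands"] by (intro adjoin_least adjoin_subfield) auto
  show "adjoin K (csqrt ` radicands) \<subseteq> adjoin K ((\<lambda>\<chi>. csqrt (\<Delta> \<chi>)) ` irr_chars G)"
    using base_subset_adjoin[of K] gens_subset_adjoin[of "(\<lambda>\<chi>. csqrt (\<Delta> \<chi>)) ` irr_chars G" K]
    by (intro adjoin_least adjoin_subfield) (auto simp: radicands_def)
qed

text \<open>Each of the finitely many eigenvalues comes from some character; the radicands of one such character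
  per eigenvalue already generate the splitting field over \<open>K\<close>.\<close>

lemma splitting_field_dimension:
  "ext_dim (card (K.square_class_span radicands)) K (splitting_field \<Gamma>)"
proof -
  let ?Sp = "spectrum (adjacency_matrix \<Gamma>)"
  have "\<forall>c\<in>?Sp. \<exists>\<chi>. \<chi> \<in> irr_chars G \<and> c \<in> eigenvalues \<chi>"
    using spectrum_semi_cayley by blast
  then obtain pick where pick: "\<forall>c\<in>?Sp. pick c \<in> irr_chars G \<and> c \<in> eigenvalues (pick c)"
    by (subst (asm) bchoice_iff) blast
  define S0 where "S0 = (\<lambda>c. \<Delta> (pick c)) ` ?Sp - {0}"
  have "finite ?Sp"
    by (rule card_finite_spectrum(1)[where n = "length (vertex_list \<Gamma>)"])
      (simp add: adjacency_matrix_def Let_def)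
  then have fin_S0: "finite S0" by (simp add: S0_def)
  have S0: "S0 \<subseteq> radicands" using pick by (auto simp: S0_def radicands_def)
  interpret N: complex_subfield "adjoin K (csqrt ` S0)" by (rule adjoin_subfield)
  have KN: "K \<subseteq> adjoin K (csqrt ` S0)" by (rule base_subset_adjoin)
  have "c \<in> adjoin K (csqrt ` S0)" if c: "c \<in> ?Sp" for c
  proof -
    have \<chi>: "pick c \<in> irr_chars G" and ev: "c \<in> eigenvalues (pick c)" using pick c by auto
    obtain n :: nat where n: "pick c \<one> = of_nat n" using char_degree[OF \<chi>] by blast
    have a: "char_sum (pick c) I1 \<in> adjoin K (csqrt ` S0)"
      using \<chi> gens_subset_adjoin[of gens \<rat>] KN by (auto simp: K_def gens_def)
    have b: "csqrt (\<Delta> (pick c)) \<in> adjoin K (csqrt ` S0)"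
    proof (cases "\<Delta> (pick c) = 0")
      case True
      then show ?thesis by (simp only: csqrt_0 N.zero_mem)
    next
      case False
      then show ?thesis using c gens_subset_adjoin[of "csqrt ` S0" K] by (auto simp: S0_def)
    qed
    show ?thesis
      using ev unfolding eigenvalues_def n insert_iff empty_iff
      by (elim disjE FalseE ssubst) (intro N.divide_mem N.mult_mem N.add_mem N.diff_mem N.numeral_mem N.of_nat_mem a b)+
  qed
  then have "splitting_field \<Gamma> \<subseteq> adjoin K (csqrt ` S0)"
    unfolding splitting_field_def by (intro adjoin_Rats_subset adjoin_subfield) auto
  then have "csqrt ` radicands \<subseteq> adjoin K (csqrt ` S0)"
    unfolding splitting_field_radicands using gens_subset_adjoin[of "csqrt ` radicands" K] by auto
  then show ?thesis unfolding splitting_field_radicands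
    by (rule K.multiquadratic_dimension[OF radicands_subset fin_S0 S0])
qed

theorem algebraic_degree_eq:
  "real (algebraic_degree \<Gamma>) = real (totient m) * real (card (K.square_class_span radicands)) / real (card T)"
proof -
  obtain k where k: "ext_dim k \<rat> K" "k * card T = totient m" by (rule K_dimension)
  have sQ: "subfield \<rat> complex_field" and sK: "subfield K complex_field"
    using Rats_subfield K.complex_subfield_axioms by (auto simp: complex_subfield_iff)
  have "ext_dim (k * card (K.square_class_span radicands)) \<rat> (splitting_field \<Gamma>)"
    by (rule ring.telescopic_base[OF ring_complex sQ sK k(1) splitting_field_dimension])
  then have d: "algebraic_degree \<Gamma> = k * card (K.square_class_span radicands)"
    using ring.dimI[OF ring_complex sQ] by (simp add: algebraic_degree_def ext_degree_def over_def)
  have "m > 0" using prim by (simp add: primitive_root_of_unity_def)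
  then have "card T \<noteq> 0" using k(2) by (metis mult_0_right totient_gt_0_iff less_irrefl)
  then show ?thesis unfolding d k(2)[symmetric] by simp
qed

end

theorem theorem3p7:
  fixes G :: "('a, 'b) monoid_scheme"
    and T11 T22 T12 T21 :: "'a set"
    and \<Gamma> :: "('a + 'a) pair_pre_digraph"
    and m :: nat and \<omega> :: complex
    and I1 I2 I3 :: "'a multiset"
    and \<delta> \<Delta> :: "('a \<Rightarrow> complex) \<Rightarrow> complex"
    and T :: "nat set" and K :: "complex set" and M :: "complex set set"
  assumes "group G" and "finite (carrier G)"
    and "T11 \<subseteq> carrier G" and "T22 \<subseteq> carrier G" and "T12 \<subseteq> carrier G" and "T21 \<subseteq> carrier G"
    and "quasi_abelian G T11 T22 T12 T21"
    and "\<Gamma> = semi_cayley G T11 T22 T12 T21"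
    and "m = group_exponent G"
    and "primitive_root_of_unity m \<omega>"
    and "I1 = mset_set T11 + mset_set T22"
    and "I2 = mset_prod G (mset_set T11) (mset_set T11) + mset_prod G (mset_set T22) (mset_set T22)
              + repeat_mset 4 (mset_prod G (mset_set T12) (mset_set T21))"
    and "I3 = repeat_mset 2 (mset_prod G (mset_set T11) (mset_set T22))"
    and "T = {t \<in> totatives m. mset_pow G I1 t = I1 \<and>
                mset_pow G (I2 - I3) t = I2 - I3 \<and> mset_pow G (I3 - I2) t = I3 - I2}"
    and "\<delta> = (\<lambda>\<chi>. char_sum \<chi> (I2 - I3) - char_sum \<chi> (I3 - I2))"
    and "\<Delta> = (\<lambda>\<chi>. \<chi> \<one>\<^bsub>G\<^esub> * \<delta> \<chi>)"
    and "K = adjoin \<rat> ((\<lambda>\<chi>. char_sum \<chi> I1) ` irr_chars G \<union> \<delta> ` irr_chars G)"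
    and "M = generate (square_class_group K) (square_class K ` {\<Delta> \<chi> | \<chi>. \<chi> \<in> irr_chars G \<and> \<Delta> \<chi> \<noteq> 0})"
  shows "K = {x \<in> adjoin \<rat> {\<omega>}.
               \<forall>\<sigma> \<in> {\<sigma> \<in> galois_group (adjoin \<rat> {\<omega>}) \<rat>. cyclotomic_char m \<omega> \<sigma> \<in> T}. \<sigma> x = x}
       \<and> splitting_field \<Gamma> =
           adjoin \<rat> ((\<lambda>\<chi>. char_sum \<chi> I1) ` irr_chars G \<union> (\<lambda>\<chi>. csqrt (\<Delta> \<chi>)) ` irr_chars G)
       \<and> splitting_field \<Gamma> = adjoin K ((\<lambda>\<chi>. csqrt (\<Delta> \<chi>)) ` irr_chars G)
       \<and> real (algebraic_degree \<Gamma>) = real (totient m) * real (card M) / real (card T)"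
proof -
  interpret S: semi_cayley_cyclotomic G T11 T22 T12 T21 m \<omega>
    using assms(1-7,9,10)
    by (simp add: semi_cayley_cyclotomic_def semi_cayley_cyclotomic_axioms_def quasi_abelian_semi_cayley_def
        quasi_abelian_semi_cayley_axioms_def finite_group_def finite_group_axioms_def)
  have I: "I1 = S.I1" "I2 = S.I2" "I3 = S.I3"
    by (simp_all add: assms(11-13) S.I1_def S.I2_def S.I3_def)
  have T: "T = S.T" unfolding assms(14) I S.T_def ..
  have \<delta>: "\<delta> = S.\<delta>" unfolding assms(15) I by (rule ext) (simp add: S.\<delta>_def)
  have \<Delta>: "\<Delta> = S.\<Delta>" unfolding assms(16) \<delta> by (rule ext) (simp add: S.\<Delta>_def)
  have K: "K = S.K" unfolding assms(17) \<delta> I S.K_def S.gens_def ..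
  have M: "M = S.K.square_class_span S.radicands"
    unfolding assms(18) K \<Delta> S.K.square_class_span_def S.radicands_def ..
  show ?thesis
    unfolding K T M I \<Delta> assms(8)
    using S.K_fixed_field S.splitting_field_eq S.splitting_field_eq_K S.algebraic_degree_eq by blast
qed

end
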